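(* Let $(S^2,g)$ be a two-dimensional real analytic Riemannian surface (that is, $g$ is a real analytic Riemannian metric on the two-sphere $S^2$). Suppose that $p\in S^2$ is a self-focal point, with first return time $T_p$, and that the first return map $\eta_p:S^*_pS^2\to S^*_pS^2$ preserves a probability measure which is in $L^1(S^*_pS^2)$, i.e. there is $\rho\in L^1(S^*_pS^2,\mu_p)$, $\rho\ge 0$, such that $\rho\,d\mu_p$ is a probability measure with $\eta_p^*(\rho\,d\mu_p)=\rho\,d\mu_p$. Then $\eta_p^2=\eta_p\circ\eta_p$ is the identity map of $S^*_pS^2$, and in particular all geodesics through $p$ are smoothly closed with the common period $2T_p$ (every unit speed geodesic $\gamma$ with $\gamma(0)=p$ satisfies $\gamma(2T_p)=p$ and $\gamma'(2T_p)=\gamma'(0)$).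
   Context: Let $M=S^2$. Let $\eta_t$ denote the homogeneous geodesic flow, i.e. the Hamilton flow on $T^*M\setminus 0$ generated by $H(x,\xi)=|\xi|_g$; it preserves the unit cosphere bundle $S^*M=\{|\xi|_g=1\}$, and $S^*_pM$ denotes the fiber over $p$, a circle. $\mu_p$ is the measure on $S^*_pM$ induced by the Euclidean metric $g_p$. A point $p\in M$ is self-focal if there exists a time $\ell>0$ such that $\eta_\ell(p,\xi)\in S^*_pM$ for all $\xi\in S^*_pM$. The minimal such $\ell$ is denoted $T_p$ and called the first return time. The first return map $\eta_p:S^*_pM\to S^*_pM$ is defined by $\eta_{T_p}(p,\xi)=(p,\eta_p(\xi))$; it is a real analytic diffeomorphism of the circle $S^*_pM$. *)

theory Defs
  imports "HOL-Probability.Probability"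
begin

text \<open>
  The manifold is the unit sphere of \<open>real^3\<close> with its standard real analytic structure.
  A metric is a function \<open>g\<close> with \<open>g x u v\<close> the inner product of the tangent vectors \<open>u\<close>, \<open>v\<close>
  at \<open>x\<close>; its values off the sphere or on non-tangent vectors are irrelevant.
\<close>

type_synonym metric = "real^3 \<Rightarrow> real^3 \<Rightarrow> real^3 \<Rightarrow> real"

type_synonym phase = "(real^3) \<times> (real^3)"

abbreviation S2 :: "(real^3) set" where
  "S2 \<equiv> sphere 0 1"

definition tangent_plane :: "real^3 \<Rightarrow> (real^3) set" where
  "tangent_plane x = {v. v \<bullet> x = 0}"

definition riemannian_metric :: "metric \<Rightarrow> bool" where
  "riemannian_metric g \<longleftrightarrow> (\<forall>x\<in>S2.
     (\<forall>u\<in>tangent_plane x. \<forall>v\<in>tangent_plane x. g x u v = g x v u) \<and>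
     (\<forall>u\<in>tangent_plane x. \<forall>v\<in>tangent_plane x. \<forall>w\<in>tangent_plane x. \<forall>a b.
        g x (a *\<^sub>R u + b *\<^sub>R v) w = a * g x u w + b * g x v w) \<and>
     (\<forall>u\<in>tangent_plane x. u \<noteq> 0 \<longrightarrow> 0 < g x u u))"

text \<open>
  Real analyticity: near each point the function is the sum of a power series indexed by
  multi-indices \<open>\<alpha>\<close>, which are functions from \<open>Basis\<close> to the natural numbers.
\<close>

definition real_analytic_on :: "('a::euclidean_space) set \<Rightarrow> ('a \<Rightarrow> real) \<Rightarrow> bool" where
  "real_analytic_on U f \<longleftrightarrow> (\<forall>a\<in>U. \<exists>r>0. \<exists>c :: ('a \<Rightarrow> nat) \<Rightarrow> real. \<forall>h. norm h < r \<longrightarrow>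
     ((\<lambda>\<alpha>. c \<alpha> * (\<Prod>b\<in>Basis. (h \<bullet> b) ^ \<alpha> b)) has_sum f (a + h)) (Basis \<rightarrow>\<^sub>E UNIV))"

text \<open>
  For \<open>s = 1\<close> and \<open>s = - 1\<close> these are the inverses of the stereographic projections from
  \<open>(0, 0, 1)\<close> and \<open>(0, 0, -1)\<close>, which form an analytic atlas of the sphere.
\<close>

definition stereo :: "real \<Rightarrow> real^2 \<Rightarrow> real^3" where
  "stereo s y = (1 / ((norm y)\<^sup>2 + 1)) *\<^sub>R vector [2 * y $ 1, 2 * y $ 2, s * ((norm y)\<^sup>2 - 1)]"

definition metric_coeff :: "metric \<Rightarrow> real \<Rightarrow> 2 \<Rightarrow> 2 \<Rightarrow> real^2 \<Rightarrow> real" where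
  "metric_coeff g s i j y =
     g (stereo s y) (frechet_derivative (stereo s) (at y) (axis i 1))
                    (frechet_derivative (stereo s) (at y) (axis j 1))"

definition real_analytic_metric :: "metric \<Rightarrow> bool" where
  "real_analytic_metric g \<longleftrightarrow> riemannian_metric g \<and>
     (\<forall>s\<in>{1, - 1}. \<forall>i j. real_analytic_on UNIV (metric_coeff g s i j))"

text \<open>
  A covector at \<open>x\<close> is represented by the vector \<open>\<xi>\<close> of the tangent plane for which it is the
  functional \<open>v \<mapsto> \<xi> \<bullet> v\<close> (Euclidean inner product, independent of \<open>g\<close>). Under this identification
  the cotangent bundle is \<open>{(x, \<xi>). norm x = 1 \<and> \<xi> \<bullet> x = 0}\<close>, and its tautological one-form is
  the restriction of \<open>\<xi> \<bullet> dx\<close>.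
\<close>

definition cotangent_nonzero :: "phase set" where
  "cotangent_nonzero = {(x, \<xi>). x \<in> S2 \<and> \<xi> \<in> tangent_plane x \<and> \<xi> \<noteq> 0}"

definition sharp :: "metric \<Rightarrow> real^3 \<Rightarrow> real^3 \<Rightarrow> real^3" where
  "sharp g x \<xi> = (THE v. v \<in> tangent_plane x \<and> (\<forall>w\<in>tangent_plane x. g x v w = \<xi> \<bullet> w))"

definition cometric :: "metric \<Rightarrow> real^3 \<Rightarrow> real^3 \<Rightarrow> real^3 \<Rightarrow> real" where
  "cometric g x \<xi> \<zeta> = g x (sharp g x \<xi>) (sharp g x \<zeta>)"

definition hamiltonian :: "metric \<Rightarrow> phase \<Rightarrow> real" where
  "hamiltonian g = (\<lambda>(x, \<xi>). sqrt (cometric g x \<xi> \<xi>))"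

definition cosphere_bundle :: "metric \<Rightarrow> phase set" where
  "cosphere_bundle g = {z \<in> cotangent_nonzero. hamiltonian g z = 1}"

definition cosphere_fiber :: "metric \<Rightarrow> real^3 \<Rightarrow> (real^3) set" where
  "cosphere_fiber g p = {\<xi>. (p, \<xi>) \<in> cosphere_bundle g}"

text \<open>
  The tangent space of the cotangent bundle at \<open>(x, \<xi>)\<close> comes from differentiating
  \<open>x \<bullet> x = 1\<close> and \<open>\<xi> \<bullet> x = 0\<close>.
\<close>

definition phase_tangent :: "phase \<Rightarrow> phase set" where
  "phase_tangent = (\<lambda>(x, \<xi>). {(a, \<alpha>). a \<bullet> x = 0 \<and> \<alpha> \<bullet> x + \<xi> \<bullet> a = 0})"

text \<open>
  With this sign, Hamilton's equations in canonical coordinates read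
  \<open>x' = \<partial>H/\<partial>\<xi>\<close>, \<open>\<xi>' = - \<partial>H/\<partial>x\<close>.
\<close>

definition symplectic_form :: "phase \<Rightarrow> phase \<Rightarrow> real" where
  "symplectic_form = (\<lambda>(a, \<alpha>) (b, \<beta>). a \<bullet> \<beta> - \<alpha> \<bullet> b)"

text \<open>
  \<open>X\<close> is the value at \<open>z\<close> of the Hamilton vector field of \<open>H\<close>. The derivative \<open>D\<close> of \<open>H\<close> along
  the cotangent bundle is determined on tangent vectors only, and only these are used.
\<close>

definition hamilton_vector :: "metric \<Rightarrow> phase \<Rightarrow> phase \<Rightarrow> bool" where
  "hamilton_vector g z X \<longleftrightarrow> X \<in> phase_tangent z \<and>
     (\<exists>D. (hamiltonian g has_derivative D) (at z within cotangent_nonzero) \<and>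
          (\<forall>Y\<in>phase_tangent z. symplectic_form X Y = D Y))"

definition hamilton_curve :: "metric \<Rightarrow> (real \<Rightarrow> phase) \<Rightarrow> bool" where
  "hamilton_curve g c \<longleftrightarrow> (\<forall>t. c t \<in> cotangent_nonzero \<and>
     (\<exists>X. hamilton_vector g (c t) X \<and> (c has_vector_derivative X) (at t)))"

definition geodesic_flow :: "metric \<Rightarrow> real \<Rightarrow> phase \<Rightarrow> phase" where
  "geodesic_flow g t z = (THE c. hamilton_curve g c \<and> c 0 = z) t"

text \<open>
  Geodesics are the projections to the sphere of orbits of the geodesic flow. On the cosphere
  bundle Hamilton's equations give \<open>x' = sharp g x \<xi>\<close>, so \<open>g\<close>-speed one corresponds to
  \<open>|\<xi>|\<^sub>g = 1\<close>.
\<close>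

definition unit_speed_geodesic :: "metric \<Rightarrow> (real \<Rightarrow> real^3) \<Rightarrow> bool" where
  "unit_speed_geodesic g \<gamma> \<longleftrightarrow>
     (\<exists>c. hamilton_curve g c \<and> (\<forall>t. c t \<in> cosphere_bundle g) \<and> \<gamma> = fst \<circ> c)"

definition is_return_time :: "metric \<Rightarrow> real^3 \<Rightarrow> real \<Rightarrow> bool" where
  "is_return_time g p l \<longleftrightarrow> l > 0 \<and>
     (\<forall>\<xi>\<in>cosphere_fiber g p. geodesic_flow g l (p, \<xi>) \<in> {p} \<times> cosphere_fiber g p)"

definition self_focal :: "metric \<Rightarrow> real^3 \<Rightarrow> bool" where
  "self_focal g p \<longleftrightarrow> (\<exists>l. is_return_time g p l)"

definition first_return_time :: "metric \<Rightarrow> real^3 \<Rightarrow> real" where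
  "first_return_time g p = (LEAST l. is_return_time g p l)"

definition first_return_map :: "metric \<Rightarrow> real^3 \<Rightarrow> real^3 \<Rightarrow> real^3" where
  "first_return_map g p \<xi> = snd (geodesic_flow g (first_return_time g p) (p, \<xi>))"

text \<open>
  Arc length on the unit circle of the Euclidean plane \<open>(T\<^sup>*\<^sub>p, g\<^sub>p)\<close>, as the image of Lebesgue
  measure under \<open>\<theta> \<mapsto> cos \<theta> e + sin \<theta> f\<close> for an orthonormal basis \<open>e, f\<close>. It does not depend on
  the choice of the basis.
\<close>

definition orthonormal_coframe :: "metric \<Rightarrow> real^3 \<Rightarrow> (real^3) \<times> (real^3) \<Rightarrow> bool" where
  "orthonormal_coframe g p = (\<lambda>(e, f). e \<in> tangent_plane p \<and> f \<in> tangent_plane p \<and>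
     cometric g p e e = 1 \<and> cometric g p f f = 1 \<and> cometric g p e f = 0)"

definition cosphere_measure :: "metric \<Rightarrow> real^3 \<Rightarrow> (real^3) measure" where
  "cosphere_measure g p = (case (SOME b. orthonormal_coframe g p b) of (e, f) \<Rightarrow>
     distr (restrict_space lborel {0..<2*pi}) (restrict_space borel (cosphere_fiber g p))
       (\<lambda>\<theta>. cos \<theta> *\<^sub>R e + sin \<theta> *\<^sub>R f))"

text \<open>
  \<open>f\<^sup>* \<nu> = \<nu>\<close>, where the pullback of a measure by a diffeomorphism \<open>f\<close> is
  \<open>A \<mapsto> \<nu> (f ` A)\<close>.
\<close>

definition pullback_invariant :: "('a \<Rightarrow> 'a) \<Rightarrow> 'a measure \<Rightarrow> bool" where
  "pullback_invariant f \<nu> \<longleftrightarrow> (\<forall>A\<in>sets \<nu>. emeasure \<nu> (f ` A) = emeasure \<nu> A)"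

end

theory Submission
  imports Defs "HOL-Complex_Analysis.Complex_Analysis"
begin

text \<open>
  Let \<open>\<eta>\<close> be the first return map. Time reversal gives \<open>\<eta> (- \<eta> \<xi>) = - \<xi>\<close>. If \<open>\<eta>\<close> preserves
  orientation, this makes the rotation number of \<open>\<eta>\<^sup>2\<close> vanish, and if \<open>\<eta>\<close> reverses orientation it
  has a fixed point; in both cases \<open>\<eta>\<^sup>2\<close> preserves orientation and has a fixed point \<open>\<xi>\<^sub>0\<close>. Cut
  the circle at \<open>\<xi>\<^sub>0\<close> and let \<open>Q\<close> be the increasing map of the interval given by \<open>\<eta>\<^sup>2\<close>. An invariant
  finite measure gives the arcs from \<open>q\<close> and from \<open>Q q\<close> to the end point equal mass, so it vanishes
  between \<open>q\<close> and \<open>Q q\<close> and is carried by the fixed points of \<open>\<eta>\<^sup>2\<close>. By reversibility these are the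
  zeros of \<open>\<xi> \<mapsto> \<eta> \<xi> + \<eta> (- \<xi>)\<close>, which is real analytic, hence finitely many unless \<open>\<eta>\<^sup>2\<close> is the
  identity; a measure with a density does not charge a finite set.

  Analyticity of \<open>\<eta>\<close> is analytic dependence of the flow on its initial point. The flow is that of a
  real analytic vector field on an open subset of \<open>real^3 \<times> real^3\<close>, the Hamilton field of the energy
  \<open>\<bar>x\<bar>\<^sup>2 \<bar>\<xi>\<bar>\<^sup>2 / 2\<close> with \<open>\<bar>\<xi>\<bar>\<close> the norm at \<open>x / \<bar>x\<bar>\<close>, which extends the energy on the cotangent
  bundle so as to be invariant under \<open>\<xi> \<mapsto> \<xi> + r x\<close> and \<open>(x, \<xi>) \<mapsto> (r x, \<xi> / r)\<close>; its Hamilton field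
  is therefore tangent to the cotangent bundle.
\<close>

section \<open>Complexification of real analytic functions\<close>

text \<open>Reversibility says that the inverse of \<eta> is its conjugate by the antipode of the
  fibre. On a circle the antipode is a rotation, so for an orientation preserving \<eta> the
  rotation number equals its own negative modulo 1, and doubling it for the square of \<eta> gives
  0. If \<eta> reverses orientation, its degree alone forces a fixed point.

  The main obstacle is that the flow is given only by a definite description, while its dependence
  on the initial covector must be analytic. Power series are therefore traded at once for complex
  extensions. Euler polygons are finite compositions, so they stay holomorphic in the parameter, and
  Montel's theorem carries this to the limit. To work with solutions on the whole real line, the
  field is cut off away from the compact cosphere bundle. The cutoff is a scalar factor, so the
  first integrals of the field survive it and hold the solutions on the bundle.\<close>

text \<open>
  Points of the complexification of \<open>'a\<close> are pairs \<open>(u, v)\<close>, standing for \<open>u + \<i> v\<close>. Holomorphy in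
  several variables is replaced by holomorphy along all holomorphic curves, which is closed under
  composition and locally uniform limits by definition.
\<close>

definition cpx_coord :: "'a::euclidean_space \<Rightarrow> 'a \<times> 'a \<Rightarrow> complex" where
  "cpx_coord b z = Complex (fst z \<bullet> b) (snd z \<bullet> b)"

definition cscale :: "complex \<Rightarrow> 'a \<times> 'a \<Rightarrow> 'a::euclidean_space \<times> 'a" where
  "cscale w d = (Re w *\<^sub>R fst d - Im w *\<^sub>R snd d, Im w *\<^sub>R fst d + Re w *\<^sub>R snd d)"

text \<open>Tested against every vector \<open>b\<close>, so that linear projections of a
  holomorphic curve are immediate; \<open>holo_curve_BasisI\<close> reduces the test to a
  basis.\<close>

definition holo_curve :: "complex set \<Rightarrow> (complex \<Rightarrow> 'a::euclidean_space \<times> 'a) \<Rightarrow> bool" where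
  "holo_curve W z \<longleftrightarrow> (\<forall>b. (\<lambda>w. cpx_coord b (z w)) holomorphic_on W)"

definition curvewise_holo :: "('a::euclidean_space \<times> 'a) set \<Rightarrow> ('a \<times> 'a \<Rightarrow> complex) \<Rightarrow> bool" where
  "curvewise_holo U F \<longleftrightarrow>
     (\<forall>W z. open W \<longrightarrow> holo_curve W z \<longrightarrow> z ` W \<subseteq> U \<longrightarrow> (\<lambda>w. F (z w)) holomorphic_on W)"

lemma cpx_coord_add: "cpx_coord b (x + y) = cpx_coord b x + cpx_coord b y"
  by (simp add: cpx_coord_def inner_add_left complex_eq_iff)

lemma cpx_coord_diff: "cpx_coord b (x - y) = cpx_coord b x - cpx_coord b y"
  by (simp add: cpx_coord_def inner_diff_left complex_eq_iff)

lemma cpx_coord_scaleR: "cpx_coord b (r *\<^sub>R x) = of_real r * cpx_coord b x"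
  by (simp add: cpx_coord_def complex_eq_iff)

lemma cpx_coord_cscale: "cpx_coord b (cscale w d) = w * cpx_coord b d"
  by (simp add: cpx_coord_def cscale_def complex_eq_iff inner_add_left inner_diff_left)

lemma cpx_coord_real: "cpx_coord b (x, 0) = of_real (x \<bullet> b)"
  by (simp add: cpx_coord_def complex_eq_iff)

text \<open>The Euclidean norm of a pair is the Hermitian norm of the complexification: the mixed
  terms in \<open>u \<bullet> v\<close> cancel.\<close>

lemma norm_cscale: "norm (cscale w d) = cmod w * norm d"
proof -
  obtain u v where d: "d = (u, v)" by fastforce
  have 1: "(norm (Re w *\<^sub>R u - Im w *\<^sub>R v))\<^sup>2 =
      (Re w)\<^sup>2 * (norm u)\<^sup>2 + (Im w)\<^sup>2 * (norm v)\<^sup>2 - 2 * (Re w * Im w * (u \<bullet> v))"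
    unfolding power2_norm_eq_inner
    by (simp add: inner_diff inner_commute algebra_simps power2_eq_square)
  have 2: "(norm (Im w *\<^sub>R u + Re w *\<^sub>R v))\<^sup>2 =
      (Im w)\<^sup>2 * (norm u)\<^sup>2 + (Re w)\<^sup>2 * (norm v)\<^sup>2 + 2 * (Re w * Im w * (u \<bullet> v))"
    unfolding power2_norm_eq_inner
    by (simp add: inner_add inner_commute algebra_simps power2_eq_square)
  have "(norm (cscale w d))\<^sup>2 = (cmod w * norm d)\<^sup>2"
    unfolding d cscale_def norm_prod_def cmod_def fst_conv snd_conv 1 2 power_mult_distrib
    by (simp add: algebra_simps)
  then show ?thesis by (simp add: power2_eq_iff_nonneg)
qed

lemma norm_cpx_coord_le: "norm (cpx_coord b z) \<le> norm z * norm b"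
proof -
  have 1: "\<bar>fst z \<bullet> b\<bar> \<le> norm (fst z) * norm b" "\<bar>snd z \<bullet> b\<bar> \<le> norm (snd z) * norm b"
    by (rule Cauchy_Schwarz_ineq2)+
  have "(norm (cpx_coord b z))\<^sup>2 = \<bar>fst z \<bullet> b\<bar>\<^sup>2 + \<bar>snd z \<bullet> b\<bar>\<^sup>2"
    by (simp add: cpx_coord_def cmod_def)
  also have "\<dots> \<le> (norm (fst z) * norm b)\<^sup>2 + (norm (snd z) * norm b)\<^sup>2"
    using 1 by (intro add_mono power_mono) auto
  also have "\<dots> = (norm z * norm b)\<^sup>2"
    by (simp add: norm_prod_def power_mult_distrib algebra_simps)
  finally show ?thesis
    by (rule power2_le_imp_le) simp
qed

lemma continuous_on_cpx_coord [continuous_intros]: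
  "continuous_on S f \<Longrightarrow> continuous_on S (\<lambda>x. cpx_coord b (f x))"
  unfolding cpx_coord_def Complex_eq by (intro continuous_intros) auto

lemma holo_curve_add: "holo_curve W y \<Longrightarrow> holo_curve W z \<Longrightarrow> holo_curve W (\<lambda>w. y w + z w)"
  unfolding holo_curve_def by (simp add: cpx_coord_add holomorphic_on_add)

lemma holo_curve_const: "holo_curve W (\<lambda>w. c)"
  unfolding holo_curve_def by simp

lemma holo_curve_scaleR: "holo_curve W z \<Longrightarrow> holo_curve W (\<lambda>w. r *\<^sub>R z w)"
  unfolding holo_curve_def by (auto simp: cpx_coord_scaleR intro!: holomorphic_intros)

lemma holo_curve_line: "holo_curve W (\<lambda>w. c + cscale w d)"
  unfolding holo_curve_def by (auto simp: cpx_coord_add cpx_coord_cscale intro!: holomorphic_intros)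

lemma holo_curve_BasisI:
  assumes "\<And>b. b \<in> Basis \<Longrightarrow> (\<lambda>w. cpx_coord b (z w)) holomorphic_on W"
  shows "holo_curve W z"
  unfolding holo_curve_def
proof
  fix v
  have "cpx_coord v x = (\<Sum>b\<in>Basis. of_real (v \<bullet> b) * cpx_coord b x)" for x :: "'a \<times> 'a"
    unfolding cpx_coord_def complex_eq_iff
    by (simp add: euclidean_inner[of _ v] mult.commute)
  then show "(\<lambda>w. cpx_coord v (z w)) holomorphic_on W"
    by (auto intro!: holomorphic_intros assms)
qed

lemma continuous_on_holo_curve:
  assumes "holo_curve W z" shows "continuous_on W z"
proof -
  have z: "z w = (\<Sum>b\<in>Basis. Re (cpx_coord b (z w)) *\<^sub>R b, \<Sum>b\<in>Basis. Im (cpx_coord b (z w)) *\<^sub>R b)" for w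
    by (simp add: cpx_coord_def euclidean_representation)
  have "continuous_on W (\<lambda>w. (\<Sum>b\<in>Basis. Re (cpx_coord b (z w)) *\<^sub>R b, \<Sum>b\<in>Basis. Im (cpx_coord b (z w)) *\<^sub>R b))"
    using assms unfolding holo_curve_def
    by (intro continuous_on_Pair continuous_on_sum continuous_on_scaleR continuous_on_Re
        continuous_on_Im continuous_on_const) (simp_all add: holomorphic_on_imp_continuous_on)
  then show ?thesis using z by (simp only: flip: z)
qed

subsection \<open>Cauchy estimates\<close>

text \<open>Discs of radius \<open>R/4\<close> about points of the half ball stay in the ball; the
  Cauchy inequality on them gives the factor 4.\<close>

lemma deriv_bound_half_ball:
  assumes "f holomorphic_on ball 0 R" "0 < R" "\<And>w. w \<in> ball 0 R \<Longrightarrow> norm (f w) \<le> B"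
    and u: "u \<in> ball 0 (R/2)"
  shows "norm (deriv f u) \<le> 4 * B / R"
proof -
  have sub: "cball u (R/4) \<subseteq> ball 0 R"
  proof
    fix x assume "x \<in> cball u (R/4)"
    then have "norm (x - u) \<le> R/4" by (simp add: dist_norm norm_minus_commute)
    moreover have "norm x \<le> norm (x - u) + norm u" using norm_triangle_ineq[of "x-u" u] by simp
    ultimately show "x \<in> ball 0 R" using u assms(2) by (simp add: dist_norm)
  qed
  have "norm ((deriv ^^ 1) f u) \<le> fact 1 * B / (R/4)^1"
  proof (rule Cauchy_inequality)
    show "f holomorphic_on ball u (R/4)"
      using assms(1) sub ball_subset_cball holomorphic_on_subset by blast
    show "continuous_on (cball u (R/4)) f"
      using assms(1) sub holomorphic_on_imp_continuous_on continuous_on_subset by blast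
    show "0 < R/4" using assms by simp
    show "norm (f x) \<le> B" if "norm (u - x) = R/4" for x
      using that sub assms(3) by (auto simp: dist_norm)
  qed
  then show ?thesis by (simp add: field_simps)
qed

lemma holo_lipschitz_at_0:
  assumes "f holomorphic_on ball 0 R" "0 < R" "\<And>w. w \<in> ball 0 R \<Longrightarrow> norm (f w) \<le> B"
    and h: "norm h < R/2"
  shows "norm (f h - f 0) \<le> 4 * B / R * norm h"
proof -
  have "norm (f h - f 0) \<le> 4 * B / R * norm (h - 0)"
  proof (rule field_differentiable_bound[of "ball 0 (R/2)" f "deriv f"])
    fix z :: complex assume "z \<in> ball 0 (R/2)"
    then show "(f has_field_derivative deriv f z) (at z within ball 0 (R/2))"
      using assms(1,2) by (intro DERIV_subset[OF holomorphic_derivI[of f "ball 0 R"]]) auto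
  qed (use assms deriv_bound_half_ball in auto)
  then show ?thesis by simp
qed

text \<open>The remainder has derivative \<open>deriv f u - deriv f 0\<close>. Since
  \<open>deriv f\<close> is bounded by \<open>4 * B / R\<close> on the half ball, the Lipschitz
  bound applied to it gives \<open>4 * (4 * B / R) / (R/2)\<close>, which is the constant
  32.\<close>

lemma holo_taylor1_at_0:
  assumes f: "f holomorphic_on ball 0 R" "0 < R" "\<And>w. w \<in> ball 0 R \<Longrightarrow> norm (f w) \<le> B"
    and h: "norm h < R/4"
  shows "norm (f h - f 0 - h * deriv f 0) \<le> 32 * B / R\<^sup>2 * (norm h)\<^sup>2"
proof -
  have f': "deriv f holomorphic_on ball 0 (R/2)"
    using holomorphic_deriv[OF f(1)] f(2) by (auto intro: holomorphic_on_subset)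
  have B: "0 \<le> B" using f(2) f(3)[of 0] norm_ge_zero order_trans by (metis centre_in_ball)
  define g where "g = (\<lambda>u. f u - u * deriv f 0)"
  have "norm (g h - g 0) \<le> (32 * B / R\<^sup>2 * norm h) * norm (h - 0)"
  proof (rule field_differentiable_bound[of "cball 0 (norm h)" g "\<lambda>u. deriv f u - deriv f 0"])
    fix z :: complex assume z: "z \<in> cball 0 (norm h)"
    then have zR: "norm z < R / 4" using h by simp
    show "(g has_field_derivative deriv f z - deriv f 0) (at z within cball 0 (norm h))"
      unfolding g_def using f(1,2) zR
      by (auto intro!: derivative_eq_intros DERIV_subset[OF holomorphic_derivI[of f "ball 0 R"]])
    have "norm (deriv f z - deriv f 0) \<le> 4 * (4 * B / R) / (R/2) * norm z"
      by (rule holo_lipschitz_at_0[OF f']) (use f zR deriv_bound_half_ball[OF f] in auto)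
    also have "\<dots> = 32 * B / R\<^sup>2 * norm z" by (simp add: power2_eq_square)
    also have "\<dots> \<le> 32 * B / R\<^sup>2 * norm h"
      using z B by (intro mult_left_mono) auto
    finally show "norm (deriv f z - deriv f 0) \<le> 32 * B / R\<^sup>2 * norm h" .
  qed (use assms in auto)
  moreover have "g h - g 0 = f h - f 0 - h * deriv f 0" by (simp add: g_def)
  ultimately show ?thesis by (simp add: power2_eq_square mult.assoc)
qed

lemma curvewise_holo_line:
  assumes "curvewise_holo (ball z0 R) F" "norm d = 1" "z \<in> ball z0 (R/2)"
  shows "(\<lambda>w. F (z + cscale w d)) holomorphic_on ball 0 (R/2)"
    and "\<And>w. w \<in> ball 0 (R/2) \<Longrightarrow> z + cscale w d \<in> ball z0 R"
proof -
  show *: "\<And>w. w \<in> ball 0 (R/2) \<Longrightarrow> z + cscale w d \<in> ball z0 R"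
  proof -
    fix w :: complex assume w: "w \<in> ball 0 (R/2)"
    have "dist z0 (z + cscale w d) \<le> dist z0 z + norm (cscale w d)"
      by (metis dist_triangle dist_add_cancel add.right_neutral dist_0_norm)
    also have "\<dots> < R" using w assms(2,3) by (simp add: norm_cscale dist_norm)
    finally show "z + cscale w d \<in> ball z0 R" by simp
  qed
  show "(\<lambda>w. F (z + cscale w d)) holomorphic_on ball 0 (R/2)"
    using assms(1)[unfolded curvewise_holo_def, rule_format, OF open_ball holo_curve_line] *
    by blast
qed

text \<open>Restrict \<open>F\<close> to the complex line through \<open>x\<close> and
  \<open>y\<close>. The two points are less than \<open>R/4\<close> apart, which is half the radius
  \<open>R/2\<close> of the disc on which the restriction is holomorphic.\<close>

lemma curvewise_holo_lipschitz:
  assumes F: "curvewise_holo (ball z0 R) F" and R: "0 < R"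
    and B: "\<And>z. z \<in> ball z0 R \<Longrightarrow> norm (F z) \<le> B"
    and xy: "x \<in> ball z0 (R/8)" "y \<in> ball z0 (R/8)"
  shows "norm (F y - F x) \<le> 8 * B / R * norm (y - x)"
proof (cases "x = y")
  case False
  define d where "d = (1 / norm (y - x)) *\<^sub>R (y - x)"
  have d: "norm d = 1" using False by (simp add: d_def)
  have xR: "x \<in> ball z0 (R/2)" using xy R by auto
  have "norm (y - x) \<le> dist z0 x + dist z0 y"
    using dist_triangle[of y x z0] by (simp add: dist_norm[symmetric] dist_commute)
  then have n: "norm (y - x) < R/4" using xy by simp
  have y: "y = x + cscale (of_real (norm (y - x))) d"
    using False by (simp add: cscale_def d_def prod_eq_iff)
  define f where "f = (\<lambda>w. F (x + cscale w d))"
  have "norm (f (of_real (norm (y - x))) - f 0) \<le> 4 * B / (R/2) * norm (complex_of_real (norm (y - x)))"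
    by (rule holo_lipschitz_at_0)
      (use curvewise_holo_line[OF F d xR] B R n in \<open>auto simp: f_def\<close>)
  moreover have "f (of_real (norm (y - x))) = F y" using y by (simp add: f_def)
  moreover have "f 0 = F x" by (simp add: f_def cscale_def zero_prod_def[symmetric])
  ultimately show ?thesis by (simp add: field_simps)
qed simp

definition cdir_deriv :: "('a::euclidean_space \<times> 'a \<Rightarrow> complex) \<Rightarrow> 'a \<times> 'a \<Rightarrow> 'a \<times> 'a \<Rightarrow> complex" where
  "cdir_deriv F d z = deriv (\<lambda>w. F (z + cscale w d)) 0"

lemma cscale_0 [simp]: "cscale 0 d = 0"
  by (simp add: cscale_def zero_prod_def)

lemma cdir_deriv_taylor:
  assumes F: "curvewise_holo (ball z0 R) F" and R: "0 < R"
    and B: "\<And>z. z \<in> ball z0 R \<Longrightarrow> norm (F z) \<le> B"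
    and d: "norm d = 1" and z: "z \<in> ball z0 (R/2)" and h: "norm h < R/8"
  shows "norm (F (z + cscale h d) - F z - h * cdir_deriv F d z) \<le> 128 * B / R\<^sup>2 * (norm h)\<^sup>2"
proof -
  have "norm ((\<lambda>w. F (z + cscale w d)) h - (\<lambda>w. F (z + cscale w d)) 0 - h * deriv (\<lambda>w. F (z + cscale w d)) 0)
     \<le> 32 * B / (R/2)\<^sup>2 * (norm h)\<^sup>2"
    by (rule holo_taylor1_at_0) (use curvewise_holo_line[OF F d z] B R h in auto)
  then show ?thesis by (simp add: cdir_deriv_def field_simps)
qed

lemma cdir_deriv_bound:
  assumes F: "curvewise_holo (ball z0 R) F" and R: "0 < R"
    and B: "\<And>z. z \<in> ball z0 R \<Longrightarrow> norm (F z) \<le> B"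
    and d: "norm d = 1" and z: "z \<in> ball z0 (R/2)"
  shows "norm (cdir_deriv F d z) \<le> 8 * B / R"
proof -
  have "norm (deriv (\<lambda>w. F (z + cscale w d)) 0) \<le> 4 * B / (R/2)"
    by (rule deriv_bound_half_ball) (use curvewise_holo_line[OF F d z] B R in auto)
  then show ?thesis by (simp add: cdir_deriv_def)
qed

text \<open>Along a curve the difference quotients are holomorphic, and
  \<open>cdir_deriv_taylor\<close> bounds their distance from the derivative by a multiple of the
  step, uniformly on \<open>W\<close>. Passing to the uniform limit takes the place of a chain rule
  in several variables.\<close>

lemma curvewise_holo_cdir_deriv:
  assumes F: "curvewise_holo (ball z0 R) F" and R: "0 < R"
    and B: "\<And>z. z \<in> ball z0 R \<Longrightarrow> norm (F z) \<le> B" and d: "norm d = 1"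
  shows "curvewise_holo (ball z0 (R/2)) (cdir_deriv F d)"
  unfolding curvewise_holo_def
proof (intro allI impI)
  fix W and z :: "complex \<Rightarrow> 'a \<times> 'a"
  assume W: "open W" and z: "holo_curve W z" "z ` W \<subseteq> ball z0 (R/2)"
  \<comment> \<open>The 9 keeps every step, also the one for \<open>n = 0\<close>, strictly below
    the \<open>R/8\<close> demanded by \<open>cdir_deriv_taylor\<close>.\<close>
  define h where "h n = R / (9 * (real n + 1))" for n :: nat
  have h0: "h n > 0" for n using R by (simp add: h_def)
  have h8: "norm (complex_of_real (h n)) < R/8" for n
  proof -
    have "R * 8 < R * (9 * (real n + 1))" using R by (intro mult_strict_left_mono) auto
    moreover have "norm (complex_of_real (h n)) = h n" using h0[of n] by simp
    moreover have "8 * h n < R" using R \<open>R * 8 < _\<close> by (simp add: h_def field_simps)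
    ultimately show ?thesis by simp
  qed
  have hlim: "h \<longlonglongrightarrow> 0" unfolding h_def by real_asymp
  have B0: "0 \<le> B" using B[of z0] R norm_ge_zero order_trans by (metis centre_in_ball)
  define f where "f n w = (F (z w + cscale (of_real (h n)) d) - F (z w)) / of_real (h n)" for n w
  have sub: "(\<lambda>w. z w + cscale (of_real (h n)) d) ` W \<subseteq> ball z0 R" for n
  proof (rule image_subsetI)
    fix w assume "w \<in> W"
    then have "z w \<in> ball z0 (R/2)" using z(2) by auto
    moreover have "complex_of_real (h n) \<in> ball 0 (R/2)" using h8[of n] R by simp
    ultimately show "z w + cscale (of_real (h n)) d \<in> ball z0 R"
      by (rule curvewise_holo_line(2)[OF F d])
  qed
  have est: "norm (f n w - cdir_deriv F d (z w)) \<le> 128 * B / R\<^sup>2 * h n" if "w \<in> W" for n w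
  proof -
    have "norm (F (z w + cscale (of_real (h n)) d) - F (z w) - of_real (h n) * cdir_deriv F d (z w))
        \<le> 128 * B / R\<^sup>2 * (h n)\<^sup>2"
      using cdir_deriv_taylor[OF F R B d _ h8[of n], of "z w"] that z(2) by auto
    moreover have "f n w - cdir_deriv F d (z w) =
        (F (z w + cscale (of_real (h n)) d) - F (z w) - of_real (h n) * cdir_deriv F d (z w)) / of_real (h n)"
      using h0[of n] by (simp add: f_def field_simps)
    ultimately have "norm (f n w - cdir_deriv F d (z w)) * h n \<le> (128 * B / R\<^sup>2 * h n) * h n"
      using h0[of n] by (simp add: norm_divide power2_eq_square mult.assoc)
    then show ?thesis using h0[of n] by (rule mult_right_le_imp_le)
  qed
  have lim: "uniform_limit W f (\<lambda>w. cdir_deriv F d (z w)) sequentially"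
  proof (rule uniform_limitI)
    fix e :: real assume e: "0 < e"
    have "(\<lambda>n. 128 * B / R\<^sup>2 * h n) \<longlonglongrightarrow> 128 * B / R\<^sup>2 * 0"
      by (intro tendsto_intros hlim)
    then have "\<forall>\<^sub>F n in sequentially. 128 * B / R\<^sup>2 * h n < e"
      using e order_tendstoD(2) by fastforce
    then show "\<forall>\<^sub>F n in sequentially. \<forall>w\<in>W. dist (f n w) (cdir_deriv F d (z w)) < e"
      by (rule eventually_mono) (use est in \<open>auto simp: dist_norm intro: le_less_trans\<close>)
  qed
  show "(\<lambda>w. cdir_deriv F d (z w)) holomorphic_on W"
  proof (rule holomorphic_uniform_sequence[OF W])
    show "f n holomorphic_on W" for n
    proof -
      have 1: "(\<lambda>w. F (z w + cscale (of_real (h n)) d)) holomorphic_on W"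
        using F W sub[of n] holo_curve_add[OF z(1) holo_curve_const] unfolding curvewise_holo_def by blast
      have "z ` W \<subseteq> ball z0 R" using z(2) R by force
      then have 2: "(\<lambda>w. F (z w)) holomorphic_on W"
        using F W z(1) unfolding curvewise_holo_def by blast
      show ?thesis unfolding f_def using 1 2 h0[of n] by (intro holomorphic_intros) auto
    qed
    show "\<exists>e>0. cball x e \<subseteq> W \<and> uniform_limit (cball x e) f (\<lambda>w. cdir_deriv F d (z w)) sequentially"
      if "x \<in> W" for x
      using that W lim open_contains_cball uniform_limit_on_subset by metis
  qed
qed

subsection \<open>Real analytic functions through their complex extensions\<close>

text \<open>Continuity is demanded alongside curvewise holomorphy: it gives the local bounds behind
  the Cauchy estimates, and it lets balls be shrunk until extensions can be composed.\<close>

definition cpx_ext :: "('a::euclidean_space \<Rightarrow> real) \<Rightarrow> 'a \<Rightarrow> real \<Rightarrow> ('a \<times> 'a \<Rightarrow> complex) \<Rightarrow> bool" where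
  "cpx_ext f a r F \<longleftrightarrow> 0 < r \<and> curvewise_holo (ball (a, 0) r) F \<and> continuous_on (ball (a, 0) r) F \<and>
     (\<forall>x\<in>ball a r. F (x, 0) = of_real (f x))"

definition ranalytic_at :: "('a::euclidean_space \<Rightarrow> real) \<Rightarrow> 'a \<Rightarrow> bool" where
  "ranalytic_at f a \<longleftrightarrow> (\<exists>r F. cpx_ext f a r F)"

lemma real_mem_ball: "(x, 0) \<in> ball (a, 0) r \<longleftrightarrow> x \<in> ball a r"
  by (simp add: dist_prod_def)

lemma curvewise_holo_subset: "curvewise_holo U F \<Longrightarrow> V \<subseteq> U \<Longrightarrow> curvewise_holo V F"
  unfolding curvewise_holo_def by blast

lemma cpx_ext_mono: "cpx_ext f a r F \<Longrightarrow> 0 < s \<Longrightarrow> s \<le> r \<Longrightarrow> cpx_ext f a s F"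
  unfolding cpx_ext_def
  by (auto elim: continuous_on_subset curvewise_holo_subset)

lemma cpx_ext_pos: "cpx_ext f a r F \<Longrightarrow> 0 < r"
  by (simp add: cpx_ext_def)

lemma ranalytic_at_cong:
  assumes f: "ranalytic_at f a" and e: "0 < e" and eq: "\<And>x. x \<in> ball a e \<Longrightarrow> g x = f x"
  shows "ranalytic_at g a"
proof -
  obtain r F where F: "cpx_ext f a r F" using f unfolding ranalytic_at_def by blast
  have "cpx_ext f a (min r e) F" using e cpx_ext_pos[OF F] by (intro cpx_ext_mono[OF F]) auto
  then have "cpx_ext g a (min r e) F" using eq unfolding cpx_ext_def by auto
  then show ?thesis unfolding ranalytic_at_def by blast
qed

lemma ranalytic_at_const: "ranalytic_at (\<lambda>x. c) a"
  unfolding ranalytic_at_def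
  by (rule exI[of _ 1], rule exI[of _ "\<lambda>z. of_real c"]) (simp add: cpx_ext_def curvewise_holo_def)

lemma ranalytic_at_inner: "ranalytic_at (\<lambda>x. x \<bullet> v) a"
  unfolding ranalytic_at_def
  by (rule exI[of _ 1], rule exI[of _ "cpx_coord v"])
    (auto simp: cpx_ext_def curvewise_holo_def holo_curve_def cpx_coord_real intro!: continuous_intros)

lemma ranalytic_at_common:
  assumes "ranalytic_at f a" "ranalytic_at g a"
  obtains r F G where "cpx_ext f a r F" "cpx_ext g a r G"
proof -
  obtain r F s G where F: "cpx_ext f a r F" and G: "cpx_ext g a s G"
    using assms unfolding ranalytic_at_def by blast
  have "cpx_ext f a (min r s) F" "cpx_ext g a (min r s) G"
    using cpx_ext_pos[OF F] cpx_ext_pos[OF G] by (auto intro: cpx_ext_mono[OF F] cpx_ext_mono[OF G])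
  then show ?thesis by (rule that)
qed

lemma ranalytic_at_add:
  assumes "ranalytic_at f a" "ranalytic_at g a"
  shows "ranalytic_at (\<lambda>x. f x + g x) a"
proof -
  obtain r F G where "cpx_ext f a r F" "cpx_ext g a r G"
    using ranalytic_at_common[OF assms] .
  then have "cpx_ext (\<lambda>x. f x + g x) a r (\<lambda>z. F z + G z)"
    unfolding cpx_ext_def curvewise_holo_def
    by (simp add: continuous_on_add continuous_on_mult holomorphic_on_add holomorphic_on_mult)
  then show ?thesis unfolding ranalytic_at_def by blast
qed

lemma ranalytic_at_mult:
  assumes "ranalytic_at f a" "ranalytic_at g a"
  shows "ranalytic_at (\<lambda>x. f x * g x) a"
proof -
  obtain r F G where "cpx_ext f a r F" "cpx_ext g a r G"
    using ranalytic_at_common[OF assms] .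
  then have "cpx_ext (\<lambda>x. f x * g x) a r (\<lambda>z. F z * G z)"
    unfolding cpx_ext_def curvewise_holo_def
    by (simp add: continuous_on_add continuous_on_mult holomorphic_on_add holomorphic_on_mult)
  then show ?thesis unfolding ranalytic_at_def by blast
qed

lemma ranalytic_at_minus: "ranalytic_at f a \<Longrightarrow> ranalytic_at (\<lambda>x. - f x) a"
  using ranalytic_at_mult[OF ranalytic_at_const[of "-1"]] by simp

lemma ranalytic_at_diff:
  "ranalytic_at f a \<Longrightarrow> ranalytic_at g a \<Longrightarrow> ranalytic_at (\<lambda>x. f x - g x) a"
  using ranalytic_at_add[of f a "\<lambda>x. - g x"] ranalytic_at_minus[of g a] by simp

lemma ranalytic_at_power: "ranalytic_at f a \<Longrightarrow> ranalytic_at (\<lambda>x. f x ^ n) a"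
  by (induction n) (auto intro: ranalytic_at_const ranalytic_at_mult)

text \<open>The coordinate extensions are assembled into one map of complexifications. The radius
  \<open>d\<close> serves two purposes: in compositions it is the domain of the outer extension, and
  for a vector field \<open>d = 1\<close> bounds the speed.\<close>

lemma ranalytic_map_extension:
  fixes G :: "'a::euclidean_space \<Rightarrow> 'b::euclidean_space"
  assumes G: "\<And>b. b \<in> Basis \<Longrightarrow> ranalytic_at (\<lambda>x. G x \<bullet> b) a" and d: "0 < d"
  obtains r H where "0 < r" "continuous_on (ball (a, 0) r) H" "\<And>x. x \<in> ball a r \<Longrightarrow> H (x, 0) = (G x, 0)"
    "\<And>W z. open W \<Longrightarrow> holo_curve W z \<Longrightarrow> z ` W \<subseteq> ball (a, 0) r \<Longrightarrow> holo_curve W (\<lambda>w. H (z w))"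
    "\<And>z. z \<in> ball (a, 0) r \<Longrightarrow> H z \<in> ball (G a, 0) d"
proof -
  obtain s K where K: "\<And>b. b \<in> Basis \<Longrightarrow> cpx_ext (\<lambda>x. G x \<bullet> b) a (s b) (K b)"
    using G unfolding ranalytic_at_def by metis
  define r0 where "r0 = Min (s ` (Basis :: 'b set))"
  have s0: "s b > 0" if "b \<in> Basis" for b using K[OF that] by (simp add: cpx_ext_def)
  have r0: "0 < r0" unfolding r0_def using s0 by (subst Min_gr_iff) auto
  have K': "cpx_ext (\<lambda>x. G x \<bullet> b) a r0 (K b)" if "b \<in> Basis" for b
    by (rule cpx_ext_mono[OF K[OF that] r0]) (use that in \<open>auto simp: r0_def\<close>)
  define H where "H z = (\<Sum>b\<in>Basis. Re (K b z) *\<^sub>R b, \<Sum>b\<in>Basis. Im (K b z) *\<^sub>R b)" for z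
  have Hc: "cpx_coord b (H z) = K b z" if "b \<in> Basis" for b z
    using that by (simp add: H_def cpx_coord_def complex_eq_iff)
  have Hr: "H (x, 0) = (G x, 0)" if "x \<in> ball a r0" for x
    using K' that unfolding H_def cpx_ext_def by (simp add: euclidean_representation)
  have Hcont: "continuous_on (ball (a, 0) r0) H"
    unfolding H_def using K'
    by (intro continuous_on_Pair continuous_on_sum continuous_on_scaleR continuous_on_Re
        continuous_on_Im continuous_on_const) (simp_all add: cpx_ext_def)
  have "isCont H (a, 0)"
    using Hcont r0 by (simp add: continuous_on_eq_continuous_at)
  then obtain e where e: "e > 0" "\<And>z. dist z (a, 0) < e \<Longrightarrow> dist (H z) (H (a, 0)) < d"
    using d unfolding continuous_at_eps_delta by blast
  define r1 where "r1 = min e r0"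
  have r1: "0 < r1" "r1 \<le> r0" using e r0 by (auto simp: r1_def)
  have sub: "ball (a, 0) r1 \<subseteq> ball (a, 0) r0" using r1 by auto
  show ?thesis
  proof (rule that[OF r1(1)])
    show "continuous_on (ball (a, 0) r1) H" using Hcont sub by (rule continuous_on_subset)
    show "H (x, 0) = (G x, 0)" if "x \<in> ball a r1" for x using that r1 by (intro Hr) auto
    show "H z \<in> ball (G a, 0) d" if "z \<in> ball (a, 0) r1" for z
      using e(2)[of z] that Hr[of a] r0 by (simp add: r1_def dist_commute)
    fix W and z :: "complex \<Rightarrow> 'a \<times> 'a"
    assume W: "open W" "holo_curve W z" "z ` W \<subseteq> ball (a, 0) r1"
    show "holo_curve W (\<lambda>w. H (z w))"
    proof (rule holo_curve_BasisI)
      fix b :: 'b assume b: "b \<in> Basis"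
      have "z ` W \<subseteq> ball (a, 0) r0" using W(3) sub by blast
      then have "(\<lambda>w. K b (z w)) holomorphic_on W"
        using K'[OF b] W(1,2) unfolding cpx_ext_def curvewise_holo_def by blast
      then show "(\<lambda>w. cpx_coord b (H (z w))) holomorphic_on W" using Hc[OF b] by simp
    qed
  qed
qed

lemma ranalytic_at_compose:
  fixes G :: "'a::euclidean_space \<Rightarrow> 'b::euclidean_space"
  assumes G: "\<And>b. b \<in> Basis \<Longrightarrow> ranalytic_at (\<lambda>x. G x \<bullet> b) a" and f: "ranalytic_at f (G a)"
  shows "ranalytic_at (\<lambda>x. f (G x)) a"
proof -
  obtain d F where F: "cpx_ext f (G a) d F" using f unfolding ranalytic_at_def by blast
  obtain r H where r: "0 < r" and H: "continuous_on (ball (a, 0) r) H"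
    "\<And>x. x \<in> ball a r \<Longrightarrow> H (x, 0) = (G x, 0)"
    "\<And>W z. open W \<Longrightarrow> holo_curve W z \<Longrightarrow> z ` W \<subseteq> ball (a, 0) r \<Longrightarrow> holo_curve W (\<lambda>w. H (z w))"
    "\<And>z. z \<in> ball (a, 0) r \<Longrightarrow> H z \<in> ball (G a, 0) d"
    using ranalytic_map_extension[OF G cpx_ext_pos[OF F]] by blast
  have "cpx_ext (\<lambda>x. f (G x)) a r (\<lambda>z. F (H z))"
    unfolding cpx_ext_def
  proof (intro conjI ballI)
    show "curvewise_holo (ball (a, 0) r) (\<lambda>z. F (H z))"
      unfolding curvewise_holo_def
    proof (intro allI impI)
      fix W and z :: "complex \<Rightarrow> 'a \<times> 'a"
      assume W: "open W" "holo_curve W z" "z ` W \<subseteq> ball (a, 0) r"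
      have "(\<lambda>w. H (z w)) ` W \<subseteq> ball (G a, 0) d" using H(4) W(3) by blast
      then show "(\<lambda>w. F (H (z w))) holomorphic_on W"
        using F W(1) H(3)[OF W] unfolding cpx_ext_def curvewise_holo_def by blast
    qed
    show "continuous_on (ball (a, 0) r) (\<lambda>z. F (H z))"
    proof (rule continuous_on_compose2[of "ball (G a, 0) d" F])
      show "continuous_on (ball (G a, 0) d) F" using F by (simp add: cpx_ext_def)
      show "H ` ball (a, 0) r \<subseteq> ball (G a, 0) d" using H(4) by blast
    qed (rule H(1))
    show "F (H (x, 0)) = of_real (f (G x))" if "x \<in> ball a r" for x
    proof -
      have "H (x, 0) \<in> ball (G a, 0) d" using that by (intro H(4)) (simp only: real_mem_ball)
      then show ?thesis using F H(2)[OF that] unfolding cpx_ext_def by (metis real_mem_ball)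
    qed
  qed (rule r)
  then show ?thesis unfolding ranalytic_at_def by blast
qed

text \<open>Supplies reciprocals and square roots, with \<open>h\<close> a one-variable holomorphic
  function extending \<open>k\<close>.\<close>

lemma ranalytic_at_holo_compose:
  assumes f: "ranalytic_at f a" and S: "open S" "complex_of_real (f a) \<in> S" and h: "h holomorphic_on S"
    and eq: "\<And>x. complex_of_real x \<in> S \<Longrightarrow> h (of_real x) = of_real (k x)"
  shows "ranalytic_at (\<lambda>x. k (f x)) a"
proof -
  obtain r F where F: "cpx_ext f a r F" using f unfolding ranalytic_at_def by blast
  then have r: "0 < r" by (simp add: cpx_ext_def)
  have Fa: "F (a, 0) = of_real (f a)" using F r by (simp add: cpx_ext_def)
  obtain d where d: "d > 0" "ball (complex_of_real (f a)) d \<subseteq> S"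
    using S open_contains_ball by blast
  have "isCont F (a, 0)"
    using F r by (simp add: cpx_ext_def continuous_on_eq_continuous_at)
  then obtain e where e: "e > 0" "\<And>z. dist z (a, 0) < e \<Longrightarrow> dist (F z) (F (a, 0)) < d"
    using d(1) unfolding continuous_at_eps_delta by blast
  define r1 where "r1 = min e r"
  have r1: "0 < r1" "r1 \<le> r" using e r by (auto simp: r1_def)
  have F1: "cpx_ext f a r1 F" using cpx_ext_mono[OF F r1] .
  have into: "F z \<in> S" if "z \<in> ball (a, 0) r1" for z
    using e(2)[of z] that Fa d(2) by (auto simp: r1_def dist_commute)
  have "cpx_ext (\<lambda>x. k (f x)) a r1 (\<lambda>z. h (F z))"
    unfolding cpx_ext_def
  proof (intro conjI ballI)
    show "curvewise_holo (ball (a, 0) r1) (\<lambda>z. h (F z))"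
      unfolding curvewise_holo_def
    proof (intro allI impI)
      fix W and z :: "complex \<Rightarrow> 'a \<times> 'a"
      assume W: "open W" "holo_curve W z" "z ` W \<subseteq> ball (a, 0) r1"
      have 1: "(\<lambda>w. F (z w)) holomorphic_on W"
        using F1 W unfolding cpx_ext_def curvewise_holo_def by blast
      show "(\<lambda>w. h (F (z w))) holomorphic_on W"
      proof -
        have "(\<lambda>w. F (z w)) ` W \<subseteq> S" using into W(3) by blast
        then show ?thesis using holomorphic_on_compose_gen[OF 1 h] by (simp add: o_def)
      qed
    qed
    show "continuous_on (ball (a, 0) r1) (\<lambda>z. h (F z))"
    proof (rule continuous_on_compose2[of S h])
      show "continuous_on S h" by (rule holomorphic_on_imp_continuous_on[OF h])
      show "continuous_on (ball (a, 0) r1) F" using F1 by (simp add: cpx_ext_def)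
      show "F ` ball (a, 0) r1 \<subseteq> S" using into by blast
    qed
    show "h (F (x, 0)) = of_real (k (f x))" if "x \<in> ball a r1" for x
    proof -
      have "F (x, 0) = of_real (f x)" using F1 that by (simp add: cpx_ext_def)
      moreover have "F (x, 0) \<in> S" using that by (intro into) (simp only: real_mem_ball)
      ultimately show ?thesis using eq by metis
    qed
  qed (use r1 in auto)
  then show ?thesis unfolding ranalytic_at_def by blast
qed

lemma ranalytic_at_inverse:
  assumes "ranalytic_at f a" "f a \<noteq> 0" shows "ranalytic_at (\<lambda>x. inverse (f x)) a"
  by (rule ranalytic_at_holo_compose[OF assms(1), of "- {0}" inverse])
    (use assms in \<open>auto intro!: holomorphic_intros\<close>)

lemma ranalytic_at_divide:
  assumes "ranalytic_at f a" "ranalytic_at g a" "g a \<noteq> 0"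
  shows "ranalytic_at (\<lambda>x. f x / g x) a"
  using ranalytic_at_mult[OF assms(1) ranalytic_at_inverse[OF assms(2,3)]] by (simp add: divide_inverse)

lemma ranalytic_at_sqrt:
  assumes "ranalytic_at f a" "0 < f a" shows "ranalytic_at (\<lambda>x. sqrt (f x)) a"
proof (rule ranalytic_at_holo_compose[OF assms(1), of "- \<real>\<^sub>\<le>\<^sub>0" csqrt])
  show "open (- (\<real>\<^sub>\<le>\<^sub>0 :: complex set))" using closed_nonpos_Reals_complex by blast
  show "csqrt holomorphic_on - \<real>\<^sub>\<le>\<^sub>0" by (auto intro!: holomorphic_intros)
qed (use assms in \<open>auto simp: complex_nonpos_Reals_iff\<close>)

lemma cpx_ext_bounded:
  assumes F: "cpx_ext f a r F"
  obtains s B where "cpx_ext f a s F" "s \<le> r" "\<And>z. z \<in> ball (a, 0) s \<Longrightarrow> norm (F z) \<le> B"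
proof -
  have r: "0 < r" using F by (simp add: cpx_ext_def)
  have "isCont F (a, 0)" using F r by (simp add: cpx_ext_def continuous_on_eq_continuous_at)
  then obtain e where e: "e > 0" "\<And>z. dist z (a, 0) < e \<Longrightarrow> dist (F z) (F (a, 0)) < 1"
    unfolding continuous_at_eps_delta using zero_less_one[where 'a = real] by blast
  have "norm (F z) \<le> norm (F (a, 0)) + 1" if "z \<in> ball (a, 0) (min e r)" for z
  proof -
    have "dist (F z) (F (a, 0)) < 1" using e(2) that by (simp add: dist_commute)
    then show ?thesis using norm_triangle_ineq2[of "F z" "F (a, 0)"] by (simp add: dist_norm)
  qed
  moreover have "cpx_ext f a (min e r) F" using e(1) r by (intro cpx_ext_mono[OF F]) auto
  ultimately show ?thesis by (intro that[of "min e r" "norm (F (a, 0)) + 1"]) auto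
qed

lemma curvewise_holo_continuous:
  assumes F: "curvewise_holo (ball z0 R) F" and R: "0 < R"
    and B: "\<And>z. z \<in> ball z0 R \<Longrightarrow> norm (F z) \<le> B"
  shows "continuous_on (ball z0 (R/8)) F"
proof (rule lipschitz_on_continuous_on)
  have "0 \<le> B" using B[of z0] R norm_ge_zero order_trans by (metis centre_in_ball)
  then show "(8 * B / R)-lipschitz_on (ball z0 (R/8)) F"
    using curvewise_holo_lipschitz[OF F R B] R
    by (auto simp: lipschitz_on_def dist_norm)
qed

lemma ranalytic_at_lipschitz:
  assumes "ranalytic_at f a"
  obtains e L where "0 < e" "L-lipschitz_on (ball a e) f"
proof -
  obtain r0 F0 where "cpx_ext f a r0 F0" using assms unfolding ranalytic_at_def by blast
  then obtain r F B where F: "cpx_ext f a r F" and B: "\<And>z. z \<in> ball (a, 0) r \<Longrightarrow> norm (F z) \<le> B"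
    by (rule cpx_ext_bounded) blast
  have r: "0 < r" and c: "curvewise_holo (ball (a, 0) r) F" using F by (auto simp: cpx_ext_def)
  have B0: "0 \<le> B" using B[of "(a, 0)"] r norm_ge_zero order_trans by (metis centre_in_ball)
  have "(8 * B / r)-lipschitz_on (ball a (r/8)) f"
    unfolding lipschitz_on_def
  proof (intro conjI ballI)
    fix x y assume xy: "x \<in> ball a (r/8)" "y \<in> ball a (r/8)"
    have "norm (F (x, 0) - F (y, 0)) \<le> 8 * B / r * norm ((x, 0) - (y, 0::'a))"
      by (rule curvewise_holo_lipschitz[OF c r B]) (use xy in \<open>auto simp only: real_mem_ball\<close>)
    moreover have "F (x, 0) = of_real (f x)" "F (y, 0) = of_real (f y)"
      using F xy r by (auto simp: cpx_ext_def)
    ultimately show "dist (f x) (f y) \<le> 8 * B / r * dist x y"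
      by (simp add: dist_norm norm_prod_def flip: of_real_diff)
  qed (use r B0 in auto)
  then show ?thesis using that[of "r/8"] r by simp
qed

section \<open>Derivatives of real analytic functions\<close>

lemma cdir_deriv_scaleR:
  assumes F: "curvewise_holo (ball z0 R) F" and d: "norm d = 1" and z: "z \<in> ball z0 (R/2)" and R: "0 < R"
  shows "cdir_deriv F (s *\<^sub>R d) z = of_real s * cdir_deriv F d z"
proof -
  define g where "g w = F (z + cscale w d)" for w
  have "g holomorphic_on ball 0 (R/2)"
    unfolding g_def by (rule curvewise_holo_line(1)[OF F d z])
  then have g: "(g has_field_derivative deriv g 0) (at (of_real s * 0))"
    using R by (auto intro: holomorphic_derivI)
  have eq: "(\<lambda>w. F (z + cscale w (s *\<^sub>R d))) = (\<lambda>w. g (of_real s * w))"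
    unfolding g_def cscale_def by (auto simp: algebra_simps)
  have "((\<lambda>w. g (of_real s * w)) has_field_derivative deriv g 0 * of_real s) (at 0)"
    by (rule DERIV_chain2[where f = g and g = "\<lambda>w. of_real s * w" and x = 0, OF g])
      (auto intro!: derivative_eq_intros)
  then show ?thesis
    unfolding cdir_deriv_def eq by (simp add: DERIV_imp_deriv g_def[abs_def])
qed

lemma real_linear_bound_zero:
  fixes x C e :: real
  assumes "0 < e" "\<And>h. 0 < h \<Longrightarrow> h < e \<Longrightarrow> \<bar>x\<bar> \<le> C * h"
  shows "x = 0"
proof -
  have "((\<lambda>h. C * h) \<longlongrightarrow> C * 0) (at_right 0)"
    by (intro tendsto_intros)
  moreover have "\<forall>\<^sub>F h in at_right 0. \<bar>x\<bar> \<le> C * h"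
    using assms by (auto simp: eventually_at_right_field intro!: exI[of _ e])
  ultimately have "\<bar>x\<bar> \<le> C * 0"
    by (intro tendsto_lowerbound[of "\<lambda>h. C * h"]) auto
  then show ?thesis by simp
qed

text \<open>Bookkeeping for the additivity of the derivative: \<open>A\<close>, \<open>B\<close>,
  \<open>F\<close> are the values of a function at \<open>x + h *\<^sub>R (u + v)\<close>,
  \<open>x + h *\<^sub>R u\<close> and \<open>x\<close>, the letters \<open>P\<close>,
  \<open>Q\<close>, \<open>R\<close> are the linear terms, and \<open>S\<close> is \<open>R\<close>
  with its base point moved to \<open>x\<close>.\<close>

lemma abs_diff_chain:
  fixes A B F P Q R S :: real
  assumes "\<bar>A - F - P\<bar> \<le> E" "\<bar>B - F - Q\<bar> \<le> E" "\<bar>A - B - R\<bar> \<le> E" "\<bar>R - S\<bar> \<le> G"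
  shows "\<bar>P - Q - S\<bar> \<le> 3 * E + G"
  using assms by linarith

lemma norm_Pair_0: "norm (u, 0) = norm u"
  by (simp add: norm_prod_def)

lemma cscale_real: "(x, 0) + cscale (of_real h) (u, 0) = (x + h *\<^sub>R u, 0)"
  by (simp add: cscale_def)

text \<open>The candidate for the derivative is the complex directional derivative in real
  directions. It is homogeneous and satisfies a quadratic Taylor bound, and its components again
  have complex extensions. The work lies in additivity, because the estimates on complex lines treat
  one direction at a time.\<close>

theorem ranalytic_at_has_derivative:
  fixes f :: "'a::euclidean_space \<Rightarrow> real"
  assumes "ranalytic_at f a"
  obtains e f' where "0 < e" "\<And>x. x \<in> ball a e \<Longrightarrow> (f has_derivative f' x) (at x)"
    "\<And>b. b \<in> Basis \<Longrightarrow> ranalytic_at (\<lambda>x. f' x b) a"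
proof -
  obtain r0 F0 where "cpx_ext f a r0 F0" using assms unfolding ranalytic_at_def by blast
  then obtain R F B where F: "cpx_ext f a R F" and B: "\<And>z. z \<in> ball (a, 0) R \<Longrightarrow> norm (F z) \<le> B"
    by (rule cpx_ext_bounded) blast
  have R: "0 < R" and c: "curvewise_holo (ball (a, 0) R) F" using F by (auto simp: cpx_ext_def)
  have Fr: "F (x, 0) = of_real (f x)" if "x \<in> ball a R" for x using F that by (simp add: cpx_ext_def)
  have B0: "0 \<le> B" using B[of "(a, 0)"] R norm_ge_zero order_trans by (metis centre_in_ball)
  define C where "C = 128 * B / R\<^sup>2"
  have C0: "0 \<le> C" using B0 by (simp add: C_def)
  define D where "D u x = cdir_deriv F (u, 0) (x, 0)" for u x :: 'a
  have D_scale: "D (s *\<^sub>R u) x = of_real s * D u x" if "norm u = 1" "x \<in> ball a (R/2)" for s u x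
    unfolding D_def
    using cdir_deriv_scaleR[OF c, of "(u, 0)" "(x, 0)" s] that R
    by (simp only: norm_Pair_0 real_mem_ball) simp
  have D_norm: "D u x = of_real (norm u) * D ((1 / norm u) *\<^sub>R u) x" if "u \<noteq> 0" "x \<in> ball a (R/2)" for u x
    using D_scale[of "(1 / norm u) *\<^sub>R u" x "norm u"] that by simp
  have D_0: "D 0 x = 0" for x
    by (simp add: D_def cdir_deriv_def cscale_def zero_prod_def[symmetric])
  have taylor1: "norm (of_real (f (x + h *\<^sub>R u)) - of_real (f x) - of_real h * D u x) \<le> C * h\<^sup>2"
    if u: "norm u = 1" and x: "x \<in> ball a (R/2)" and h: "\<bar>h\<bar> < R/8" for x u h
  proof -
    have x2: "(x, 0) \<in> ball (a, 0) (R/2)" using x by (simp only: real_mem_ball)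
    have u2: "norm (u, 0::'a) = 1" using u by (simp add: norm_Pair_0)
    have "norm (F ((x, 0) + cscale (of_real h) (u, 0)) - F (x, 0) - of_real h * cdir_deriv F (u, 0) (x, 0))
       \<le> 128 * B / R\<^sup>2 * (norm (complex_of_real h))\<^sup>2"
      by (rule cdir_deriv_taylor[OF c R B u2 x2]) (use h in auto)
    moreover have "x + h *\<^sub>R u \<in> ball a R"
    proof -
      have "dist a (x + h *\<^sub>R u) \<le> dist a x + norm (h *\<^sub>R u)"
        by (metis dist_triangle dist_add_cancel add.right_neutral dist_0_norm)
      then show ?thesis using x h u R by simp
    qed
    moreover have "x \<in> ball a R" using x R by simp
    ultimately show ?thesis by (simp only: cscale_real Fr C_def D_def) simp
  qed
  \<comment> \<open>For a real step \<open>h\<close> all other terms in the Taylor bound are real,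
    so \<open>h\<close> times the imaginary part is at most \<open>C * h\<^sup>2\<close>.\<close>
  have Im_D: "D u x = of_real (Re (D u x))" if "x \<in> ball a (R/2)" for u x
  proof (cases "u = 0")
    case False
    define v where "v = (1 / norm u) *\<^sub>R u"
    have v: "norm v = 1" using False by (simp add: v_def)
    have "Im (D v x) = 0"
    proof (rule real_linear_bound_zero[of "R/8"])
      fix h assume h: "0 < h" "h < R/8"
      have "\<bar>Im (of_real (f (x + h *\<^sub>R v)) - of_real (f x) - of_real h * D v x)\<bar> \<le> C * h\<^sup>2"
        using taylor1[OF v that, of h] h abs_Im_le_cmod order_trans by fastforce
      then have "h * \<bar>Im (D v x)\<bar> \<le> h * (C * h)" using h by (simp add: abs_mult power2_eq_square algebra_simps)
      then show "\<bar>Im (D v x)\<bar> \<le> C * h" using h by simp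
    qed (use R in auto)
    then have "D v x = of_real (Re (D v x))" by (simp add: complex_eq_iff)
    then show ?thesis using D_norm[OF False that] by (metis of_real_mult Re_complex_of_real v_def)
  qed (simp add: D_0)
  define f' where "f' x u = Re (D u x)" for x u
  have f'_scale: "f' x (s *\<^sub>R u) = s * f' x u" if "x \<in> ball a (R/2)" for x u s
  proof (cases "u = 0")
    case False
    define v where "v = (1 / norm u) *\<^sub>R u"
    have v: "norm v = 1" "u = norm u *\<^sub>R v" using False by (auto simp: v_def)
    have "D (s *\<^sub>R u) x = D ((s * norm u) *\<^sub>R v) x" using v(2) by (metis scaleR_scaleR)
    also have "\<dots> = of_real s * D u x"
      using D_scale[OF v(1) that, of "s * norm u"] D_scale[OF v(1) that, of "norm u"] v(2) by simp
    finally show ?thesis by (simp add: f'_def)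
  qed (simp add: f'_def D_0)
  have taylor: "\<bar>f (x + u) - f x - f' x u\<bar> \<le> C * (norm u)\<^sup>2"
    if x: "x \<in> ball a (R/2)" and u: "norm u < R/8" for x u
  proof (cases "u = 0")
    case False
    define v where "v = (1 / norm u) *\<^sub>R u"
    have v: "norm v = 1" "u = norm u *\<^sub>R v" using False by (auto simp: v_def)
    have "\<bar>Re (of_real (f (x + norm u *\<^sub>R v)) - of_real (f x) - of_real (norm u) * D v x)\<bar> \<le> C * (norm u)\<^sup>2"
      using taylor1[OF v(1) x, of "norm u"] u abs_Re_le_cmod order_trans by fastforce
    moreover have "f' x u = norm u * f' x v" using f'_scale[OF x, of "norm u" v] v(2) by simp
    ultimately show ?thesis using v(2) by (simp add: f'_def)
  qed (simp add: f'_def D_0)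
  \<comment> \<open>The directional derivatives are holomorphic on the ball of radius
    \<open>R/2\<close>, and their Lipschitz bound holds on an eighth of it.\<close>
  define e where "e = R/16"
  have e: "0 < e" using R by (simp add: e_def)
  define L where "L = 8 * (8 * B / R) / (R/2)"
  have L0: "0 \<le> L" using B0 R by (simp add: L_def)
  have cD: "curvewise_holo (ball (a, 0) (R/2)) (cdir_deriv F (u, 0))" if "norm u = 1" for u :: 'a
    using curvewise_holo_cdir_deriv[OF c R B] that by (simp add: norm_Pair_0)
  have bD: "norm (cdir_deriv F (u, 0) z) \<le> 8 * B / R" if "norm u = 1" "z \<in> ball (a, 0) (R/2)" for u :: 'a and z
    using cdir_deriv_bound[OF c R B _ that(2), of "(u, 0)"] that(1) by (simp add: norm_Pair_0)
  have D_lip: "norm (D u y - D u x) \<le> L * norm (y - x)"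
    if u: "norm u = 1" and xy: "x \<in> ball a e" "y \<in> ball a e" for x y u
  proof -
    have xy': "(x, 0) \<in> ball (a, 0) (R/2/8)" "(y, 0) \<in> ball (a, 0) (R/2/8)"
      using xy by (simp_all only: real_mem_ball) (simp_all add: e_def)
    have "norm (cdir_deriv F (u, 0) (y, 0) - cdir_deriv F (u, 0) (x, 0)) \<le> L * norm ((y, 0) - (x, 0::'a))"
      unfolding L_def by (rule curvewise_holo_lipschitz[OF cD[OF u] _ bD[OF u] xy']) (use R in auto)
    then show ?thesis by (simp add: D_def norm_Pair_0)
  qed
  have f'_lip: "\<bar>f' y v - f' x v\<bar> \<le> L * norm v * norm (y - x)"
    if xy: "x \<in> ball a e" "y \<in> ball a e" for x y v
  proof (cases "v = 0")
    case False
    define u where "u = (1 / norm v) *\<^sub>R v"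
    have u: "norm u = 1" "v = norm v *\<^sub>R u" using False by (auto simp: u_def)
    have xy2: "x \<in> ball a (R/2)" "y \<in> ball a (R/2)" using xy R by (auto simp: e_def)
    have "\<bar>f' y u - f' x u\<bar> \<le> L * norm (y - x)"
      using D_lip[OF u(1) xy] abs_Re_le_cmod[of "D u y - D u x"] by (simp add: f'_def)
    then have "norm v * \<bar>f' y u - f' x u\<bar> \<le> norm v * (L * norm (y - x))"
      by (intro mult_left_mono) auto
    moreover have "f' y v - f' x v = norm v * (f' y u - f' x u)"
      using f'_scale[OF xy2(1), of "norm v" u] f'_scale[OF xy2(2), of "norm v" u] u(2)
      by (simp add: algebra_simps)
    ultimately show ?thesis by (simp only: abs_mult abs_norm_cancel mult_ac)
  qed (simp add: f'_def D_0)
  \<comment> \<open>Compare the direct move from \<open>x\<close> to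
    \<open>x + h *\<^sub>R (u + v)\<close> with the move by way of \<open>x + h *\<^sub>R u\<close>.
    The three Taylor errors are quadratic in \<open>h\<close>, and so is the cost of replacing the
    base point \<open>x + h *\<^sub>R u\<close> by \<open>x\<close> in the second leg.\<close>
  have add: "f' x (u + v) = f' x u + f' x v" if x: "x \<in> ball a e" for x u v
  proof -
    define N where "N = norm u + norm v + 1"
    have N: "0 < N" "norm u \<le> N" "norm v \<le> N" "norm (u + v) \<le> N"
      using norm_triangle_ineq[of u v] by (auto simp: N_def add_nonneg_pos)
    define h0 where "h0 = (e - dist a x) / N"
    have h0: "0 < h0" using x N by (simp add: h0_def)
    have x2: "x \<in> ball a (R/2)" using x R by (simp add: e_def)
    have "f' x (u + v) - f' x u - f' x v = 0"
    proof (rule real_linear_bound_zero[OF h0])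
      fix h assume h: "0 < h" "h < h0"
      have hN: "h * N < e - dist a x" using h N by (simp add: h0_def field_simps)
      have small: "norm (h *\<^sub>R w) < R/8 \<and> norm (h *\<^sub>R w) < e - dist a x \<and> (norm (h *\<^sub>R w))\<^sup>2 \<le> h\<^sup>2 * N\<^sup>2" if "norm w \<le> N" for w :: 'a
      proof -
        have "h * norm w \<le> h * N" using that h by simp
        moreover have "e - dist a x \<le> R/8" using R zero_le_dist[of a x] unfolding e_def by linarith
        ultimately have 1: "h * norm w < R/8" "h * norm w < e - dist a x" using hN by linarith+
        have "(h * norm w)\<^sup>2 \<le> (h * N)\<^sup>2" using \<open>h * norm w \<le> h * N\<close> h by (intro power_mono) auto
        then show ?thesis using 1 h by (simp add: power_mult_distrib)
      qed
      have y: "x + h *\<^sub>R u \<in> ball a e"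
      proof -
        have "dist a (x + h *\<^sub>R u) \<le> dist a x + norm (h *\<^sub>R u)"
          by (metis dist_triangle dist_add_cancel add.right_neutral dist_0_norm)
        then show ?thesis using small[OF N(2)] by simp
      qed
      then have y2: "x + h *\<^sub>R u \<in> ball a (R/2)" using R by (simp add: e_def)
      have t: "C * (norm (h *\<^sub>R w))\<^sup>2 \<le> C * (h\<^sup>2 * N\<^sup>2)" if "norm w \<le> N" for w :: 'a
        using small[OF that] C0 by (intro mult_left_mono) auto
      have 1: "\<bar>f (x + h *\<^sub>R (u + v)) - f x - h * f' x (u + v)\<bar> \<le> C * (h\<^sup>2 * N\<^sup>2)"
        using taylor[OF x2, of "h *\<^sub>R (u + v)"] small[OF N(4)] t[OF N(4)] f'_scale[OF x2, of h "u + v"] by linarith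
      have 2: "\<bar>f (x + h *\<^sub>R u) - f x - h * f' x u\<bar> \<le> C * (h\<^sup>2 * N\<^sup>2)"
        using taylor[OF x2, of "h *\<^sub>R u"] small[OF N(2)] t[OF N(2)] f'_scale[OF x2, of h u] by linarith
      have 3: "\<bar>f (x + h *\<^sub>R u + h *\<^sub>R v) - f (x + h *\<^sub>R u) - h * f' (x + h *\<^sub>R u) v\<bar> \<le> C * (h\<^sup>2 * N\<^sup>2)"
        using taylor[OF y2, of "h *\<^sub>R v"] small[OF N(3)] t[OF N(3)] f'_scale[OF y2, of h v] by linarith
      have "\<bar>f' (x + h *\<^sub>R u) v - f' x v\<bar> \<le> L * norm v * (h * norm u)"
        using f'_lip[OF x y, of v] h by simp
      also have "\<dots> \<le> L * N * (h * N)"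
        using L0 N h by (intro mult_mono) auto
      finally have "h * \<bar>f' (x + h *\<^sub>R u) v - f' x v\<bar> \<le> h * (L * N * (h * N))"
        using h by (intro mult_left_mono) auto
      then have 4: "\<bar>h * f' (x + h *\<^sub>R u) v - h * f' x v\<bar> \<le> L * (h\<^sup>2 * N\<^sup>2)"
        using h unfolding right_diff_distrib[symmetric] abs_mult by (simp add: power2_eq_square mult_ac)
      have "\<bar>h * f' x (u + v) - h * f' x u - h * f' x v\<bar> \<le> 3 * (C * (h\<^sup>2 * N\<^sup>2)) + L * (h\<^sup>2 * N\<^sup>2)"
        using 1 2 3 4 unfolding scaleR_add_right add.assoc[symmetric] by (rule abs_diff_chain)
      then have "h * \<bar>f' x (u + v) - f' x u - f' x v\<bar> \<le> h * ((3 * C + L) * N\<^sup>2 * h)"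
        using h unfolding right_diff_distrib[symmetric] abs_mult by (simp add: power2_eq_square algebra_simps)
      then show "\<bar>f' x (u + v) - f' x u - f' x v\<bar> \<le> ((3 * C + L) * N\<^sup>2) * h" using h by simp
    qed
    then show ?thesis by simp
  qed
  show ?thesis
  proof (rule that[OF e])
    fix x assume x: "x \<in> ball a e"
    have x2: "x \<in> ball a (R/2)" using x R by (simp add: e_def)
    have "linear (f' x)" using add[OF x] f'_scale[OF x2] by (intro linearI) auto
    then have bl: "bounded_linear (f' x)" by (simp add: linear_conv_bounded_linear)
    show "(f has_derivative f' x) (at x)"
      unfolding has_derivative_at_alt
    proof (intro conjI allI impI bl)
      fix \<epsilon> :: real assume \<epsilon>: "0 < \<epsilon>"
      define \<delta> where "\<delta> = min (R/8) (\<epsilon> / (C + 1))"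
      have "0 < \<delta>" using R \<epsilon> C0 by (simp add: \<delta>_def)
      moreover have "norm (f y - f x - f' x (y - x)) \<le> \<epsilon> * norm (y - x)" if y: "norm (y - x) < \<delta>" for y
      proof -
        have "\<bar>f (x + (y - x)) - f x - f' x (y - x)\<bar> \<le> C * (norm (y - x))\<^sup>2"
          by (rule taylor[OF x2]) (use y in \<open>simp add: \<delta>_def\<close>)
        also have "\<dots> = (C * norm (y - x)) * norm (y - x)" by (simp add: power2_eq_square)
        also have "\<dots> \<le> \<epsilon> * norm (y - x)"
        proof (rule mult_right_mono)
          have "(C + 1) * norm (y - x) \<le> \<epsilon>" using y C0 by (simp add: \<delta>_def field_simps)
          then show "C * norm (y - x) \<le> \<epsilon>"
            using norm_ge_zero[of "y - x"] unfolding distrib_right by linarith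
        qed simp
        finally show ?thesis by simp
      qed
      ultimately show "\<exists>d>0. \<forall>y. norm (y - x) < d \<longrightarrow> norm (f y - f x - f' x (y - x)) \<le> \<epsilon> * norm (y - x)"
        by blast
    qed
  next
    fix b :: 'a assume "b \<in> Basis"
    then have b: "norm b = 1" by simp
    have R2: "0 < R/2" using R by simp
    have "cpx_ext (\<lambda>x. f' x b) a (R/2/8) (cdir_deriv F (b, 0))"
      unfolding cpx_ext_def
    proof (intro conjI ballI)
      show "curvewise_holo (ball (a, 0) (R/2/8)) (cdir_deriv F (b, 0))"
        by (rule curvewise_holo_subset[OF cD[OF b]]) (use R in auto)
      show "continuous_on (ball (a, 0) (R/2/8)) (cdir_deriv F (b, 0))"
        by (rule curvewise_holo_continuous[OF cD[OF b] R2 bD[OF b]])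
      fix x assume "x \<in> ball a (R/2/8)"
      then have "x \<in> ball a (R/2)" using R by simp
      then show "cdir_deriv F (b, 0) (x, 0) = of_real (f' x b)"
        using Im_D[of x b] by (simp add: D_def f'_def)
    qed (use R in simp)
    then show "ranalytic_at (\<lambda>x. f' x b) a" unfolding ranalytic_at_def by blast
  qed
qed

text \<open>Evaluate the real series at a point with all coordinates equal to \<open>s\<close>. A
  summable real family is absolutely summable, so the terms there dominate the complexified series
  wherever all complex coordinates are at most \<open>s\<close> in modulus. The M-test then makes
  the complex sum a uniform limit of polynomials.\<close>

lemma real_analytic_on_imp_ranalytic_at:
  fixes f :: "'a::euclidean_space \<Rightarrow> real"
  assumes "real_analytic_on U f" "a \<in> U"
  shows "ranalytic_at f a"
proof -
  define X where "X = (Basis :: 'a set) \<rightarrow>\<^sub>E (UNIV :: nat set)"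
  obtain r c where r: "0 < r" and c: "\<And>h. norm h < r \<Longrightarrow>
     ((\<lambda>\<alpha>. c \<alpha> * (\<Prod>b\<in>Basis. (h \<bullet> b) ^ \<alpha> b)) has_sum f (a + h)) X"
    using assms unfolding real_analytic_on_def X_def by blast
  \<comment> \<open>Keeps the norm of the test point \<open>h0\<close>, a sum of
    \<open>DIM('a)\<close> vectors of length \<open>s\<close>, at most \<open>r/2\<close>.\<close>
  define s where "s = r / (2 * DIM('a))"
  have s: "0 < s" using r by (simp add: s_def)
  define h0 where "h0 = (\<Sum>b\<in>Basis. s *\<^sub>R (b::'a))"
  have h0b: "h0 \<bullet> b = s" if "b \<in> Basis" for b using that by (simp add: h0_def)
  have "norm h0 \<le> (\<Sum>b\<in>Basis. norm (s *\<^sub>R (b::'a)))" unfolding h0_def by (rule norm_sum)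
  also have "\<dots> = r/2" using s r by (simp add: s_def)
  also have "\<dots> < r" using r by simp
  finally have "norm h0 < r" .
  then have "(\<lambda>\<alpha>. c \<alpha> * (\<Prod>b\<in>Basis. (h0 \<bullet> b) ^ \<alpha> b)) summable_on X"
    using c summable_on_def by blast
  then have "(\<lambda>\<alpha>. norm (c \<alpha> * (\<Prod>b\<in>Basis. (h0 \<bullet> b) ^ \<alpha> b))) summable_on X"
    by (rule summable_on_iff_abs_summable_on_real[THEN iffD1])
  moreover have "norm (c \<alpha> * (\<Prod>b\<in>Basis. (h0 \<bullet> b) ^ \<alpha> b)) = \<bar>c \<alpha>\<bar> * (\<Prod>b\<in>(Basis::'a set). s ^ \<alpha> b)" for \<alpha>
    using s by (simp add: h0b abs_mult abs_of_nonneg prod_nonneg)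
  ultimately have M: "(\<lambda>\<alpha>. \<bar>c \<alpha>\<bar> * (\<Prod>b\<in>(Basis::'a set). s ^ \<alpha> b)) summable_on X"
    by simp
  define T where "T \<alpha> z = of_real (c \<alpha>) * (\<Prod>b\<in>Basis. cpx_coord b (z - (a, 0)) ^ \<alpha> b)" for \<alpha> and z :: "'a \<times> 'a"
  define F where "F z = (\<Sum>\<^sub>\<infinity>\<alpha>\<in>X. T \<alpha> z)" for z
  have T_le: "norm (T \<alpha> z) \<le> \<bar>c \<alpha>\<bar> * (\<Prod>b\<in>(Basis::'a set). s ^ \<alpha> b)" if "z \<in> ball (a, 0) s" for \<alpha> z
  proof -
    have "norm (cpx_coord b (z - (a, 0))) \<le> s" if b: "b \<in> Basis" for b
    proof -
      have "norm (cpx_coord b (z - (a, 0))) \<le> norm (z - (a, 0)) * norm b" by (rule norm_cpx_coord_le)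
      also have "\<dots> < s" using \<open>z \<in> ball (a, 0) s\<close> b by (simp add: dist_norm norm_minus_commute)
      finally show ?thesis by simp
    qed
    then show ?thesis
      unfolding T_def norm_mult prod_norm[symmetric] norm_power norm_of_real
      by (intro mult_left_mono prod_mono conjI power_mono) auto
  qed
  have ul: "uniform_limit (ball (a, 0) s) (\<lambda>A z. \<Sum>\<alpha>\<in>A. T \<alpha> z) F (finite_subsets_at_top X)"
    unfolding F_def by (rule Weierstrass_m_test_general[OF T_le M])
  have T_cont: "continuous_on S (T \<alpha>)" for S \<alpha>
    unfolding T_def by (intro continuous_intros)
  have T_holo: "(\<lambda>w. T \<alpha> (z w)) holomorphic_on W" if "holo_curve W z" for W z \<alpha>
    using that unfolding T_def holo_curve_def
    by (auto simp: cpx_coord_diff cpx_coord_real intro!: holomorphic_intros)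
  have "cpx_ext f a s F"
    unfolding cpx_ext_def
  proof (intro conjI ballI)
    show "continuous_on (ball (a, 0) s) F"
      by (rule uniform_limit_theorem[OF _ ul]) (auto intro!: always_eventually continuous_on_sum T_cont)
    show "curvewise_holo (ball (a, 0) s) F"
      unfolding curvewise_holo_def
    proof (intro allI impI)
      fix W and z :: "complex \<Rightarrow> 'a \<times> 'a"
      assume W: "open W" "holo_curve W z" "z ` W \<subseteq> ball (a, 0) s"
      have "\<exists>D. ((\<lambda>w. F (z w)) has_field_derivative D) (at w0)" if w0: "w0 \<in> W" for w0
      proof -
        obtain e where e: "0 < e" "cball w0 e \<subseteq> W" using W(1) w0 open_contains_cball by blast
        have ul': "uniform_limit (cball w0 e) (\<lambda>A w. \<Sum>\<alpha>\<in>A. T \<alpha> (z w)) (\<lambda>w. F (z w)) (finite_subsets_at_top X)"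
        proof (rule uniform_limitI)
          fix \<epsilon> :: real assume "0 < \<epsilon>"
          show "\<forall>\<^sub>F A in finite_subsets_at_top X. \<forall>w\<in>cball w0 e. dist (\<Sum>\<alpha>\<in>A. T \<alpha> (z w)) (F (z w)) < \<epsilon>"
            by (rule eventually_mono[OF uniform_limitD[OF ul \<open>0 < \<epsilon>\<close>]]) (use W(3) e(2) in blast)
        qed
        have "holo_curve (cball w0 e) z"
          using W(2) e(2) unfolding holo_curve_def by (blast intro: holomorphic_on_subset)
        then have hc: "(\<lambda>w. \<Sum>\<alpha>\<in>A. T \<alpha> (z w)) holomorphic_on cball w0 e" for A
          by (intro holomorphic_on_sum T_holo)
        have "(\<lambda>w. F (z w)) holomorphic_on ball w0 e"
          by (rule holomorphic_uniform_limit[OF _ ul'])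
            (use hc in \<open>auto intro!: always_eventually intro: holomorphic_on_imp_continuous_on holomorphic_on_subset[OF _ ball_subset_cball]\<close>)
        then show ?thesis using e(1) holomorphic_derivI[of "\<lambda>w. F (z w)" "ball w0 e" w0] by auto
      qed
      then show "(\<lambda>w. F (z w)) holomorphic_on W"
        using W(1) by (simp add: holomorphic_on_open)
    qed
    fix x assume x: "x \<in> ball a s"
    have "1 \<le> DIM('a)" by (simp add: Suc_leI)
    then have "1 \<le> real DIM('a)" by linarith
    then have "1 \<le> 2 * real DIM('a)" by linarith
    then have "r / (2 * real DIM('a)) \<le> r / 1" using r by (intro divide_left_mono) linarith+
    then have "s \<le> r" by (simp add: s_def)
    then have "norm (x - a) < r" using x by (simp add: dist_norm norm_minus_commute)
    then have "((\<lambda>\<alpha>. c \<alpha> * (\<Prod>b\<in>Basis. ((x - a) \<bullet> b) ^ \<alpha> b)) has_sum f x) X"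
      using c[of "x - a"] by simp
    then have "((\<lambda>\<alpha>. of_real (c \<alpha> * (\<Prod>b\<in>Basis. ((x - a) \<bullet> b) ^ \<alpha> b)) :: complex) has_sum of_real (f x)) X"
      by (rule has_sum_of_real)
    moreover have "of_real (c \<alpha> * (\<Prod>b\<in>Basis. ((x - a) \<bullet> b) ^ \<alpha> b)) = T \<alpha> (x, 0)" for \<alpha>
      by (simp add: T_def cpx_coord_real)
    ultimately show "F (x, 0) = of_real (f x)"
      unfolding F_def by (simp add: infsumI)
  qed (rule s)
  then show ?thesis unfolding ranalytic_at_def by blast
qed

section \<open>Ordinary differential equations\<close>

lemma norm_bound_by_vector_derivative:
  fixes f :: "real \<Rightarrow> 'a::real_normed_vector"
  assumes "a \<le> b" "\<And>s. a \<le> s \<Longrightarrow> s \<le> b \<Longrightarrow> (f has_vector_derivative f' s) (at s)"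
    and "\<And>s. a \<le> s \<Longrightarrow> s \<le> b \<Longrightarrow> norm (f' s) \<le> K"
  shows "norm (f b - f a) \<le> K * (b - a)"
proof (cases "a = b")
  case False
  have "norm (f b - f a) \<le> K * b - K * a"
  proof (rule differentiable_bound_general[where \<phi> = "\<lambda>s. K * s" and \<phi>' = "\<lambda>_. K" and f' = f'])
    show "continuous_on {a..b} f"
      using assms(2) has_vector_derivative_continuous
      by (metis atLeastAtMost_iff continuous_at_imp_continuous_on)
    show "((\<lambda>s. K * s) has_vector_derivative K) (at x)" for x
      unfolding has_real_derivative_iff_has_vector_derivative[symmetric]
      by (auto intro!: derivative_eq_intros)
  qed (use assms False in \<open>auto intro!: continuous_intros\<close>)
  then show ?thesis by (simp add: algebra_simps)
qed simp

lemma has_vector_derivative_reflect: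
  assumes "(c has_vector_derivative D) (at (- t))"
  shows "((\<lambda>s::real. c (- s)) has_vector_derivative - D) (at t)"
proof -
  have "((uminus :: real \<Rightarrow> real) has_vector_derivative (- 1)) (at t)"
    unfolding has_real_derivative_iff_has_vector_derivative[symmetric]
    by (auto intro!: derivative_eq_intros)
  then show ?thesis using vector_diff_chain_at[of uminus "-1" t c D] assms by (simp add: o_def)
qed

text \<open>For positive times \<open>K * exp (k * s)\<close> is an antiderivative of the bound, so
  one integration gains the factor \<open>1 / k\<close>; negative times follow by
  reflection.\<close>

lemma norm_exp_bound:
  fixes u :: "real \<Rightarrow> 'a::real_normed_vector"
  assumes u0: "u 0 = 0" and u: "\<And>s. (u has_vector_derivative u' s) (at s)"
    and b: "\<And>s. norm (u' s) \<le> K * k * exp (k * \<bar>s\<bar>)" and K: "0 \<le> K"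
  shows "norm (u t) \<le> K * exp (k * \<bar>t\<bar>)"
proof -
  have fwd: "norm (u t) \<le> K * exp (k * t)"
    if u0: "u 0 = 0" and u: "\<And>s. (u has_vector_derivative u' s) (at s)"
      and b: "\<And>s. norm (u' s) \<le> K * k * exp (k * \<bar>s\<bar>)" and t: "0 < t"
    for u u' :: "real \<Rightarrow> 'a" and t
  proof -
    have "norm (u t - u 0) \<le> K * exp (k * t) - K * exp (k * 0)"
    proof (rule differentiable_bound_general[where \<phi> = "\<lambda>s. K * exp (k * s)" and \<phi>' = "\<lambda>s. K * k * exp (k * s)" and f' = u'])
      show "continuous_on {0..t} u"
        using u has_vector_derivative_continuous by (metis continuous_at_imp_continuous_on)
      show "((\<lambda>s. K * exp (k * s)) has_vector_derivative K * k * exp (k * x)) (at x)" for x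
        unfolding has_real_derivative_iff_has_vector_derivative[symmetric]
        by (auto intro!: derivative_eq_intros)
      show "norm (u' x) \<le> K * k * exp (k * x)" if "0 < x" for x using b[of x] that by simp
    qed (use t u in \<open>auto intro!: continuous_intros\<close>)
    then show ?thesis using u0 K by simp
  qed
  consider "t = 0" | "0 < t" | "t < 0" by linarith
  then show ?thesis
  proof cases
    case 2 then show ?thesis using fwd[OF u0 u b, of t] by simp
  next
    case 3
    have "norm (u (- (- t))) \<le> K * exp (k * (- t))"
      by (rule fwd[where u = "\<lambda>s. u (- s)" and u' = "\<lambda>s. - u' (- s)"])
        (use 3 u0 u b[of "- _"] in \<open>auto intro!: has_vector_derivative_reflect\<close>)
    then show ?thesis using 3 by simp
  qed (use u0 K in simp)
qed

text \<open>The squared distance of two solutions, damped by \<open>exp (- 2 * L * t)\<close>, does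
  not increase. Negative times are positive times for the field \<open>- W\<close>.\<close>

lemma ode_unique:
  fixes W :: "'a::real_inner \<Rightarrow> 'a"
  assumes L: "L-lipschitz_on UNIV W"
    and c1: "\<And>t. (c1 has_vector_derivative W (c1 t)) (at t)"
    and c2: "\<And>t. (c2 has_vector_derivative W (c2 t)) (at t)" and eq: "c1 0 = c2 0"
  shows "c1 t = c2 t"
proof -
  have fwd: "c1 t = c2 t" if L: "L-lipschitz_on UNIV W" and t: "0 \<le> t"
    and c1: "\<And>t. (c1 has_vector_derivative W (c1 t)) (at t)"
    and c2: "\<And>t. (c2 has_vector_derivative W (c2 t)) (at t)" and eq: "c1 0 = c2 0"
    for W :: "'a \<Rightarrow> 'a" and c1 c2 t
  proof -
    define u where "u t = c1 t - c2 t" for t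
    define \<phi> where "\<phi> t = (u t \<bullet> u t) * exp (- 2 * L * t)" for t
    have u: "(u has_vector_derivative W (c1 t) - W (c2 t)) (at t)" for t
      unfolding u_def by (intro derivative_intros c1 c2)
    have "\<phi> t \<le> \<phi> 0"
    proof (rule DERIV_nonpos_imp_nonincreasing[OF t])
      fix s
      define D where "D = W (c1 s) - W (c2 s)"
      have eq: "(\<lambda>h. u s \<bullet> (h *\<^sub>R D) + (h *\<^sub>R D) \<bullet> u s) = (*) (2 * (u s \<bullet> D))"
        by (auto simp: fun_eq_iff inner_commute)
      have 1: "((\<lambda>t. u t \<bullet> u t) has_real_derivative 2 * (u s \<bullet> D)) (at s)"
        using has_derivative_inner[OF u[of s, unfolded has_vector_derivative_def] u[of s, unfolded has_vector_derivative_def]]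
        unfolding D_def[symmetric] eq by (simp only: has_field_derivative_def)
      have 2: "((\<lambda>t. exp (- 2 * L * t)) has_real_derivative (- 2 * L) * exp (- 2 * L * s)) (at s)"
        by (auto intro!: derivative_eq_intros)
      have "(\<phi> has_real_derivative
          (2 * (u s \<bullet> (W (c1 s) - W (c2 s))) - 2 * L * (u s \<bullet> u s)) * exp (- 2 * L * s)) (at s)"
        unfolding \<phi>_def D_def[symmetric]
        by (rule DERIV_cong[OF DERIV_mult[OF 1 2]]) (simp add: algebra_simps)
      moreover have "u s \<bullet> (W (c1 s) - W (c2 s)) \<le> L * (u s \<bullet> u s)"
      proof -
        have "u s \<bullet> (W (c1 s) - W (c2 s)) \<le> norm (u s) * norm (W (c1 s) - W (c2 s))"
          by (rule norm_cauchy_schwarz)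
        also have "\<dots> \<le> norm (u s) * (L * norm (u s))"
          using lipschitz_onD[OF L, of "c1 s" "c2 s"] by (intro mult_left_mono) (auto simp: dist_norm u_def)
        finally show ?thesis by (simp only: dot_square_norm power2_eq_square mult_ac)
      qed
      ultimately have d: "(\<phi> has_real_derivative
          (2 * (u s \<bullet> (W (c1 s) - W (c2 s))) - 2 * L * (u s \<bullet> u s)) * exp (- 2 * L * s)) (at s)"
        and le: "2 * (u s \<bullet> (W (c1 s) - W (c2 s))) - 2 * L * (u s \<bullet> u s) \<le> 0"
        by (simp_all add: mult.assoc)
      show "\<exists>y. (\<phi> has_real_derivative y) (at s) \<and> y \<le> 0"
        using d mult_nonpos_nonneg[OF le exp_ge_zero] by blast
    qed
    then have "u t \<bullet> u t \<le> 0" using eq by (simp add: \<phi>_def u_def mult_le_0_iff)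
    then have "u t = 0" using inner_gt_zero_iff[of "u t"] by (meson not_le)
    then show ?thesis by (simp add: u_def)
  qed
  show ?thesis
  proof (cases "0 \<le> t")
    case True then show ?thesis using fwd[OF L _ c1 c2 eq] by simp
  next
    case False
    have L': "L-lipschitz_on UNIV (\<lambda>x. - W x)" using L by (simp add: lipschitz_on_def dist_norm norm_minus_commute)
    have "c1 (- (- t)) = c2 (- (- t))"
      by (rule fwd[OF L', where ?c1.0 = "\<lambda>s. c1 (- s)" and ?c2.0 = "\<lambda>s. c2 (- s)"])
        (use False eq in \<open>auto intro!: has_vector_derivative_reflect c1 c2\<close>)
    then show ?thesis by simp
  qed
qed

lemma geometric_Cauchy_limit:
  fixes a :: "nat \<Rightarrow> 'a::banach"
  assumes "\<And>n. norm (a (Suc n) - a n) \<le> b * (1/2)^n"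
  shows "\<exists>l. a \<longlonglongrightarrow> l \<and> (\<forall>n. norm (a n - l) \<le> 2 * b * (1/2)^n)"
proof -
  have b: "0 \<le> b" using order_trans[OF norm_ge_zero assms[of 0]] by simp
  have tele: "norm (a (n + m) - a n) \<le> 2 * b * (1/2)^n * (1 - (1/2)^m)" for n m
  proof (induction m)
    case (Suc m)
    have "norm (a (n + Suc m) - a n) \<le> norm (a (Suc (n + m)) - a (n + m)) + norm (a (n + m) - a n)"
      using norm_triangle_ineq[of "a (Suc (n + m)) - a (n + m)" "a (n + m) - a n"] by simp
    also have "\<dots> \<le> b * (1/2)^(n+m) + 2 * b * (1/2)^n * (1 - (1/2)^m)"
      using assms[of "n + m"] Suc by linarith
    also have "\<dots> = 2 * b * (1/2)^n * (1 - (1/2)^Suc m)" by (simp add: power_add algebra_simps)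
    finally show ?case .
  qed simp
  have tele': "norm (a (n + m) - a n) \<le> 2 * b * (1/2)^n" for n m
  proof -
    have "2 * b * (1/2)^n * (1 - (1/2)^m) \<le> 2 * b * (1/2)^n * 1"
      using b by (intro mult_left_mono) auto
    then show ?thesis using tele[of n m] by simp
  qed
  have "(\<lambda>n. 2 * b * (1/2)^n) \<longlonglongrightarrow> 2 * b * 0" by (intro tendsto_intros LIMSEQ_power_zero) auto
  then have lim0: "(\<lambda>n. 2 * b * (1/2)^n) \<longlonglongrightarrow> 0" by simp
  have "Cauchy a"
  proof (rule CauchyI')
    fix e :: real assume "0 < e"
    then obtain M where M: "2 * b * (1/2)^M < e/2"
      using order_tendstoD(2)[OF lim0, of "e/2"] by (auto simp: eventually_sequentially)
    have "norm (a m - a n) < e" if "m \<ge> M" "n > m" for m n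
    proof -
      have "norm (a m - a M) \<le> 2 * b * (1/2)^M" "norm (a n - a M) \<le> 2 * b * (1/2)^M"
        using tele'[of M "m - M"] tele'[of M "n - M"] that by auto
      then show ?thesis using M norm_triangle_ineq4[of "a m - a M" "a n - a M"] by simp
    qed
    then show "\<exists>M. \<forall>m\<ge>M. \<forall>n>m. dist (a m) (a n) < e" unfolding dist_norm by blast
  qed
  then obtain l where l: "a \<longlonglongrightarrow> l" using Cauchy_convergent_iff convergent_def by blast
  have "norm (a n - l) \<le> 2 * b * (1/2)^n" for n
  proof (rule LIMSEQ_le_const2)
    have "(\<lambda>m. a (n + m)) \<longlonglongrightarrow> l"
      using LIMSEQ_ignore_initial_segment[OF l, of n] by (simp add: add.commute)
    then show "(\<lambda>m. norm (a n - a (n + m))) \<longlonglongrightarrow> norm (a n - l)"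
      by (rule tendsto_norm[OF tendsto_diff[OF tendsto_const]])
    show "\<exists>N. \<forall>m\<ge>N. norm (a n - a (n + m)) \<le> 2 * b * (1/2)^n"
      using tele' by (metis norm_minus_commute)
  qed
  with l show ?thesis by blast
qed

lemma antiderivative_exists:
  fixes f :: "real \<Rightarrow> 'a::euclidean_space"
  assumes "continuous_on UNIV f"
  shows "\<exists>G. G 0 = z \<and> (\<forall>t. (G has_vector_derivative f t) (at t))"
proof -
  have "\<exists>F. \<forall>x::real. -\<infinity> < ereal x \<longrightarrow> ereal x < \<infinity> \<longrightarrow> (F has_vector_derivative f x) (at x)"
    by (rule einterval_antiderivative) (use assms in \<open>auto simp: continuous_on_eq_continuous_at\<close>)
  then obtain F where F: "\<And>x. (F has_vector_derivative f x) (at x)" by auto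
  have "((\<lambda>t. F t - F 0 + z) has_vector_derivative f t) (at t)" for t
    using F[of t] by (auto intro!: derivative_eq_intros)
  then show ?thesis by (intro exI[of _ "\<lambda>t. F t - F 0 + z"]) auto
qed

text \<open>The weight \<open>exp (k * \<bar>t\<bar>)\<close> with \<open>k = 2 * (L + 1)\<close> makes Picard iteration a contraction on the
  whole line.\<close>

theorem ode_exists:
  fixes W :: "'a::euclidean_space \<Rightarrow> 'a"
  assumes L: "L-lipschitz_on UNIV W"
  obtains c where "c 0 = z" "\<And>t. (c has_vector_derivative W (c t)) (at t)"
proof -
  define P where "P f = (SOME G. G 0 = z \<and> (\<forall>t. (G has_vector_derivative f t) (at t)))" for f :: "real \<Rightarrow> 'a"
  have P: "P f 0 = z" "\<And>t. (P f has_vector_derivative f t) (at t)" if "continuous_on UNIV f" for f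
    using someI_ex[OF antiderivative_exists[OF that, of z]] unfolding P_def by auto
  have W_cont: "continuous_on UNIV W" using L by (rule lipschitz_on_continuous_on)
  define C where "C = rec_nat (\<lambda>_. z) (\<lambda>n c. P (\<lambda>t. W (c t)))"
  have C0: "C 0 = (\<lambda>_. z)" and CS: "C (Suc n) = P (\<lambda>t. W (C n t))" for n
    by (simp_all add: C_def)
  have C_cont: "continuous_on UNIV (C n)" for n
  proof (induction n)
    case (Suc n)
    then have "continuous_on UNIV (\<lambda>t. W (C n t))"
      using continuous_on_compose2[OF W_cont] by blast
    then show ?case
      using P(2) has_vector_derivative_continuous unfolding CS
      by (metis continuous_at_imp_continuous_on)
  qed (simp add: C0)
  have WC_cont: "continuous_on UNIV (\<lambda>t. W (C n t))" for n
    using continuous_on_compose2[OF W_cont C_cont] by blast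
  have C_0: "C n 0 = z" for n
    by (cases n) (simp_all add: C0 CS P(1)[OF WC_cont])
  have C_deriv: "(C (Suc n) has_vector_derivative W (C n t)) (at t)" for n t
    unfolding CS by (rule P(2)[OF WC_cont])
  define k where "k = 2 * (L + 1)"
  have L0: "0 \<le> L" using L by (rule lipschitz_on_nonneg)
  have k: "1 \<le> k" using L0 by (simp add: k_def)
  define B where "B = norm (W z)"
  have B: "0 \<le> B" by (simp add: B_def)
  have step: "norm (C (Suc n) t - C n t) \<le> (B * (1/2)^n) * exp (k * \<bar>t\<bar>)" for n t
  proof (induction n arbitrary: t)
    case 0
    have "norm (C 1 t - z) \<le> B * exp (k * \<bar>t\<bar>)"
    proof (rule norm_exp_bound[where u = "\<lambda>t. C 1 t - z" and u' = "\<lambda>t. W (C 0 t)"])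
      show "((\<lambda>t. C 1 t - z) has_vector_derivative W (C 0 s)) (at s)" for s
        using C_deriv[of 0 s] by (auto intro!: derivative_eq_intros)
      show "norm (W (C 0 s)) \<le> B * k * exp (k * \<bar>s\<bar>)" for s
      proof -
        have "1 \<le> k * exp (k * \<bar>s\<bar>)" using mult_mono[of 1 k 1 "exp (k * \<bar>s\<bar>)"] k by simp
        then have "B * 1 \<le> B * (k * exp (k * \<bar>s\<bar>))" using B by (rule mult_left_mono)
        then show ?thesis by (simp add: C0 B_def mult.assoc)
      qed
    qed (use B C_0 in auto)
    then show ?case by (simp add: C0)
  next
    case (Suc n)
    have "norm (C (Suc (Suc n)) t - C (Suc n) t) \<le> (B * (1/2)^Suc n) * exp (k * \<bar>t\<bar>)"
    proof (rule norm_exp_bound[where u' = "\<lambda>t. W (C (Suc n) t) - W (C n t)"])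
      show "((\<lambda>t. C (Suc (Suc n)) t - C (Suc n) t) has_vector_derivative W (C (Suc n) s) - W (C n s)) (at s)" for s
        by (intro derivative_intros C_deriv)
      fix s
      have "norm (W (C (Suc n) s) - W (C n s)) \<le> L * norm (C (Suc n) s - C n s)"
        using lipschitz_onD[OF L, of "C (Suc n) s" "C n s"] by (simp add: dist_norm)
      also have "\<dots> \<le> (k / 2) * ((B * (1/2)^n) * exp (k * \<bar>s\<bar>))"
        using Suc[of s] L0 by (intro mult_mono) (auto simp: k_def)
      finally show "norm (W (C (Suc n) s) - W (C n s)) \<le> B * (1/2)^Suc n * k * exp (k * \<bar>s\<bar>)"
        by (simp add: mult_ac)
    qed (use B C_0 in auto)
    then show ?case .
  qed
  have "\<exists>l. (\<lambda>n. C n t) \<longlonglongrightarrow> l \<and> (\<forall>n. norm (C n t - l) \<le> 2 * (B * exp (k * \<bar>t\<bar>)) * (1/2)^n)" for t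
    by (rule geometric_Cauchy_limit) (use step[of _ t] in \<open>simp add: mult_ac\<close>)
  then obtain c where c: "\<And>t. (\<lambda>n. C n t) \<longlonglongrightarrow> c t"
    and c_err: "\<And>t n. norm (C n t - c t) \<le> 2 * (B * exp (k * \<bar>t\<bar>)) * (1/2)^n" by metis
  have "(c has_vector_derivative W (c t)) (at t)" for t
  proof -
    define A where "A = \<bar>t\<bar> + 1"
    define K where "K = 2 * (B * exp (k * A))"
    \<comment> \<open>On the bounded interval \<open>ball 0 A\<close> the derivatives
      \<open>W (C n x)\<close> converge uniformly, so the limit of the iterates may be
      differentiated termwise.\<close>
    have "\<exists>g. \<forall>x\<in>ball 0 A. (\<lambda>n. C (Suc n) x) \<longlonglongrightarrow> g x \<and> (g has_derivative (\<lambda>h. h *\<^sub>R W (c x))) (at x within ball 0 A)"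
    proof (rule has_derivative_sequence[where f' = "\<lambda>n x h. h *\<^sub>R W (C n x)" and ?x0.0 = 0])
      show "(C (Suc n) has_derivative (\<lambda>h. h *\<^sub>R W (C n x))) (at x within ball 0 A)" for n x
        using C_deriv[of n x] unfolding has_vector_derivative_def by (rule has_derivative_at_withinI)
      show "(\<lambda>n. C (Suc n) 0) \<longlonglongrightarrow> z" by (simp add: C_0)
      fix e :: real assume e: "0 < e"
      have "(\<lambda>n. L * (K * (1/2)^n)) \<longlonglongrightarrow> L * (K * 0)" by (intro tendsto_intros LIMSEQ_power_zero) auto
      then have "\<forall>\<^sub>F n in sequentially. L * (K * (1/2)^n) < e"
        using order_tendstoD(2)[of _ 0 _ e] e by simp
      then show "\<forall>\<^sub>F n in sequentially. \<forall>x\<in>ball 0 A. \<forall>h. norm (h *\<^sub>R W (C n x) - h *\<^sub>R W (c x)) \<le> e * norm h"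
      proof (rule eventually_mono)
        fix n assume n: "L * (K * (1/2)^n) < e"
        show "\<forall>x\<in>ball 0 A. \<forall>h. norm (h *\<^sub>R W (C n x) - h *\<^sub>R W (c x)) \<le> e * norm h"
        proof (intro ballI allI)
          fix x h :: real assume "x \<in> ball 0 A"
          then have "k * \<bar>x\<bar> \<le> k * A" using k by (intro mult_left_mono) auto
          then have "2 * (B * exp (k * \<bar>x\<bar>)) * (1/2)^n \<le> K * (1/2)^n"
            unfolding K_def using B by (intro mult_right_mono mult_left_mono) auto
          then have "norm (C n x - c x) \<le> K * (1/2)^n" using c_err[of n x] by linarith
          then have "L * norm (C n x - c x) \<le> L * (K * (1/2)^n)" using L0 by (intro mult_left_mono)
          moreover have "norm (W (C n x) - W (c x)) \<le> L * norm (C n x - c x)"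
            using lipschitz_onD[OF L, of "C n x" "c x"] by (simp add: dist_norm)
          ultimately have "norm (W (C n x) - W (c x)) \<le> e" using n by linarith
          then have "\<bar>h\<bar> * norm (W (C n x) - W (c x)) \<le> \<bar>h\<bar> * e" by (intro mult_left_mono) auto
          then show "norm (h *\<^sub>R W (C n x) - h *\<^sub>R W (c x)) \<le> e * norm h"
            unfolding scaleR_diff_right[symmetric] norm_scaleR by (simp add: mult.commute)
        qed
      qed
    qed (auto simp: A_def)
    then obtain g where g: "\<And>x. x \<in> ball 0 A \<Longrightarrow> (\<lambda>n. C (Suc n) x) \<longlonglongrightarrow> g x"
      "\<And>x. x \<in> ball 0 A \<Longrightarrow> (g has_derivative (\<lambda>h. h *\<^sub>R W (c x))) (at x within ball 0 A)" by blast
    have gc: "g x = c x" if "x \<in> ball 0 A" for x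
      using LIMSEQ_unique[OF g(1)[OF that] LIMSEQ_Suc[OF c]] .
    have t: "t \<in> ball 0 A" by (simp add: A_def)
    have "(g has_derivative (\<lambda>h. h *\<^sub>R W (c t))) (at t)"
      using g(2)[OF t] unfolding at_within_open[OF t open_ball] .
    then have "(c has_derivative (\<lambda>h. h *\<^sub>R W (c t))) (at t)"
      by (rule has_derivative_transform_within_open[OF _ open_ball t gc])
    then show ?thesis by (simp add: has_vector_derivative_def)
  qed
  moreover have "c 0 = z" using c[of 0] C_0 by (simp add: LIMSEQ_const_iff)
  ultimately show ?thesis using that by blast
qed

text \<open>Multiply \<open>V\<close> by a scalar cutoff supported in a compact neighbourhood of
  \<open>K\<close>, where \<open>V\<close> is Lipschitz and bounded. The last conclusion records
  that \<open>W\<close> is everywhere zero or a multiple of \<open>V\<close>, so every first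
  integral of \<open>V\<close> is one of \<open>W\<close>.\<close>

lemma lipschitz_cutoff:
  fixes V :: "'a::euclidean_space \<Rightarrow> 'a"
  assumes K: "compact K" "K \<noteq> {}" "open U" "K \<subseteq> U"
    and V: "\<And>x. x \<in> U \<Longrightarrow> \<exists>e>0. \<exists>L. L-lipschitz_on (ball x e) V"
  obtains W L M d and \<kappa> :: "'a \<Rightarrow> real" where "L-lipschitz_on UNIV W" "\<And>x. norm (W x) \<le> M" "0 < d"
    "\<And>x. infdist x K < d \<Longrightarrow> x \<in> U \<and> W x = V x"
    "\<And>x. W x = 0 \<or> x \<in> U \<and> W x = \<kappa> x *\<^sub>R V x"
proof -
  obtain d0 where d0: "0 < d0" "(\<Union>x\<in>K. cball x d0) \<subseteq> U"
    using compact_subset_open_imp_cball_epsilon_subset[OF K(1,3,4)] by blast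
  define S where "S = {x. infdist x K \<le> d0}"
  have S: "compact S" unfolding S_def using compact_infdist_le[OF K(2,1) d0(1)] .
  have SU: "S \<subseteq> U"
  proof
    fix x assume "x \<in> S"
    obtain y where "y \<in> K" "infdist x K = dist x y"
      using infdist_attains_inf[OF compact_imp_closed[OF K(1)] K(2)] by blast
    then show "x \<in> U" using d0(2) \<open>x \<in> S\<close> by (force simp: S_def dist_commute)
  qed
  have "local_lipschitz {0::real} S (\<lambda>_. V)"
    unfolding local_lipschitz_def
  proof (intro ballI)
    fix x and t :: real assume "x \<in> S"
    then obtain e L where e: "0 < e" "L-lipschitz_on (ball x e) V" using V SU by blast
    have "L-lipschitz_on (cball x (e/2) \<inter> S) V"
      by (rule lipschitz_on_subset[OF e(2)]) (use e(1) in auto)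
    then show "\<exists>u>0. \<exists>L. \<forall>t\<in>cball t u \<inter> {0}. L-lipschitz_on (cball x u \<inter> S) V"
      using e(1) by (intro exI[of _ "e/2"]) auto
  qed
  then obtain L where L: "L-lipschitz_on S V"
    by (rule local_lipschitz_compact_implies_lipschitz[OF _ S]) auto
  have "bounded (V ` S)"
    using compact_continuous_image[OF lipschitz_on_continuous_on[OF L] S] compact_imp_bounded by blast
  then obtain M where M: "\<And>x. x \<in> S \<Longrightarrow> norm (V x) \<le> M" "0 < M"
    unfolding bounded_pos by blast
  \<comment> \<open>Piecewise linear in the distance to \<open>K\<close>: equal to 1 up to
    \<open>d0/2\<close> and to 0 from \<open>d0\<close> on.\<close>
  define \<kappa> where "\<kappa> x = max 0 (min 1 (2 - 2 * infdist x K / d0))" for x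
  have \<kappa>: "0 \<le> \<kappa> x" "\<kappa> x \<le> 1" for x by (auto simp: \<kappa>_def)
  have \<kappa>_lip: "\<bar>\<kappa> x - \<kappa> y\<bar> \<le> 2 / d0 * dist x y" for x y
  proof -
    have "\<bar>\<kappa> x - \<kappa> y\<bar> \<le> \<bar>2 * infdist x K / d0 - 2 * infdist y K / d0\<bar>"
      unfolding \<kappa>_def by linarith
    also have "2 * infdist x K / d0 - 2 * infdist y K / d0 = 2 / d0 * (infdist x K - infdist y K)"
      by (simp add: diff_divide_distrib right_diff_distrib)
    also have "\<bar>2 / d0 * (infdist x K - infdist y K)\<bar> = 2 / d0 * \<bar>infdist x K - infdist y K\<bar>"
      unfolding abs_mult using d0(1) abs_of_pos[of "2 / d0"] by (metis divide_pos_pos zero_less_numeral)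
    also have "\<dots> \<le> 2 / d0 * dist x y"
      using d0(1) by (intro mult_left_mono infdist_triangle_abs) auto
    finally show ?thesis .
  qed
  have \<kappa>_out: "\<kappa> x = 0" if "x \<notin> S" for x
    using that d0(1) by (simp add: \<kappa>_def S_def field_simps)
  define W where "W x = (if x \<in> S then \<kappa> x *\<^sub>R V x else 0)" for x
  have W_le: "norm (W x) \<le> M" for x
  proof (cases "x \<in> S")
    case True
    have "\<bar>\<kappa> x\<bar> * norm (V x) \<le> 1 * M" using M(1)[OF True] \<kappa>[of x] by (intro mult_mono) auto
    then show ?thesis using True by (simp add: W_def)
  qed (use M(2) in \<open>simp add: W_def\<close>)
  define L' where "L' = 2 / d0 * M + L"
  have L0: "0 \<le> L" using L by (rule lipschitz_on_nonneg)
  have L': "0 \<le> L'" "2 / d0 * M \<le> L'" using L0 M(2) d0(1) by (auto simp: L'_def)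
  have mixed: "norm (W x - W y) \<le> L' * dist x y" if "x \<in> S" "y \<notin> S" for x y
  proof -
    have "norm (W x - W y) = \<bar>\<kappa> x - \<kappa> y\<bar> * norm (V x)" using that \<kappa>_out by (simp add: W_def)
    also have "\<dots> \<le> (2 / d0 * dist x y) * M" using \<kappa>_lip M that(1) d0(1) by (intro mult_mono) auto
    also have "\<dots> \<le> L' * dist x y" using mult_right_mono[OF L'(2), of "dist x y"] by (simp add: mult_ac)
    finally show ?thesis .
  qed
  have "norm (W x - W y) \<le> L' * dist x y" for x y
  proof -
    consider "x \<in> S" "y \<in> S" | "x \<in> S" "y \<notin> S" | "x \<notin> S" "y \<in> S" | "x \<notin> S" "y \<notin> S" by blast
    then show ?thesis
    proof cases
      case 1
      have "W x - W y = (\<kappa> x - \<kappa> y) *\<^sub>R V x + \<kappa> y *\<^sub>R (V x - V y)"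
        using 1 by (simp add: W_def algebra_simps)
      then have "norm (W x - W y) \<le> \<bar>\<kappa> x - \<kappa> y\<bar> * norm (V x) + \<bar>\<kappa> y\<bar> * norm (V x - V y)"
        by (metis norm_triangle_ineq norm_scaleR)
      also have "\<dots> \<le> (2 / d0 * dist x y) * M + 1 * (L * dist x y)"
        using \<kappa>_lip M 1 \<kappa> L0 d0(1) lipschitz_onD[OF L 1] by (intro add_mono mult_mono) (auto simp: dist_norm)
      also have "\<dots> = L' * dist x y" by (simp add: L'_def algebra_simps)
      finally show ?thesis .
    next
      case 3 then show ?thesis using mixed[of y x] by (simp add: dist_commute norm_minus_commute)
    qed (use mixed L' in \<open>auto simp: W_def\<close>)
  qed
  then have "L'-lipschitz_on UNIV W" using L'(1) by (simp add: lipschitz_on_def dist_norm)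
  moreover have "x \<in> U \<and> W x = V x" if "infdist x K < d0/2" for x
  proof -
    have "x \<in> S" using that infdist_nonneg[of x K] d0(1) unfolding S_def mem_Collect_eq by linarith
    moreover have "\<kappa> x = 1" using that d0(1) by (simp add: \<kappa>_def field_simps)
    ultimately show ?thesis using SU by (auto simp: W_def)
  qed
  moreover have "W x = 0 \<or> x \<in> U \<and> W x = \<kappa> x *\<^sub>R V x" for x using SU by (auto simp: W_def)
  ultimately show ?thesis using W_le d0(1) by (intro that[of L' W M "d0/2" \<kappa>]) auto
qed

subsection \<open>Euler's method\<close>

definition euler :: "('a \<Rightarrow> 'a) \<Rightarrow> real \<Rightarrow> nat \<Rightarrow> 'a \<Rightarrow> 'a::real_vector" where
  "euler W h n = ((\<lambda>y. y + h *\<^sub>R W y) ^^ n)"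

lemma euler_0: "euler W h 0 x = x"
  and euler_Suc: "euler W h (Suc n) x = euler W h n x + h *\<^sub>R W (euler W h n x)"
  by (simp_all add: euler_def)

text \<open>A single step misses the solution by at most \<open>L * M * h\<^sup>2\<close>, and each
  later step amplifies an existing error by at most \<open>1 + h * L\<close>. All \<open>n\<close>
  contributions are charged the full amplification.\<close>

lemma euler_error:
  fixes W :: "'a::real_normed_vector \<Rightarrow> 'a"
  assumes L: "L-lipschitz_on UNIV W" and M: "\<And>x. norm (W x) \<le> M"
    and c: "\<And>t. (c has_vector_derivative W (c t)) (at t)" and h: "0 \<le> h"
  shows "norm (euler W h n (c t0) - c (t0 + n * h)) \<le> n * (L * M * h\<^sup>2) * (1 + h * L) ^ n"
proof -
  have L0: "0 \<le> L" using L by (rule lipschitz_on_nonneg)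
  have M0: "0 \<le> M" using M norm_ge_zero order_trans by blast
  have local: "norm (c (t + h) - c t - h *\<^sub>R W (c t)) \<le> L * M * h\<^sup>2" for t
  proof -
    define g where "g s = c s - (s - t) *\<^sub>R W (c t)" for s
    have "norm (g (t + h) - g t) \<le> (L * (M * h)) * (t + h - t)"
    proof (rule norm_bound_by_vector_derivative[where f' = "\<lambda>s. W (c s) - W (c t)"])
      fix s assume s: "t \<le> s" "s \<le> t + h"
      show "(g has_vector_derivative W (c s) - W (c t)) (at s)"
        unfolding g_def by (auto intro!: derivative_eq_intros c)
      have "norm (c s - c t) \<le> M * (s - t)"
        using s c M by (intro norm_bound_by_vector_derivative[where f' = "\<lambda>s. W (c s)"]) auto
      also have "\<dots> \<le> M * h" using s M0 by (intro mult_left_mono) auto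
      finally have "L * norm (c s - c t) \<le> L * (M * h)" using L0 by (intro mult_left_mono)
      then show "norm (W (c s) - W (c t)) \<le> L * (M * h)"
        using lipschitz_onD[OF L, of "c s" "c t"] by (simp add: dist_norm)
    qed (use h in simp)
    then show ?thesis by (simp add: g_def power2_eq_square mult.assoc algebra_simps)
  qed
  define K where "K = L * M * h\<^sup>2"
  have K: "0 \<le> K" using L0 M0 by (simp add: K_def)
  define q where "q = 1 + h * L"
  have q: "1 \<le> q" using h L0 by (simp add: q_def)
  have "norm (euler W h n (c t0) - c (t0 + n * h)) \<le> n * K * q ^ n"
  proof (induction n)
    case (Suc n)
    define y where "y = euler W h n (c t0)"
    define t where "t = t0 + n * h"
    have "euler W h (Suc n) (c t0) - c (t0 + Suc n * h) =
        (y - c t) + h *\<^sub>R (W y - W (c t)) - (c (t + h) - c t - h *\<^sub>R W (c t))"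
      by (simp add: euler_Suc y_def t_def algebra_simps)
    then have "norm (euler W h (Suc n) (c t0) - c (t0 + Suc n * h)) \<le>
        norm ((y - c t) + h *\<^sub>R (W y - W (c t))) + norm (c (t + h) - c t - h *\<^sub>R W (c t))"
      by (simp only: norm_triangle_ineq4)
    also have "\<dots> \<le> (norm (y - c t) + norm (h *\<^sub>R (W y - W (c t)))) + K"
      using local[of t] unfolding K_def by (intro add_mono norm_triangle_ineq)
    also have "\<dots> \<le> (norm (y - c t) + h * (L * norm (y - c t))) + K"
      using h lipschitz_onD[OF L, of y "c t"] by (auto simp: dist_norm intro!: mult_left_mono)
    also have "\<dots> = q * norm (y - c t) + K" by (simp add: q_def algebra_simps)
    also have "\<dots> \<le> q * (n * K * q ^ n) + K * q ^ Suc n"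
      using Suc q K one_le_power[OF q, of "Suc n"] mult_left_mono[of 1 "q ^ Suc n" K]
      unfolding y_def t_def by (intro add_mono mult_left_mono) auto
    also have "\<dots> = Suc n * K * q ^ Suc n" by (simp add: algebra_simps)
    finally show ?case .
  qed (simp add: euler_0)
  then show ?thesis by (simp add: K_def q_def)
qed

text \<open>With \<open>N\<close> steps of length \<open>\<tau> / N\<close> the amplification stays
  below \<open>exp (\<tau> * L)\<close>, while the sum of the \<open>N\<close> one-step errors is of
  order \<open>1 / N\<close>.\<close>

lemma euler_converges:
  fixes W :: "'a::real_normed_vector \<Rightarrow> 'a"
  assumes L: "L-lipschitz_on UNIV W" and M: "\<And>x. norm (W x) \<le> M"
    and c: "\<And>t. (c has_vector_derivative W (c t)) (at t)" and \<tau>: "0 \<le> \<tau>"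
  shows "(\<lambda>n. euler W (\<tau> / Suc n) (Suc n) (c t0)) \<longlonglongrightarrow> c (t0 + \<tau>)"
proof -
  have L0: "0 \<le> L" using L by (rule lipschitz_on_nonneg)
  have M0: "0 \<le> M" using M norm_ge_zero order_trans by blast
  have "norm (euler W (\<tau> / Suc n) (Suc n) (c t0) - c (t0 + \<tau>)) \<le> (L * M * \<tau>\<^sup>2 * exp (\<tau> * L)) * inverse (Suc n)" for n
  proof -
    define N where "N = real (Suc n)"
    have N: "0 < N" by (simp add: N_def)
    have 1: "norm (euler W (\<tau> / Suc n) (Suc n) (c t0) - c (t0 + Suc n * (\<tau> / Suc n)))
        \<le> Suc n * (L * M * (\<tau> / Suc n)\<^sup>2) * (1 + (\<tau> / Suc n) * L) ^ Suc n"
      by (rule euler_error[OF L M c]) (use \<tau> in simp)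
    have "(1 + (\<tau> / Suc n) * L) ^ Suc n \<le> exp (\<tau> * L)"
    proof -
      have "- real (Suc n) \<le> \<tau> * L" using mult_nonneg_nonneg[OF \<tau> L0] by linarith
      then have "(1 + (\<tau> * L) / Suc n) ^ Suc n \<le> exp (\<tau> * L)"
        by (rule exp_ge_one_plus_x_over_n_power_n) simp
      then show ?thesis by simp
    qed
    then have 2: "Suc n * (L * M * (\<tau> / Suc n)\<^sup>2) * (1 + (\<tau> / Suc n) * L) ^ Suc n \<le>
        Suc n * (L * M * (\<tau> / Suc n)\<^sup>2) * exp (\<tau> * L)"
      using L0 M0 by (intro mult_left_mono) auto
    have 3: "Suc n * (L * M * (\<tau> / Suc n)\<^sup>2) * exp (\<tau> * L) = (L * M * \<tau>\<^sup>2 * exp (\<tau> * L)) * inverse (Suc n)"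
      unfolding N_def[symmetric] using N by (simp add: power2_eq_square field_simps)
    have "Suc n * (\<tau> / Suc n) = \<tau>" unfolding N_def[symmetric] using N by simp
    then show ?thesis using order_trans[OF 1 2] unfolding 3 by (simp only:)
  qed
  then have ev: "\<forall>\<^sub>F n in sequentially. norm (euler W (\<tau> / Suc n) (Suc n) (c t0) - c (t0 + \<tau>)) \<le>
      (L * M * \<tau>\<^sup>2 * exp (\<tau> * L)) * inverse (Suc n)"
    by (rule always_eventually[OF allI])
  have "(\<lambda>n. (L * M * \<tau>\<^sup>2 * exp (\<tau> * L)) * inverse (real (Suc n))) \<longlonglongrightarrow> (L * M * \<tau>\<^sup>2 * exp (\<tau> * L)) * 0"
    by (intro tendsto_mult_left LIMSEQ_inverse_real_of_nat)
  then have lim: "(\<lambda>n. (L * M * \<tau>\<^sup>2 * exp (\<tau> * L)) * inverse (real (Suc n))) \<longlonglongrightarrow> 0" by (simp only: mult_zero_right)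
  have "(\<lambda>n. euler W (\<tau> / Suc n) (Suc n) (c t0) - c (t0 + \<tau>)) \<longlonglongrightarrow> 0"
    by (rule Lim_null_comparison[OF ev lim])
  then show ?thesis by (rule LIM_zero_cancel)
qed

subsection \<open>Analytic dependence on parameters\<close>

text \<open>Analyticity of a path in one real variable, as the restriction to the real axis of a
  holomorphic curve in the complexification. One parameter fits the purpose: the initial covectors
  of interest form a circle.\<close>

definition param_analytic :: "(real \<Rightarrow> 'a::euclidean_space) \<Rightarrow> real \<Rightarrow> bool" where
  "param_analytic f x \<longleftrightarrow> (\<exists>r>0. \<exists>z. holo_curve (ball (of_real x) r) z \<and>
     (\<forall>y. \<bar>y - x\<bar> < r \<longrightarrow> z (of_real y) = (f y, 0)))"

lemma of_real_mem_ball: "complex_of_real y \<in> ball (of_real x) r \<longleftrightarrow> \<bar>y - x\<bar> < r"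
  by (simp add: dist_norm abs_minus_commute flip: of_real_diff)

lemma holo_curve_subset: "holo_curve U z \<Longrightarrow> V \<subseteq> U \<Longrightarrow> holo_curve V z"
  unfolding holo_curve_def by (blast intro: holomorphic_on_subset)

text \<open>Euler polygons started on a holomorphic curve are holomorphic in the parameter, and a
  uniformly bounded sequence of them has a holomorphic limit by Montel's theorem; on the real axis
  the limit is the solution.\<close>

lemma param_analytic_step:
  fixes W :: "'a::euclidean_space \<Rightarrow> 'a"
  assumes L: "L-lipschitz_on UNIV W" and M: "\<And>x. norm (W x) \<le> M"
    and W: "\<And>b. b \<in> Basis \<Longrightarrow> ranalytic_at (\<lambda>x. W x \<bullet> b) a"
  obtains \<rho> \<delta> where "0 < \<rho>" "0 < \<delta>"
    "\<And>c x0 t0 \<tau>. (\<And>x t. (c x has_vector_derivative W (c x t)) (at t)) \<Longrightarrow> c x0 t0 \<in> ball a \<rho> \<Longrightarrow>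
       0 \<le> \<tau> \<Longrightarrow> \<tau> \<le> \<delta> \<Longrightarrow> param_analytic (\<lambda>x. c x t0) x0 \<Longrightarrow> param_analytic (\<lambda>x. c x (t0 + \<tau>)) x0"
proof -
  obtain r H where r: "0 < r" and "continuous_on (ball (a, 0) r) H"
    and Hr: "\<And>x. x \<in> ball a r \<Longrightarrow> H (x, 0) = (W x, 0)"
    and Hh: "\<And>S z. open S \<Longrightarrow> holo_curve S z \<Longrightarrow> z ` S \<subseteq> ball (a, 0) r \<Longrightarrow> holo_curve S (\<lambda>w. H (z w))"
    and Hb: "\<And>z. z \<in> ball (a, 0) r \<Longrightarrow> H z \<in> ball (W a, 0) 1"
    by (rule ranalytic_map_extension[OF W zero_less_one], assumption, rule that)
  define B where "B = norm (W a) + 1"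
  have B: "0 < B" by (simp add: B_def add_nonneg_pos)
  have HB: "norm (H z) \<le> B" if "z \<in> ball (a, 0) r" for z
    using Hb[OF that] norm_triangle_ineq2[of "H z" "(W a, 0)"]
    by (simp add: B_def dist_norm norm_minus_commute norm_Pair_0)
  show ?thesis
  \<comment> \<open>Budget inside the ball of radius \<open>r\<close>: the start lies within
    \<open>r/4\<close> of \<open>a\<close>, a small parameter disc moves it by less than another
    \<open>r/4\<close>, and speed at most \<open>B\<close> over time at most \<open>r/(4*B)\<close>
    adds a last \<open>r/4\<close>.\<close>
  proof (rule that[of "r/4" "r/(4*B)"])
    show "0 < r/4" "0 < r/(4*B)" using r B by auto
    fix c :: "real \<Rightarrow> real \<Rightarrow> 'a" and x0 t0 \<tau> :: real
    assume c: "\<And>x t. (c x has_vector_derivative W (c x t)) (at t)" and start: "c x0 t0 \<in> ball a (r/4)"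
      and \<tau>: "0 \<le> \<tau>" "\<tau> \<le> r/(4*B)" and "param_analytic (\<lambda>x. c x t0) x0"
    then obtain r1 z where r1: "0 < r1" and z: "holo_curve (ball (of_real x0) r1) z"
      and zr: "\<And>y. \<bar>y - x0\<bar> < r1 \<Longrightarrow> z (of_real y) = (c y t0, 0)"
      unfolding param_analytic_def by blast
    have "isCont z (of_real x0)"
      using continuous_on_holo_curve[OF z] r1 by (simp add: continuous_on_eq_continuous_at)
    then obtain e where e: "0 < e" "\<And>w. dist w (of_real x0) < e \<Longrightarrow> dist (z w) (z (of_real x0)) < r/4"
      using r unfolding continuous_at_eps_delta by (meson divide_pos_pos zero_less_numeral)
    define r2 where "r2 = min e r1"
    have r2: "0 < r2" "r2 \<le> r1" using e(1) r1 by (auto simp: r2_def)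
    define S where "S = ball (complex_of_real x0) r2"
    have S: "open S" by (simp add: S_def)
    have zS: "holo_curve S z" by (rule holo_curve_subset[OF z]) (use r2 in \<open>auto simp: S_def\<close>)
    have z_near: "dist (a, 0) (z w) < r/2" if "w \<in> S" for w
    proof -
      have "dist (z (of_real x0)) (z w) < r/4" using e(2)[of w] that by (simp add: S_def r2_def dist_commute)
      moreover have "dist (a, 0) (z (of_real x0)) < r/4"
        using zr[of x0] r1 start by (simp add: dist_prod_def)
      ultimately show ?thesis using dist_triangle[of "(a, 0)" "z w" "z (of_real x0)"] by linarith
    qed
    define h where "h n = \<tau> / Suc n" for n
    have h0: "0 \<le> h n" for n using \<tau> by (simp add: h_def)
    have hk: "k * h n * B \<le> r/4" if "k \<le> Suc n" for k n
    proof -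
      have "k * h n \<le> Suc n * h n" using that h0 by (intro mult_right_mono) auto
      also have "\<dots> = \<tau>" by (simp add: h_def)
      finally have "k * h n * B \<le> r/(4*B) * B" using \<tau> B by (intro mult_right_mono) auto
      then show ?thesis using B by simp
    qed
    have stay: "dist (a, 0) (euler H (h n) k (z w)) < r/2 + k * h n * B" if "w \<in> S" "k \<le> Suc n" for w n k
      using that(2)
    proof (induction k)
      case 0 then show ?case using z_near[OF that(1)] by (simp add: euler_0)
    next
      case (Suc k)
      define y where "y = euler H (h n) k (z w)"
      have y: "dist (a, 0) y < r/2 + k * h n * B" using Suc by (simp add: y_def)
      then have "y \<in> ball (a, 0) r" using hk[of k n] Suc.prems r by simp
      then have "h n * norm (H y) \<le> h n * B" using HB h0 by (intro mult_left_mono) auto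
      moreover have "dist (a, 0) (y + h n *\<^sub>R H y) \<le> dist (a, 0) y + norm (h n *\<^sub>R H y)"
        by (metis dist_triangle dist_add_cancel add.right_neutral dist_0_norm)
      ultimately show ?case using y h0[of n] by (simp add: euler_Suc algebra_simps flip: y_def)
    qed
    have stay': "euler H (h n) k (z w) \<in> ball (a, 0) r" if "w \<in> S" "k \<le> Suc n" for w n k
      using stay[OF that] hk[OF that(2)] r unfolding mem_ball by linarith
    have holo: "holo_curve S (\<lambda>w. euler H (h n) k (z w))" if "k \<le> Suc n" for n k
      using that
    proof (induction k)
      case (Suc k)
      then have IH: "holo_curve S (\<lambda>w. euler H (h n) k (z w))" by simp
      have "(\<lambda>w. euler H (h n) k (z w)) ` S \<subseteq> ball (a, 0) r" using stay' Suc.prems by auto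
      then show ?case unfolding euler_Suc
        by (intro holo_curve_add holo_curve_scaleR IH Hh[OF S IH])
    qed (simp add: euler_0 zS)
    have real: "euler H (h n) k (z (of_real y)) = (euler W (h n) k (c y t0), 0)"
      if "\<bar>y - x0\<bar> < r2" "k \<le> Suc n" for y n k
      using that(2)
    proof (induction k)
      case 0 then show ?case using zr[of y] that r2 by (simp add: euler_0)
    next
      case (Suc k)
      then have IH: "euler H (h n) k (z (of_real y)) = (euler W (h n) k (c y t0), 0)" by simp
      have "of_real y \<in> S" unfolding S_def of_real_mem_ball by (rule that(1))
      then have "(euler W (h n) k (c y t0), 0::'a) \<in> ball (a, 0) r"
        using stay'[of "of_real y" k n] Suc.prems IH by simp
      then have "H (euler W (h n) k (c y t0), 0) = (W (euler W (h n) k (c y t0)), 0)"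
        unfolding real_mem_ball by (rule Hr)
      then show ?case by (simp add: euler_Suc IH)
    qed
    have "\<exists>g. g holomorphic_on S \<and> (\<forall>y. \<bar>y - x0\<bar> < r2 \<longrightarrow> g (of_real y) = of_real (c y (t0 + \<tau>) \<bullet> b))"
      if b: "b \<in> Basis" for b
    proof -
      define F where "F n w = cpx_coord b (euler H (h n) (Suc n) (z w))" for n w
      have Fh: "F n holomorphic_on S" for n
        using holo[of "Suc n" n] unfolding F_def[abs_def] holo_curve_def by blast
      have Fb: "norm (F n w) \<le> norm a + r" if "w \<in> S" for n w
      proof -
        have "norm (F n w) \<le> norm (euler H (h n) (Suc n) (z w)) * norm b"
          unfolding F_def by (rule norm_cpx_coord_le)
        also have "\<dots> \<le> norm (a, 0::'a) + r"
          using stay'[OF that, of "Suc n" n] b norm_triangle_ineq2[of "euler H (h n) (Suc n) (z w)" "(a, 0)"]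
          by (simp add: dist_norm norm_minus_commute)
        finally show ?thesis by (simp add: norm_Pair_0)
      qed
      \<comment> \<open>A convergent subsequence is enough. On the real axis the polygons converge
        to the solution by \<open>euler_converges\<close>, and this identifies the limit there; off
        the axis only boundedness is used.\<close>
      obtain g s where g: "g holomorphic_on S" and s: "strict_mono (s :: nat \<Rightarrow> nat)"
        and lim: "\<And>w. w \<in> S \<Longrightarrow> (\<lambda>n. F (s n) w) \<longlonglongrightarrow> g w"
      proof (rule Montel[OF S, of "range F" F])
        show "\<exists>B. \<forall>h\<in>range F. \<forall>w\<in>K. cmod (h w) \<le> B" if "K \<subseteq> S" for K
          using Fb that by (intro exI[of _ "norm a + r"]) auto
      qed (use Fh in auto)
      have "g (of_real y) = of_real (c y (t0 + \<tau>) \<bullet> b)" if y: "\<bar>y - x0\<bar> < r2" for y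
      proof -
        have yS: "of_real y \<in> S" unfolding S_def of_real_mem_ball by (rule y)
        have "F n (of_real y) = of_real (euler W (h n) (Suc n) (c y t0) \<bullet> b)" for n
          unfolding F_def using real[OF y, of "Suc n" n] by (simp add: cpx_coord_real)
        moreover have "(\<lambda>n. complex_of_real (euler W (h n) (Suc n) (c y t0) \<bullet> b)) \<longlonglongrightarrow> of_real (c y (t0 + \<tau>) \<bullet> b)"
          unfolding h_def by (intro tendsto_of_real tendsto_inner tendsto_const euler_converges[OF L M c \<tau>(1)])
        ultimately have "(\<lambda>n. F n (of_real y)) \<longlonglongrightarrow> of_real (c y (t0 + \<tau>) \<bullet> b)" by simp
        then have "(\<lambda>n. F (s n) (of_real y)) \<longlonglongrightarrow> of_real (c y (t0 + \<tau>) \<bullet> b)"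
          using LIMSEQ_subseq_LIMSEQ[OF _ s] by (fastforce simp: o_def)
        then show ?thesis using lim[OF yS] LIMSEQ_unique by blast
      qed
      then show ?thesis using g by blast
    qed
    then obtain g where g: "\<And>b. b \<in> Basis \<Longrightarrow> g b holomorphic_on S"
      "\<And>b y. b \<in> Basis \<Longrightarrow> \<bar>y - x0\<bar> < r2 \<Longrightarrow> g b (of_real y) = of_real (c y (t0 + \<tau>) \<bullet> b)"
      by metis
    define z' where "z' w = (\<Sum>b\<in>Basis. Re (g b w) *\<^sub>R b, \<Sum>b\<in>Basis. Im (g b w) *\<^sub>R b)" for w
    have "cpx_coord b (z' w) = g b w" if "b \<in> Basis" for b w
      using that by (simp add: z'_def cpx_coord_def complex_eq_iff)
    then have "holo_curve S z'"
      by (intro holo_curve_BasisI) (simp add: g(1))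
    moreover have "z' (of_real y) = (c y (t0 + \<tau>), 0)" if "\<bar>y - x0\<bar> < r2" for y
      using g(2)[OF _ that] by (simp add: z'_def euclidean_representation)
    ultimately show "param_analytic (\<lambda>x. c x (t0 + \<tau>)) x0"
      unfolding param_analytic_def S_def using r2(1) by blast
  qed
qed

text \<open>The admissible time step depends on the point reached. That analyticity at time
  \<open>a\<close> implies analyticity at time \<open>b\<close> is a transitive relation, valid on
  short intervals about every time, so bisection gives it for \<open>0\<close> and \<open>T\<close>.
  The radius in the parameter may shrink on the way; only analyticity at \<open>x0\<close> is
  carried.\<close>

theorem param_analytic_flow:
  fixes W :: "'a::euclidean_space \<Rightarrow> 'a"
  assumes L: "L-lipschitz_on UNIV W" and M: "\<And>x. norm (W x) \<le> M"
    and W: "\<And>a b. a \<in> K \<Longrightarrow> b \<in> Basis \<Longrightarrow> ranalytic_at (\<lambda>x. W x \<bullet> b) a"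
    and c: "\<And>x t. (c x has_vector_derivative W (c x t)) (at t)" and cK: "\<And>x t. c x t \<in> K"
    and 0: "param_analytic (\<lambda>x. c x 0) x0" and T: "0 \<le> T"
  shows "param_analytic (\<lambda>x. c x T) x0"
proof -
  have "param_analytic (\<lambda>x. c x 0) x0 \<longrightarrow> param_analytic (\<lambda>x. c x T) x0"
    using T
  proof (induction rule: Bolzano)
    case (local t)
    obtain \<rho> \<delta> where \<rho>: "0 < \<rho>" and \<delta>: "0 < \<delta>"
      and step: "\<And>t0 \<tau>. c x0 t0 \<in> ball (c x0 t) \<rho> \<Longrightarrow>
       0 \<le> \<tau> \<Longrightarrow> \<tau> \<le> \<delta> \<Longrightarrow> param_analytic (\<lambda>x. c x t0) x0 \<Longrightarrow> param_analytic (\<lambda>x. c x (t0 + \<tau>)) x0"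
      using param_analytic_step[OF L M W[OF cK[of x0 t]]] c by metis
    have "isCont (c x0) t" using c has_vector_derivative_continuous by blast
    then obtain e where e: "0 < e" "\<And>s. dist s t < e \<Longrightarrow> dist (c x0 s) (c x0 t) < \<rho>"
      using \<rho> unfolding continuous_at_eps_delta by blast
    show ?case
    proof (intro exI[of _ "min e \<delta>"] conjI allI impI)
      fix a b assume ab: "a \<le> t \<and> t \<le> b \<and> b - a < min e \<delta>" and "param_analytic (\<lambda>x. c x a) x0"
      then have "param_analytic (\<lambda>x. c x (a + (b - a))) x0"
        using e(2)[of a] by (intro step) (auto simp: dist_real_def dist_commute)
      then show "param_analytic (\<lambda>x. c x b) x0" by simp
    qed (use e \<delta> in auto)
  qed blast
  then show ?thesis using 0 by blast
qed

lemma param_analytic_isCont: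
  assumes "param_analytic f x" shows "isCont f x"
proof -
  obtain r z where r: "0 < r" and z: "holo_curve (ball (of_real x) r) z"
    and zr: "\<And>y. \<bar>y - x\<bar> < r \<Longrightarrow> z (of_real y) = (f y, 0)"
    using assms unfolding param_analytic_def by blast
  have "isCont z (of_real x)"
    using continuous_on_holo_curve[OF z] r by (simp add: continuous_on_eq_continuous_at)
  moreover have "isCont complex_of_real x" by (intro continuous_intros)
  ultimately have "isCont (\<lambda>y. z (complex_of_real y)) x" by (rule isCont_o2[rotated])
  then have "isCont (\<lambda>y. fst (z (complex_of_real y))) x"
    by (rule continuous_fst)
  moreover have "\<forall>\<^sub>F y in nhds x. f y = fst (z (of_real y))"
    using r zr by (auto simp: eventually_nhds_metric dist_real_def intro!: exI[of _ r])
  ultimately show ?thesis using isCont_cong[of f "\<lambda>y. fst (z (of_real y))" x] by blast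
qed

lemma param_analytic_add:
  assumes "param_analytic f x" "param_analytic g x"
  shows "param_analytic (\<lambda>y. f y + g y) x"
proof -
  obtain r z where r: "0 < r" and z: "holo_curve (ball (of_real x) r) z"
    and zr: "\<And>y. \<bar>y - x\<bar> < r \<Longrightarrow> z (of_real y) = (f y, 0)"
    using assms(1) unfolding param_analytic_def by blast
  obtain s u where s: "0 < s" and u: "holo_curve (ball (of_real x) s) u"
    and us: "\<And>y. \<bar>y - x\<bar> < s \<Longrightarrow> u (of_real y) = (g y, 0)"
    using assms(2) unfolding param_analytic_def by blast
  have "holo_curve (ball (of_real x) (min r s)) z" by (rule holo_curve_subset[OF z]) auto
  moreover have "holo_curve (ball (of_real x) (min r s)) u" by (rule holo_curve_subset[OF u]) auto
  ultimately have "holo_curve (ball (of_real x) (min r s)) (\<lambda>w. z w + u w)" by (rule holo_curve_add)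
  moreover have "z (of_real y) + u (of_real y) = (f y + g y, 0)" if "\<bar>y - x\<bar> < min r s" for y
    using zr us that by simp
  ultimately show ?thesis
    unfolding param_analytic_def using r s by (intro exI[of _ "min r s"]) auto
qed

lemma param_analytic_shift:
  assumes "param_analytic f (x + s)"
  shows "param_analytic (\<lambda>y. f (y + s)) x"
proof -
  obtain r z where r: "0 < r" and z: "holo_curve (ball (of_real (x + s)) r) z"
    and zr: "\<And>y. \<bar>y - (x + s)\<bar> < r \<Longrightarrow> z (of_real y) = (f y, 0)"
    using assms unfolding param_analytic_def by blast
  have "(\<lambda>w. cpx_coord b (z (w + of_real s))) holomorphic_on ball (of_real x) r" for b
  proof -
    have "(\<lambda>w. w + complex_of_real s) ` ball (of_real x) r \<subseteq> ball (of_real (x + s)) r"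
      by (auto simp: dist_norm)
    moreover have "(\<lambda>w. w + complex_of_real s) holomorphic_on ball (of_real x) r"
      by (intro holomorphic_intros)
    ultimately show ?thesis
      using z holomorphic_on_compose_gen[of "\<lambda>w. w + complex_of_real s" _ "\<lambda>w. cpx_coord b (z w)"]
      unfolding holo_curve_def by (force simp: o_def)
  qed
  then have "holo_curve (ball (of_real x) r) (\<lambda>w. z (w + of_real s))" by (simp add: holo_curve_def)
  moreover have "z (of_real y + of_real s) = (f (y + s), 0)" if "\<bar>y - x\<bar> < r" for y
    using zr[of "y + s"] that by simp
  ultimately show ?thesis unfolding param_analytic_def using r by blast
qed

lemma param_analytic_snd:
  assumes "param_analytic f x" shows "param_analytic (\<lambda>y. snd (f y)) x"
proof -
  obtain r z where r: "0 < r" and z: "holo_curve (ball (of_real x) r) z"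
    and zr: "\<And>y. \<bar>y - x\<bar> < r \<Longrightarrow> z (of_real y) = (f y, 0)"
    using assms unfolding param_analytic_def by blast
  have "cpx_coord b (snd (fst u), snd (snd u)) = cpx_coord (0, b) u" for b and u :: "('a \<times> 'b) \<times> ('a \<times> 'b)"
    by (simp add: cpx_coord_def inner_prod_def)
  then have "holo_curve (ball (of_real x) r) (\<lambda>w. (snd (fst (z w)), snd (snd (z w))))"
    using z by (simp add: holo_curve_def)
  moreover have "(snd (fst (z (of_real y))), snd (snd (z (of_real y)))) = (snd (f y), 0)" if "\<bar>y - x\<bar> < r" for y
    using zr[OF that] by simp
  ultimately show ?thesis unfolding param_analytic_def using r by blast
qed

lemma param_analytic_circle:
  fixes p :: "'a::euclidean_space" and e f :: "'b::euclidean_space"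
  shows "param_analytic (\<lambda>y. (p, cos y *\<^sub>R e + sin y *\<^sub>R f)) x"
proof -
  define z :: "complex \<Rightarrow> ('a \<times> 'b) \<times> ('a \<times> 'b)"
    where "z w = ((p, Re (cos w) *\<^sub>R e + Re (sin w) *\<^sub>R f), (0, Im (cos w) *\<^sub>R e + Im (sin w) *\<^sub>R f))" for w
  have "cpx_coord b (z w) = of_real (p \<bullet> fst b) + cos w * of_real (e \<bullet> snd b) + sin w * of_real (f \<bullet> snd b)" for b w
    by (simp add: z_def cpx_coord_def inner_prod_def inner_add_left complex_eq_iff)
  then have "holo_curve (ball (of_real x) 1) z"
    by (auto simp: holo_curve_def intro!: holomorphic_intros)
  moreover have "z (of_real y) = ((p, cos y *\<^sub>R e + sin y *\<^sub>R f), 0)" for y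
    by (simp add: z_def zero_prod_def cos_of_real sin_of_real)
  ultimately show ?thesis unfolding param_analytic_def by (intro exI[of _ 1]) auto
qed

text \<open>The limit points of the zero set form a closed set. It is open by the identity theorem
  and nonempty by compactness of \<open>{a..b}\<close>, hence the whole line.\<close>

theorem param_analytic_zeros:
  assumes f: "\<And>x. param_analytic f x" and inf: "infinite {x \<in> {a..b}. f x = 0}"
  shows "f x = 0"
proof -
  define Z where "Z = {x. f x = 0}"
  \<comment> \<open>Identity theorem on a complex disc about \<open>x\<close>: the real zeros, seen
    as complex numbers, accumulate at its centre.\<close>
  have near: "\<exists>r>0. \<forall>y. \<bar>y - x\<bar> < r \<longrightarrow> f y = 0" if x: "x islimpt Z" for x
  proof -
    obtain r z where r: "0 < r" and z: "holo_curve (ball (of_real x) r) z"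
      and zr: "\<And>y. \<bar>y - x\<bar> < r \<Longrightarrow> z (of_real y) = (f y, 0)"
      using f unfolding param_analytic_def by blast
    define U where "U = complex_of_real ` {y \<in> Z. \<bar>y - x\<bar> < r}"
    have lim: "of_real x islimpt U"
      unfolding islimpt_approachable
    proof (intro allI impI)
      fix e :: real assume "0 < e"
      then obtain y where "y \<in> Z" "y \<noteq> x" "dist y x < min e r"
        using x r unfolding islimpt_approachable by (metis min_less_iff_conj)
      then show "\<exists>w\<in>U. w \<noteq> complex_of_real x \<and> dist w (of_real x) < e"
        by (intro bexI[of _ "of_real y"]) (auto simp: U_def dist_real_def dist_norm simp flip: of_real_diff)
    qed
    have "f y \<bullet> b = 0" if y: "\<bar>y - x\<bar> < r" for y b
    proof -
      have "cpx_coord b (z (of_real y)) = 0"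
      proof (rule analytic_continuation[where f = "\<lambda>w. cpx_coord b (z w)", OF _ _ _ _ _ lim])
        show "(\<lambda>w. cpx_coord b (z w)) holomorphic_on ball (of_real x) r"
          using z by (simp add: holo_curve_def)
        show "U \<subseteq> ball (of_real x) r" unfolding U_def using of_real_mem_ball by blast
        show "of_real y \<in> ball (complex_of_real x) r" unfolding of_real_mem_ball by (rule y)
        show "cpx_coord b (z w) = 0" if "w \<in> U" for w
          using that zr by (auto simp: U_def Z_def cpx_coord_real)
      qed (use r in auto)
      then show ?thesis using zr[OF y] by (simp add: cpx_coord_real)
    qed
    then have "f y = 0" if "\<bar>y - x\<bar> < r" for y using that inner_eq_zero_iff by blast
    then show ?thesis using r by blast
  qed
  define A where "A = {x. x islimpt Z}"
  have "open A"
    unfolding open_dist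
  proof
    fix x assume "x \<in> A"
    then obtain r where r: "0 < r" "\<And>y. \<bar>y - x\<bar> < r \<Longrightarrow> f y = 0" using near unfolding A_def by blast
    have "y islimpt Z" if "dist y x < r" for y
    proof (rule islimpt_subset)
      show "ball x r \<subseteq> Z" using r(2) by (auto simp: Z_def dist_real_def)
      show "y islimpt ball x r"
        using that by (intro interior_limit_point) (simp add: dist_commute)
    qed
    then show "\<exists>e>0. \<forall>y. dist y x < e \<longrightarrow> y \<in> A" using r(1) by (auto simp: A_def)
  qed
  moreover have "closed A" unfolding A_def by (rule closed_limpts)
  moreover have "A \<noteq> {}"
  proof -
    have "compact {a..b}" by simp
    then obtain x where "x islimpt {x \<in> {a..b}. f x = 0}"
      using inf unfolding compact_eq_Bolzano_Weierstrass by (metis (lifting) mem_Collect_eq subsetI)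
    then have "x islimpt Z" by (rule islimpt_subset) (auto simp: Z_def)
    then show ?thesis by (auto simp: A_def)
  qed
  ultimately have "A = UNIV" using clopen by blast
  then show ?thesis using near[of x] by (force simp: A_def)
qed

section \<open>The metric in stereographic charts\<close>

lemma tangent_plane_expansion:
  fixes x b1 b2 v :: "real^3"
  assumes x: "x \<noteq> 0" and b: "b1 \<in> tangent_plane x" "b2 \<in> tangent_plane x" "b1 \<noteq> 0" "b2 \<noteq> 0" "b1 \<bullet> b2 = 0"
    and v: "v \<in> tangent_plane x"
  shows "v = ((v \<bullet> b1) / (b1 \<bullet> b1)) *\<^sub>R b1 + ((v \<bullet> b2) / (b2 \<bullet> b2)) *\<^sub>R b2"
proof -
  define S where "S = {x, b1, b2}"
  have orth: "x \<bullet> b1 = 0" "x \<bullet> b2 = 0" "b1 \<bullet> x = 0" "b2 \<bullet> x = 0" "b2 \<bullet> b1 = 0"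
    using b by (auto simp: tangent_plane_def inner_commute)
  have ne: "x \<noteq> b1" "x \<noteq> b2" "b1 \<noteq> b2"
    using orth b x by (metis inner_eq_zero_iff)+
  have "pairwise orthogonal S"
    using orth b(5) by (auto simp: pairwise_def S_def orthogonal_def)
  then have "independent S"
    using x b by (intro pairwise_orthogonal_independent) (auto simp: S_def)
  moreover have "card S = DIM(real^3)" using ne by (simp add: S_def)
  ultimately have span: "span S = UNIV"
    using card_eq_dim[of S UNIV] by (auto simp: S_def)
  \<comment> \<open>The residual of the expansion is orthogonal to \<open>x\<close>,
    \<open>b1\<close> and \<open>b2\<close>, which span the space.\<close>
  define w where "w = v - (((v \<bullet> b1) / (b1 \<bullet> b1)) *\<^sub>R b1 + ((v \<bullet> b2) / (b2 \<bullet> b2)) *\<^sub>R b2)"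
  have "w \<bullet> x = 0" "w \<bullet> b1 = 0" "w \<bullet> b2 = 0"
    using orth b v by (auto simp: w_def inner_diff_left inner_add_left tangent_plane_def)
  then have "orthogonal w y" if "y \<in> S" for y using that by (auto simp: S_def orthogonal_def)
  then have "orthogonal w y" for y
    using orthogonal_to_span[of y S w] span by auto
  then have "w = 0" using orthogonal_self by blast
  then show ?thesis by (simp add: w_def)
qed

text \<open>The frame is orthogonal for the Euclidean inner product and neither orthogonal for
  \<open>g x\<close> nor normalised. This is what a stereographic chart supplies, and it keeps the
  formulas for \<open>sharp\<close> and \<open>cometric\<close> rational.\<close>

locale tangent_frame =
  fixes g :: metric and x b1 b2 :: "real^3"
  assumes riem: "riemannian_metric g" and x: "x \<in> S2"
    and b: "b1 \<in> tangent_plane x" "b2 \<in> tangent_plane x" "b1 \<noteq> 0" "b2 \<noteq> 0" "b1 \<bullet> b2 = 0"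
begin

definition "G11 = g x b1 b1"
definition "G12 = g x b1 b2"
definition "G22 = g x b2 b2"
definition "gdet = G11 * G22 - G12 * G12"

lemma tangent_comb: "u \<in> tangent_plane x \<Longrightarrow> v \<in> tangent_plane x \<Longrightarrow> r *\<^sub>R u + s *\<^sub>R v \<in> tangent_plane x"
  by (simp add: tangent_plane_def inner_add_left)

lemma g_sym: "u \<in> tangent_plane x \<Longrightarrow> v \<in> tangent_plane x \<Longrightarrow> g x u v = g x v u"
  using riem x unfolding riemannian_metric_def by blast

lemma g_left: "u \<in> tangent_plane x \<Longrightarrow> v \<in> tangent_plane x \<Longrightarrow> w \<in> tangent_plane x \<Longrightarrow>
    g x (r *\<^sub>R u + s *\<^sub>R v) w = r * g x u w + s * g x v w"
  using riem x unfolding riemannian_metric_def by blast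

lemma g_right: "u \<in> tangent_plane x \<Longrightarrow> v \<in> tangent_plane x \<Longrightarrow> w \<in> tangent_plane x \<Longrightarrow>
    g x w (r *\<^sub>R u + s *\<^sub>R v) = r * g x w u + s * g x w v"
  using g_left g_sym tangent_comb by metis

lemma g_pos: "u \<in> tangent_plane x \<Longrightarrow> u \<noteq> 0 \<Longrightarrow> 0 < g x u u"
  using riem x unfolding riemannian_metric_def by blast

lemma G22_pos: "0 < G22" and G11_pos: "0 < G11"
  using g_pos b by (auto simp: G22_def G11_def)

lemma gdet_pos: "0 < gdet"
proof -
  \<comment> \<open>\<open>G22\<close> times the component of \<open>b1\<close> that is
    \<open>g\<close>-orthogonal to \<open>b2\<close>; its squared \<open>g\<close>-length is
    \<open>G22 * gdet\<close>.\<close>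
  define v where "v = G22 *\<^sub>R b1 + (- G12) *\<^sub>R b2"
  have v: "v \<in> tangent_plane x" unfolding v_def using b by (intro tangent_comb) auto
  have "v \<bullet> b1 = G22 * (b1 \<bullet> b1)" using b(5) by (simp add: v_def inner_diff_left inner_commute[of b2 b1])
  then have "v \<noteq> 0" using G22_pos b(3) by auto
  then have "0 < g x v v" using g_pos v by blast
  also have "g x v v = G22 * g x b1 v + (- G12) * g x b2 v"
    unfolding v_def by (rule g_left[OF b(1,2)]) (use v in \<open>simp only: v_def\<close>)
  also have "g x b1 v = G22 * G11 - G12 * G12"
    unfolding v_def using g_right[OF b(1,2) b(1), of G22 "- G12"] by (simp add: G11_def G12_def)
  also have "g x b2 v = 0"
    unfolding v_def using g_right[OF b(1,2) b(2), of G22 "- G12"] g_sym[OF b(1,2)] by (simp add: G22_def G12_def)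
  finally show ?thesis using G22_pos by (simp add: gdet_def zero_less_mult_iff mult.commute)
qed

text \<open>Cramer's rule: the inverse Gram matrix applied to the values of \<xi> on the
  frame.\<close>

definition "shp \<xi> = ((G22 * (\<xi> \<bullet> b1) - G12 * (\<xi> \<bullet> b2)) / gdet) *\<^sub>R b1 + ((G11 * (\<xi> \<bullet> b2) - G12 * (\<xi> \<bullet> b1)) / gdet) *\<^sub>R b2"

lemma shp_tangent: "shp \<xi> \<in> tangent_plane x"
  unfolding shp_def using b by (intro tangent_comb)

lemma expand: "v \<in> tangent_plane x \<Longrightarrow> v = ((v \<bullet> b1) / (b1 \<bullet> b1)) *\<^sub>R b1 + ((v \<bullet> b2) / (b2 \<bullet> b2)) *\<^sub>R b2"
  using tangent_plane_expansion[OF _ b] x by force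

lemma g_shp:
  assumes w: "w \<in> tangent_plane x" shows "g x (shp \<xi>) w = \<xi> \<bullet> w"
proof -
  have 1: "g x (shp \<xi>) b1 = \<xi> \<bullet> b1"
  proof -
    have "g x (shp \<xi>) b1 = ((G22 * (\<xi> \<bullet> b1) - G12 * (\<xi> \<bullet> b2)) / gdet) * G11 + ((G11 * (\<xi> \<bullet> b2) - G12 * (\<xi> \<bullet> b1)) / gdet) * G12"
      unfolding shp_def g_left[OF b(1,2) b(1)] using g_sym[OF b(1,2)] by (simp add: G11_def G12_def)
    also have "\<dots> = (\<xi> \<bullet> b1) * gdet / gdet"
      by (simp add: gdet_def add_divide_distrib[symmetric] algebra_simps)
    finally show ?thesis using gdet_pos by simp
  qed
  have 2: "g x (shp \<xi>) b2 = \<xi> \<bullet> b2"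
  proof -
    have "g x (shp \<xi>) b2 = ((G22 * (\<xi> \<bullet> b1) - G12 * (\<xi> \<bullet> b2)) / gdet) * G12 + ((G11 * (\<xi> \<bullet> b2) - G12 * (\<xi> \<bullet> b1)) / gdet) * G22"
      unfolding shp_def g_left[OF b(1,2) b(2)] by (simp add: G22_def G12_def)
    also have "\<dots> = (\<xi> \<bullet> b2) * gdet / gdet"
      by (simp add: gdet_def add_divide_distrib[symmetric] algebra_simps)
    finally show ?thesis using gdet_pos by simp
  qed
  have "g x (shp \<xi>) w = (w \<bullet> b1) / (b1 \<bullet> b1) * g x (shp \<xi>) b1 + (w \<bullet> b2) / (b2 \<bullet> b2) * g x (shp \<xi>) b2"
    by (subst (1) expand[OF w]) (rule g_right[OF b(1,2) shp_tangent])
  moreover have "\<xi> \<bullet> w = (w \<bullet> b1) / (b1 \<bullet> b1) * (\<xi> \<bullet> b1) + (w \<bullet> b2) / (b2 \<bullet> b2) * (\<xi> \<bullet> b2)"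
    by (subst (1) expand[OF w]) (simp add: inner_add_right)
  ultimately show ?thesis using 1 2 by simp
qed

lemma sharp_eq: "sharp g x \<xi> = shp \<xi>"
  unfolding sharp_def
proof (rule the_equality)
  show "shp \<xi> \<in> tangent_plane x \<and> (\<forall>w\<in>tangent_plane x. g x (shp \<xi>) w = \<xi> \<bullet> w)"
    using shp_tangent g_shp by blast
  fix v assume v: "v \<in> tangent_plane x \<and> (\<forall>w\<in>tangent_plane x. g x v w = \<xi> \<bullet> w)"
  define d where "d = 1 *\<^sub>R v + (- 1) *\<^sub>R shp \<xi>"
  have d: "d \<in> tangent_plane x" unfolding d_def using v shp_tangent by (intro tangent_comb) auto
  have "g x d d = 1 * g x v d + (- 1) * g x (shp \<xi>) d"
    unfolding d_def by (rule g_left) (use v shp_tangent d in \<open>auto simp only: d_def\<close>)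
  also have "\<dots> = 0" using v d g_shp[OF d] by simp
  finally have "d = 0" using g_pos[OF d] by force
  then show "v = shp \<xi>" by (simp add: d_def)
qed

lemma cometric_eq:
  "cometric g x \<xi> \<zeta> = (G22 * (\<xi> \<bullet> b1) * (\<zeta> \<bullet> b1) - G12 * ((\<xi> \<bullet> b1) * (\<zeta> \<bullet> b2) + (\<xi> \<bullet> b2) * (\<zeta> \<bullet> b1))
     + G11 * (\<xi> \<bullet> b2) * (\<zeta> \<bullet> b2)) / gdet"
proof -
  have "cometric g x \<xi> \<zeta> = \<xi> \<bullet> shp \<zeta>"
    unfolding cometric_def sharp_eq by (rule g_shp[OF shp_tangent])
  then show ?thesis
    by (simp add: shp_def inner_add_right add_divide_distrib[symmetric] algebra_simps)
qed

lemma cometric_pos: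
  assumes "\<xi> \<in> tangent_plane x" "\<xi> \<noteq> 0" shows "0 < cometric g x \<xi> \<xi>"
proof -
  have "shp \<xi> \<noteq> 0"
  proof
    assume "shp \<xi> = 0"
    then have "g x (0 *\<^sub>R b1 + 0 *\<^sub>R b2) \<xi> = \<xi> \<bullet> \<xi>" using g_shp[OF assms(1), of \<xi>] by simp
    then have "\<xi> \<bullet> \<xi> = 0" unfolding g_left[OF b(1,2) assms(1)] by simp
    then show False using assms(2) by simp
  qed
  then show ?thesis unfolding cometric_def sharp_eq using g_pos[OF shp_tangent] by blast
qed

end

section \<open>Stereographic projection extended to the ambient space\<close>

definition stereo_coord :: "real \<Rightarrow> real^3 \<Rightarrow> real^2" where
  "stereo_coord s x = vector [x$1 / (norm x - s * x$3), x$2 / (norm x - s * x$3)]"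

lemma norm_sq_3: "(norm (x::real^3))\<^sup>2 = (x$1)\<^sup>2 + (x$2)\<^sup>2 + (x$3)\<^sup>2"
  by (simp add: norm_vec_def L2_set_def sum_3)

lemma norm_sq_2: "(norm (x::real^2))\<^sup>2 = (x$1)\<^sup>2 + (x$2)\<^sup>2"
  by (simp add: norm_vec_def L2_set_def sum_2)

lemma inner_3: "(x::real^3) \<bullet> y = x$1 * y$1 + x$2 * y$2 + x$3 * y$3"
  by (simp add: inner_vec_def sum_3)

lemma stereo_stereo_coord:
  assumes s: "s \<in> {1, -1}" and x: "x \<noteq> 0" "norm x \<noteq> s * x$3"
  shows "stereo s (stereo_coord s x) = (1 / norm x) *\<^sub>R x"
proof -
  define n where "n = norm x"
  define d where "d = n - s * x$3"
  have n: "0 < n" using x by (simp add: n_def)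
  have d: "d \<noteq> 0" using x by (simp add: d_def n_def)
  have ss: "s * s = 1" using s by auto
  have nn: "n\<^sup>2 = (x$1)\<^sup>2 + (x$2)\<^sup>2 + (x$3)\<^sup>2" unfolding n_def by (rule norm_sq_3)
  define y where "y = stereo_coord s x"
  have y: "y$1 = x$1 / d" "y$2 = x$2 / d" by (simp_all add: y_def stereo_coord_def d_def n_def)
  \<comment> \<open>A difference of squares, using \<open>s * s = 1\<close>; it cancels one factor
    \<open>d\<close> in the squared norm of \<open>y\<close>.\<close>
  have "(x$1)\<^sup>2 + (x$2)\<^sup>2 = d * (n + s * x$3)"
  proof -
    have "d * (n + s * x$3) = n\<^sup>2 - (s * s) * (x$3)\<^sup>2" unfolding d_def power2_eq_square by algebra
    then show ?thesis using nn ss by simp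
  qed
  then have "(norm y)\<^sup>2 = d * (n + s * x$3) / d\<^sup>2"
    unfolding norm_sq_2 y power_divide add_divide_distrib[symmetric] by simp
  then have ny: "(norm y)\<^sup>2 = (n + s * x$3) / d" using d by (simp add: power2_eq_square)
  have N: "(norm y)\<^sup>2 + 1 = 2 * n / d" unfolding ny using d by (simp add: field_simps d_def)
  have N': "(norm y)\<^sup>2 - 1 = 2 * s * x$3 / d" unfolding ny using d by (simp add: field_simps d_def)
  have "stereo s y = (1 / n) *\<^sub>R x"
    unfolding stereo_def N N'
    using n d ss by (simp add: vec_eq_iff forall_3 y field_simps)
  then show ?thesis by (simp add: y_def n_def)
qed

definition stereo_d1 :: "real \<Rightarrow> real^2 \<Rightarrow> real^3" where
  "stereo_d1 s y = (1 / ((norm y)\<^sup>2 + 1)\<^sup>2) *\<^sub>R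
     vector [2 * ((norm y)\<^sup>2 + 1) - 4 * y$1 * y$1, - 4 * y$1 * y$2, 4 * s * y$1]"

definition stereo_d2 :: "real \<Rightarrow> real^2 \<Rightarrow> real^3" where
  "stereo_d2 s y = (1 / ((norm y)\<^sup>2 + 1)\<^sup>2) *\<^sub>R
     vector [- 4 * y$1 * y$2, 2 * ((norm y)\<^sup>2 + 1) - 4 * y$2 * y$2, 4 * s * y$2]"

lemma stereo_has_derivative:
  "(stereo s has_derivative (\<lambda>h. (h$1) *\<^sub>R stereo_d1 s y + (h$2) *\<^sub>R stereo_d2 s y)) (at y)"
proof -
  have nth: "((\<lambda>y::real^2. y $ i) has_derivative (\<lambda>h. h $ i)) (at y)" for i
    by (rule bounded_linear_imp_has_derivative[OF bounded_linear_vec_nth])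
  define N where "N y = y$1 * y$1 + y$2 * y$2 + 1" for y :: "real^2"
  have N: "(norm y)\<^sup>2 + 1 = N y" for y :: "real^2"    using norm_sq_2[of y] by (simp add: N_def power2_eq_square)
  have Npos: "N y \<noteq> 0" for y using N[of y] zero_le_power2[of "norm y"] by linarith
  have dN: "(N has_derivative (\<lambda>h. 2 * (y$1 * h$1 + y$2 * h$2))) (at y)"
    unfolding N_def[abs_def] by (rule derivative_eq_intros nth refl)+ (auto simp: algebra_simps)
  have dinv: "((\<lambda>y. 1 / N y) has_derivative (\<lambda>h. - (2 * (y$1 * h$1 + y$2 * h$2)) / (N y)\<^sup>2)) (at y)"
    by (rule derivative_eq_intros dN refl Npos)+ (auto simp: power2_eq_square divide_inverse)
  have st: "stereo s = (\<lambda>y. (1 / N y) *\<^sub>R ((2 * y$1) *\<^sub>R axis 1 1 + (2 * y$2) *\<^sub>R axis 2 1 + (s * (N y - 2)) *\<^sub>R axis 3 1))"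
    by (rule ext) (simp add: stereo_def N[symmetric] vec_eq_iff forall_3 axis_def)
  define D :: "real^2 \<Rightarrow> real^3" where
    "D h = (1 / N y) *\<^sub>R ((2 * h$1) *\<^sub>R axis 1 1 + (2 * h$2) *\<^sub>R axis 2 1
        + (s * (2 * (y$1 * h$1 + y$2 * h$2))) *\<^sub>R axis 3 1) + (- (2 * (y$1 * h$1 + y$2 * h$2)) / (N y)\<^sup>2) *\<^sub>R
        ((2 * y$1) *\<^sub>R axis 1 1 + (2 * y$2) *\<^sub>R axis 2 1 + (s * (N y - 2)) *\<^sub>R axis 3 1)" for h
  have "(stereo s has_derivative D) (at y)"
    unfolding st D_def[abs_def] by (rule derivative_eq_intros dN dinv nth refl)+ (auto simp: algebra_simps)
  moreover have "D = (\<lambda>h. (h$1) *\<^sub>R stereo_d1 s y + (h$2) *\<^sub>R stereo_d2 s y)"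
  proof (rule ext)
    fix h
    have d1: "(stereo_d1 s y)$1 = (2 * N y - 4 * y$1 * y$1) / (N y)\<^sup>2"
      "(stereo_d1 s y)$2 = (- 4 * y$1 * y$2) / (N y)\<^sup>2" "(stereo_d1 s y)$3 = (4 * s * y$1) / (N y)\<^sup>2"
      and d2: "(stereo_d2 s y)$1 = (- 4 * y$1 * y$2) / (N y)\<^sup>2"
      "(stereo_d2 s y)$2 = (2 * N y - 4 * y$2 * y$2) / (N y)\<^sup>2" "(stereo_d2 s y)$3 = (4 * s * y$2) / (N y)\<^sup>2"
      by (simp_all add: stereo_d1_def stereo_d2_def N)
    show "D h = (h$1) *\<^sub>R stereo_d1 s y + (h$2) *\<^sub>R stereo_d2 s y"
      unfolding D_def
      using Npos[of y] by (simp add: vec_eq_iff forall_3 axis_def d1 d2 field_simps power2_eq_square)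
  qed
  ultimately show ?thesis by simp
qed

lemma stereo_frechet:
  "frechet_derivative (stereo s) (at y) (axis 1 1) = stereo_d1 s y"
  "frechet_derivative (stereo s) (at y) (axis 2 1) = stereo_d2 s y"
  unfolding frechet_derivative_at[OF stereo_has_derivative, symmetric] by (simp_all add: axis_def)

text \<open>Stereographic projection is conformal: both partial derivatives have squared length
  \<open>4 / N\<^sup>2\<close> and are orthogonal. Clearing denominators leaves polynomial
  identities in the entries of \<open>v0\<close>, \<open>v1\<close>, \<open>v2\<close>.\<close>

lemma stereo_frame:
  assumes s: "s \<in> {1, -1}"
  shows "stereo s y \<in> S2" "stereo_d1 s y \<in> tangent_plane (stereo s y)" "stereo_d2 s y \<in> tangent_plane (stereo s y)"
    "stereo_d1 s y \<noteq> 0" "stereo_d2 s y \<noteq> 0" "stereo_d1 s y \<bullet> stereo_d2 s y = 0"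
proof -
  define a c where "a = y$1" and "c = y$2"
  define N where "N = a * a + c * c + 1"
  have N: "(norm y)\<^sup>2 + 1 = N" "(norm y)\<^sup>2 - 1 = N - 2" "(norm y)\<^sup>2 = N - 1"
    using norm_sq_2[of y] by (simp_all add: N_def a_def c_def power2_eq_square)
  have N1: "1 \<le> N" by (simp add: N_def)
  have ss: "s * s = 1" using s by auto
  have st: "stereo s y = (1/N) *\<^sub>R vector [2 * a, 2 * c, s * (N - 2)]"
    unfolding stereo_def N by (simp add: a_def c_def)
  have d1: "stereo_d1 s y = (1/N\<^sup>2) *\<^sub>R vector [2 * N - 4 * a * a, - 4 * a * c, 4 * s * a]"
    unfolding stereo_d1_def N by (simp add: a_def c_def)
  have d2: "stereo_d2 s y = (1/N\<^sup>2) *\<^sub>R vector [- 4 * a * c, 2 * N - 4 * c * c, 4 * s * c]"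
    unfolding stereo_d2_def N by (simp add: a_def c_def)
  define v0 v1 v2 :: "real^3" where "v0 = vector [2 * a, 2 * c, s * (N - 2)]"
    and "v1 = vector [2 * N - 4 * a * a, - 4 * a * c, 4 * s * a]"
    and "v2 = vector [- 4 * a * c, 2 * N - 4 * c * c, 4 * s * c]"
  have s3: "s * (s * r) = r" for r using ss by (simp flip: mult.assoc)
  have "v0 \<bullet> v0 = N * N" by (simp add: v0_def inner_3 N_def algebra_simps s3 ss)
  moreover have "v1 \<bullet> v0 = 0" by (simp add: v0_def v1_def inner_3 N_def algebra_simps s3 ss)
  moreover have "v2 \<bullet> v0 = 0" by (simp add: v0_def v2_def inner_3 N_def algebra_simps s3 ss)
  moreover have "v1 \<bullet> v2 = 0" by (simp add: v1_def v2_def inner_3 N_def algebra_simps s3 ss)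
  moreover have "v1 \<bullet> v1 = 4 * N * N" by (simp add: v1_def inner_3 N_def algebra_simps s3 ss)
  moreover have "v2 \<bullet> v2 = 4 * N * N" by (simp add: v2_def inner_3 N_def algebra_simps s3 ss)
  ultimately have v: "v0 \<bullet> v0 = N * N" "v1 \<bullet> v0 = 0" "v2 \<bullet> v0 = 0" "v1 \<bullet> v2 = 0" "v1 \<noteq> 0" "v2 \<noteq> 0"
    using N1 by auto
  have "norm v0 = N" using v(1) N1 by (simp add: norm_eq_sqrt_inner)
  note st' = st[folded v0_def] and d1' = d1[folded v1_def] and d2' = d2[folded v2_def]
  show "stereo s y \<in> S2" unfolding st' using N1 \<open>norm v0 = N\<close> by simp
  show "stereo_d1 s y \<in> tangent_plane (stereo s y)" "stereo_d2 s y \<in> tangent_plane (stereo s y)"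
    unfolding tangent_plane_def st' d1' d2' using v by simp_all
  show "stereo_d1 s y \<noteq> 0" "stereo_d2 s y \<noteq> 0"
    unfolding d1' d2' using v N1 by simp_all
  show "stereo_d1 s y \<bullet> stereo_d2 s y = 0"
    unfolding d1' d2' using v by simp
qed

lemma tangent_frame_stereo:
  "riemannian_metric g \<Longrightarrow> s \<in> {1, -1} \<Longrightarrow> tangent_frame g (stereo s y) (stereo_d1 s y) (stereo_d2 s y)"
  using stereo_frame by unfold_locales

lemma stereo_cases:
  assumes "x \<noteq> 0"
  obtains s :: real where "s \<in> {1, -1}" "norm x \<noteq> s * (x::real^3)$3"
proof -
  have "norm x \<noteq> 1 * x$3 \<or> norm x \<noteq> - 1 * x$3" using assms by auto
  then show ?thesis using that by blast
qed

lemma exists_tangent_frame: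
  assumes "riemannian_metric g" "x \<in> S2"
  obtains b1 b2 where "tangent_frame g x b1 b2"
proof -
  have x: "x \<noteq> 0" "norm x = 1" using assms(2) by auto
  obtain s :: real where "s \<in> {1, -1}" "norm x \<noteq> s * x$3" using stereo_cases[OF x(1)] .
  then show ?thesis
    using stereo_stereo_coord[of s x] tangent_frame_stereo[OF assms(1), of s "stereo_coord s x"] x that by simp
qed

section \<open>The ambient energy and its Hamilton field\<close>

definition ambient_energy :: "metric \<Rightarrow> phase \<Rightarrow> real" where
  "ambient_energy g z = (norm (fst z))\<^sup>2 / 2 * cometric g ((1 / norm (fst z)) *\<^sub>R fst z) (snd z) (snd z)"

lemma metric_coeff_eq:
  "metric_coeff g s 1 1 y = g (stereo s y) (stereo_d1 s y) (stereo_d1 s y)"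
  "metric_coeff g s 1 2 y = g (stereo s y) (stereo_d1 s y) (stereo_d2 s y)"
  "metric_coeff g s 2 2 y = g (stereo s y) (stereo_d2 s y) (stereo_d2 s y)"
  by (simp_all add: metric_coeff_def stereo_frechet)

text \<open>Expresses the energy through the metric coefficients, which is where the analyticity
  hypothesis lives. The second part keeps the denominator away from zero.\<close>

lemma ambient_energy_chart:
  assumes g: "riemannian_metric g" and s: "s \<in> {1, -1}" and x: "fst z \<noteq> 0" "norm (fst z) \<noteq> s * fst z$3"
  defines "y \<equiv> stereo_coord s (fst z)"
  shows "ambient_energy g z = (norm (fst z))\<^sup>2 / 2 *
     ((metric_coeff g s 2 2 y * (snd z \<bullet> stereo_d1 s y) * (snd z \<bullet> stereo_d1 s y)
      - metric_coeff g s 1 2 y * ((snd z \<bullet> stereo_d1 s y) * (snd z \<bullet> stereo_d2 s y) + (snd z \<bullet> stereo_d2 s y) * (snd z \<bullet> stereo_d1 s y))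
      + metric_coeff g s 1 1 y * (snd z \<bullet> stereo_d2 s y) * (snd z \<bullet> stereo_d2 s y))
     / (metric_coeff g s 1 1 y * metric_coeff g s 2 2 y - metric_coeff g s 1 2 y * metric_coeff g s 1 2 y))"
    and "metric_coeff g s 1 1 y * metric_coeff g s 2 2 y - metric_coeff g s 1 2 y * metric_coeff g s 1 2 y > 0"
proof -
  have chart: "(1 / norm (fst z)) *\<^sub>R fst z = stereo s y"
    using stereo_stereo_coord[OF s x] by (simp add: y_def)
  interpret tangent_frame g "stereo s y" "stereo_d1 s y" "stereo_d2 s y"
    by (rule tangent_frame_stereo[OF g s])
  show "ambient_energy g z = (norm (fst z))\<^sup>2 / 2 *
     ((metric_coeff g s 2 2 y * (snd z \<bullet> stereo_d1 s y) * (snd z \<bullet> stereo_d1 s y)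
      - metric_coeff g s 1 2 y * ((snd z \<bullet> stereo_d1 s y) * (snd z \<bullet> stereo_d2 s y) + (snd z \<bullet> stereo_d2 s y) * (snd z \<bullet> stereo_d1 s y))
      + metric_coeff g s 1 1 y * (snd z \<bullet> stereo_d2 s y) * (snd z \<bullet> stereo_d2 s y))
     / (metric_coeff g s 1 1 y * metric_coeff g s 2 2 y - metric_coeff g s 1 2 y * metric_coeff g s 1 2 y))"
    unfolding ambient_energy_def metric_coeff_eq chart
    by (simp only: cometric_eq G11_def G12_def G22_def gdet_def)
  show "metric_coeff g s 1 1 y * metric_coeff g s 2 2 y - metric_coeff g s 1 2 y * metric_coeff g s 1 2 y > 0"
    using gdet_pos unfolding metric_coeff_eq gdet_def G11_def G12_def G22_def .
qed

lemma ranalytic_at_ambient_energy: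
  assumes g: "real_analytic_metric g" and x: "fst z \<noteq> 0"
  shows "ranalytic_at (ambient_energy g) z"
proof -
  have riem: "riemannian_metric g" using g by (simp add: real_analytic_metric_def)
  obtain s :: real where s: "s \<in> {1, -1}" "norm (fst z) \<noteq> s * fst z$3" using stereo_cases[OF x] .
  have fst_nth: "ranalytic_at (\<lambda>z::phase. fst z $ i) z" for i
    using ranalytic_at_inner[of "(axis i 1, 0)" z] by (simp add: inner_prod_def inner_axis)
  have snd_nth: "ranalytic_at (\<lambda>z::phase. snd z $ i) z" for i
    using ranalytic_at_inner[of "(0, axis i 1)" z] by (simp add: inner_prod_def inner_axis)
  note ra = ranalytic_at_add ranalytic_at_mult ranalytic_at_diff ranalytic_at_minus ranalytic_at_const
    ranalytic_at_power fst_nth snd_nth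
  have norm: "ranalytic_at (\<lambda>z::phase. norm (fst z)) z"
  proof -
    have "norm (fst z) = sqrt ((fst z$1)\<^sup>2 + (fst z$2)\<^sup>2 + (fst z$3)\<^sup>2)" for z :: phase
      by (simp flip: norm_sq_3)
    moreover have "ranalytic_at (\<lambda>z::phase. sqrt ((fst z$1)\<^sup>2 + (fst z$2)\<^sup>2 + (fst z$3)\<^sup>2)) z"
    proof (rule ranalytic_at_sqrt)
      show "0 < (fst z$1)\<^sup>2 + (fst z$2)\<^sup>2 + (fst z$3)\<^sup>2" using x by (simp flip: norm_sq_3)
    qed (intro ra)
    ultimately show ?thesis by simp
  qed
  define Y where "Y z = stereo_coord s (fst z)" for z :: phase
  have Y1: "ranalytic_at (\<lambda>z. Y z $ 1) z" and Y2: "ranalytic_at (\<lambda>z. Y z $ 2) z"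
    using s(2) unfolding Y_def stereo_coord_def vector_2
    by (auto intro!: ranalytic_at_divide ra norm)
  have Yb: "ranalytic_at (\<lambda>z. Y z \<bullet> b) z" if bB: "b \<in> Basis" for b
  proof -
    obtain i where b: "b = axis i 1" using bB by (auto simp: Basis_vec_def)
    have "ranalytic_at (\<lambda>z. Y z $ i) z" using Y1 Y2 exhaust_2[of i] by auto
    then show ?thesis by (simp add: b inner_axis)
  qed
  have G: "ranalytic_at (\<lambda>z. metric_coeff g s i j (Y z)) z" for i j
  proof (rule ranalytic_at_compose[OF Yb])
    have "real_analytic_on UNIV (metric_coeff g s i j)" using g s(1) by (auto simp: real_analytic_metric_def)
    then show "ranalytic_at (metric_coeff g s i j) (Y z)" by (rule real_analytic_on_imp_ranalytic_at) simp
  qed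
  have N: "(norm y)\<^sup>2 + 1 = (y$1)\<^sup>2 + (y$2)\<^sup>2 + 1" for y :: "real^2" by (simp add: norm_sq_2)
  have Npos: "((y$1)\<^sup>2 + (y$2)\<^sup>2 + 1)\<^sup>2 \<noteq> 0" for y :: "real^2"
  proof -
    have "0 < (y$1)\<^sup>2 + (y$2)\<^sup>2 + 1" by (intro add_nonneg_pos add_nonneg_nonneg) auto
    then show ?thesis by simp
  qed
  have D1: "ranalytic_at (\<lambda>z. snd z \<bullet> stereo_d1 s (Y z)) z"
    unfolding inner_3 stereo_d1_def N vector_scaleR_component vector_3 real_scaleR_def
    by (intro ra Y1 Y2 ranalytic_at_divide Npos)
  have D2: "ranalytic_at (\<lambda>z. snd z \<bullet> stereo_d2 s (Y z)) z"
    unfolding inner_3 stereo_d2_def N vector_scaleR_component vector_3 real_scaleR_def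
    by (intro ra Y1 Y2 ranalytic_at_divide Npos)
  define E where "E z = (norm (fst z))\<^sup>2 / 2 *
     ((metric_coeff g s 2 2 (Y z) * (snd z \<bullet> stereo_d1 s (Y z)) * (snd z \<bullet> stereo_d1 s (Y z))
      - metric_coeff g s 1 2 (Y z) * ((snd z \<bullet> stereo_d1 s (Y z)) * (snd z \<bullet> stereo_d2 s (Y z)) + (snd z \<bullet> stereo_d2 s (Y z)) * (snd z \<bullet> stereo_d1 s (Y z)))
      + metric_coeff g s 1 1 (Y z) * (snd z \<bullet> stereo_d2 s (Y z)) * (snd z \<bullet> stereo_d2 s (Y z)))
     / (metric_coeff g s 1 1 (Y z) * metric_coeff g s 2 2 (Y z) - metric_coeff g s 1 2 (Y z) * metric_coeff g s 1 2 (Y z)))" for z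
  have "metric_coeff g s 1 1 (Y z) * metric_coeff g s 2 2 (Y z) - metric_coeff g s 1 2 (Y z) * metric_coeff g s 1 2 (Y z) \<noteq> 0"
    using ambient_energy_chart(2)[OF riem s(1) x s(2)] by (simp add: Y_def)
  then have E: "ranalytic_at E z"
    unfolding E_def by (intro ra ranalytic_at_divide norm G D1 D2) simp_all
  \<comment> \<open>The chart formula must hold near \<open>z\<close>, not only at \<open>z\<close>,
    for analyticity to transfer.\<close>
  have "open {z::phase. fst z \<noteq> 0 \<and> norm (fst z) \<noteq> s * fst z$3}"
    by (intro open_Collect_conj open_Collect_neq continuous_intros)
  then obtain e where e: "0 < e" "ball z e \<subseteq> {z. fst z \<noteq> 0 \<and> norm (fst z) \<noteq> s * fst z$3}"
    using x s(2) open_contains_ball by (metis (mono_tags, lifting) mem_Collect_eq)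
  show ?thesis
  proof (rule ranalytic_at_cong[OF E e(1)])
    fix z' assume "z' \<in> ball z e"
    then have "fst z' \<noteq> 0" "norm (fst z') \<noteq> s * fst z'$3" using e(2) by auto
    then show "ambient_energy g z' = E z'"
      unfolding E_def Y_def by (rule ambient_energy_chart(1)[OF riem s(1)])
  qed
qed

definition denergy :: "metric \<Rightarrow> phase \<Rightarrow> phase \<Rightarrow> real" where
  "denergy g z = frechet_derivative (ambient_energy g) (at z)"

definition energy_field :: "metric \<Rightarrow> phase \<Rightarrow> phase" where
  "energy_field g z = (\<Sum>b\<in>Basis. denergy g z (0, b) *\<^sub>R b, - (\<Sum>b\<in>Basis. denergy g z (b, 0) *\<^sub>R b))"

context
  fixes g :: metric
  assumes g: "real_analytic_metric g"
begin

lemma riem: "riemannian_metric g"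
  using g by (simp add: real_analytic_metric_def)

lemma energy_has_derivative:
  assumes "fst z \<noteq> 0"
  shows "(ambient_energy g has_derivative denergy g z) (at z)"
proof -
  obtain e f' where "0 < e" and f': "\<And>w. w \<in> ball z e \<Longrightarrow> (ambient_energy g has_derivative f' w) (at w)"
    and "\<And>b. b \<in> Basis \<Longrightarrow> ranalytic_at (\<lambda>w. f' w b) z"
    using ranalytic_at_has_derivative[OF ranalytic_at_ambient_energy[OF g assms]] by blast
  have "ambient_energy g differentiable (at z)"
    using f'[of z] \<open>0 < e\<close> unfolding differentiable_def centre_in_ball by blast
  then show ?thesis unfolding denergy_def using frechet_derivative_works by blast
qed

lemma ranalytic_at_denergy:
  assumes "fst z \<noteq> 0" and b: "b \<in> Basis"
  shows "ranalytic_at (\<lambda>w. denergy g w b) z"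
proof -
  obtain e f' where e: "0 < e" and f': "\<And>w. w \<in> ball z e \<Longrightarrow> (ambient_energy g has_derivative f' w) (at w)"
    and ra: "\<And>b. b \<in> Basis \<Longrightarrow> ranalytic_at (\<lambda>w. f' w b) z"
    using ranalytic_at_has_derivative[OF ranalytic_at_ambient_energy[OF g assms(1)]] by blast
  show ?thesis
    by (rule ranalytic_at_cong[OF ra[OF b] e]) (use frechet_derivative_at[OF f'] in \<open>simp add: denergy_def\<close>)
qed

lemma ranalytic_at_energy_field:
  assumes "fst z \<noteq> 0" and b: "b \<in> Basis"
  shows "ranalytic_at (\<lambda>w. energy_field g w \<bullet> b) z"
proof -
  consider b' where "b = (b', 0)" "b' \<in> Basis" | b' where "b = (0, b')" "b' \<in> Basis"
    using b by (auto simp: Basis_prod_def)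
  then show ?thesis
  proof cases
    case 1
    then have "energy_field g w \<bullet> b = denergy g w (0, b')" for w
      by (simp add: energy_field_def inner_prod_def)
    moreover have "(0, b') \<in> Basis" using 1 by (simp add: Basis_prod_def)
    ultimately show ?thesis using ranalytic_at_denergy[OF assms(1)] by simp
  next
    case 2
    then have "energy_field g w \<bullet> b = - denergy g w (b', 0)" for w
      by (simp add: energy_field_def inner_prod_def)
    moreover have "(b', 0) \<in> Basis" using 2 by (simp add: Basis_prod_def)
    ultimately show ?thesis using ranalytic_at_minus[OF ranalytic_at_denergy[OF assms(1)]] by simp
  qed
qed

lemma denergy_symplectic:
  assumes "fst z \<noteq> 0"
  shows "denergy g z Y = symplectic_form (energy_field g z) Y"
proof -
  have lin: "linear (denergy g z)" using energy_has_derivative[OF assms] by (rule has_derivative_linear)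
  obtain u v where Y: "Y = (u, v)" by fastforce
  have 1: "denergy g z (u, 0) = (\<Sum>b\<in>Basis. (u \<bullet> b) * denergy g z (b, 0))"
  proof -
    have l: "linear (\<lambda>u. denergy g z (u, 0))"
      using linear_compose[of "\<lambda>u. (u, 0)" "denergy g z"] lin by (auto simp: o_def linear_iff)
    have "denergy g z (u, 0) = denergy g z (\<Sum>b\<in>Basis. (u \<bullet> b) *\<^sub>R b, 0)" by (simp add: euclidean_representation)
    also have "\<dots> = (\<Sum>b\<in>Basis. (u \<bullet> b) * denergy g z (b, 0))"
      using linear_sum[OF l, of "\<lambda>b. (u \<bullet> b) *\<^sub>R b" Basis] linear_scale[OF l] by simp
    finally show ?thesis .
  qed
  have 2: "denergy g z (0, v) = (\<Sum>b\<in>Basis. (v \<bullet> b) * denergy g z (0, b))"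
  proof -
    have l: "linear (\<lambda>v. denergy g z (0, v))"
      using linear_compose[of "\<lambda>v. (0, v)" "denergy g z"] lin by (auto simp: o_def linear_iff)
    have "denergy g z (0, v) = denergy g z (0, \<Sum>b\<in>Basis. (v \<bullet> b) *\<^sub>R b)" by (simp add: euclidean_representation)
    also have "\<dots> = (\<Sum>b\<in>Basis. (v \<bullet> b) * denergy g z (0, b))"
      using linear_sum[OF l, of "\<lambda>b. (v \<bullet> b) *\<^sub>R b" Basis] linear_scale[OF l] by simp
    finally show ?thesis .
  qed
  have "denergy g z Y = denergy g z (u, 0) + denergy g z (0, v)"
    using linear_add[OF lin, of "(u, 0)" "(0, v)"] by (simp add: Y)
  then show ?thesis
    unfolding 1 2 by (simp add: symplectic_form_def energy_field_def Y inner_sum_left inner_sum_right mult.commute inner_commute)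
qed

section \<open>Invariances of the energy and tangency of its Hamilton field\<close>

lemma cometric_smul:
  assumes "x \<in> S2" shows "cometric g x (r *\<^sub>R \<xi>) (r *\<^sub>R \<xi>) = r * r * cometric g x \<xi> \<xi>"
proof -
  obtain b1 b2 where "tangent_frame g x b1 b2" using exists_tangent_frame[OF riem assms] .
  then interpret tangent_frame g x b1 b2 .
  show ?thesis unfolding cometric_eq by (simp add: algebra_simps flip: add_divide_distrib diff_divide_distrib)
qed

text \<open>Adding a multiple of \<open>x\<close> leaves the functional that \<xi> defines on the
  tangent plane unchanged, and \<open>sharp\<close> sees only this functional.\<close>

lemma energy_shift: "ambient_energy g (x, \<xi> + r *\<^sub>R x) = ambient_energy g (x, \<xi>)"
proof -
  have "sharp g ((1 / norm x) *\<^sub>R x) (\<xi> + r *\<^sub>R x) = sharp g ((1 / norm x) *\<^sub>R x) \<xi>"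
  proof -
    have "(\<xi> + r *\<^sub>R x) \<bullet> w = \<xi> \<bullet> w" if "w \<in> tangent_plane ((1 / norm x) *\<^sub>R x)" for w
      using that by (cases "x = 0") (auto simp: tangent_plane_def inner_add_left inner_commute[of x w])
    then show ?thesis unfolding sharp_def by (intro arg_cong[where f = The] ext) auto
  qed
  then show ?thesis by (simp add: ambient_energy_def cometric_def)
qed

lemma energy_scaling:
  assumes x: "x \<noteq> 0" and r: "0 < r"
  shows "ambient_energy g (r *\<^sub>R x, (1/r) *\<^sub>R \<xi>) = ambient_energy g (x, \<xi>)"
proof -
  have S: "(1 / norm x) *\<^sub>R x \<in> S2" using x by simp
  have "(1 / norm (r *\<^sub>R x)) *\<^sub>R (r *\<^sub>R x) = (1 / norm x) *\<^sub>R x" using x r by simp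
  then show ?thesis
    unfolding ambient_energy_def fst_conv snd_conv
    using x r by (simp only: cometric_smul[OF S]) (simp add: power2_eq_square)
qed

lemma denergy_vertical:
  assumes x: "x \<noteq> 0" shows "denergy g (x, \<xi>) (0, x) = 0"
proof -
  have 1: "((\<lambda>r::real. (x, \<xi> + r *\<^sub>R x)) has_derivative (\<lambda>r. (0, r *\<^sub>R x))) (at 0)"
    by (auto intro!: derivative_eq_intros)
  have "((\<lambda>r. ambient_energy g (x, \<xi> + r *\<^sub>R x)) has_derivative (\<lambda>r. denergy g (x, \<xi>) (0, r *\<^sub>R x))) (at 0)"
    using has_derivative_compose[OF 1, of "ambient_energy g" "denergy g (x, \<xi>)"] energy_has_derivative[of "(x, \<xi>)"] x by simp
  moreover have "((\<lambda>r. ambient_energy g (x, \<xi> + r *\<^sub>R x)) has_derivative (\<lambda>r. 0)) (at (0::real))"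
    unfolding energy_shift by simp
  ultimately have "(\<lambda>r::real. denergy g (x, \<xi>) (0, r *\<^sub>R x)) = (\<lambda>r. 0)" by (rule has_derivative_unique)
  from fun_cong[OF this, of 1] show ?thesis by simp
qed

lemma denergy_radial:
  assumes x: "x \<noteq> 0" shows "denergy g (x, \<xi>) (x, - \<xi>) = 0"
proof -
  have 1: "((\<lambda>r::real. ((1 + r) *\<^sub>R x, (1 / (1 + r)) *\<^sub>R \<xi>)) has_derivative (\<lambda>r. (r *\<^sub>R x, - r *\<^sub>R \<xi>))) (at 0)"
    by (auto intro!: derivative_eq_intros)
  have 2: "((\<lambda>r. ambient_energy g ((1 + r) *\<^sub>R x, (1 / (1 + r)) *\<^sub>R \<xi>)) has_derivative (\<lambda>r. denergy g (x, \<xi>) (r *\<^sub>R x, - r *\<^sub>R \<xi>))) (at 0)"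
    using has_derivative_compose[OF 1, of "ambient_energy g" "denergy g (x, \<xi>)"] energy_has_derivative[of "(x, \<xi>)"] x by simp
  have "((\<lambda>r::real. ambient_energy g (x, \<xi>)) has_derivative (\<lambda>r. denergy g (x, \<xi>) (r *\<^sub>R x, - r *\<^sub>R \<xi>))) (at 0)"
  proof (rule has_derivative_transform_within_open[OF 2, of "{-1<..<1}"])
    show "ambient_energy g ((1 + r) *\<^sub>R x, (1 / (1 + r)) *\<^sub>R \<xi>) = ambient_energy g (x, \<xi>)" if "r \<in> {-1<..<1}" for r
      using that by (intro energy_scaling x) auto
  qed auto
  then have "(\<lambda>r::real. denergy g (x, \<xi>) (r *\<^sub>R x, - r *\<^sub>R \<xi>)) = (\<lambda>r. 0)"
    by (rule has_derivative_unique) simp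
  from fun_cong[OF this, of 1] show ?thesis by simp
qed

text \<open>Noether's principle. The functions \<open>x \<bullet> x / 2\<close> and
  \<open>\<xi> \<bullet> x\<close> generate, up to sign, the shift and the scaling under which the
  energy is invariant; so both are constant along the energy field, and their level sets cut out the
  cotangent bundle. In formulas, pair the field with \<open>(0, x)\<close> and
  \<open>(x, - \<xi>)\<close>.\<close>

lemma energy_field_tangency:
  assumes x: "fst z \<noteq> 0"
  shows "fst (energy_field g z) \<bullet> fst z = 0"
    and "snd (energy_field g z) \<bullet> fst z + snd z \<bullet> fst (energy_field g z) = 0"
proof -
  obtain a \<xi> where z: "z = (a, \<xi>)" by fastforce
  have a: "a \<noteq> 0" using x z by simp
  show "fst (energy_field g z) \<bullet> fst z = 0"
    using denergy_vertical[OF a, of \<xi>] denergy_symplectic[OF x, of "(0, a)"]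
    by (simp add: z symplectic_form_def split: prod.splits)
  show "snd (energy_field g z) \<bullet> fst z + snd z \<bullet> fst (energy_field g z) = 0"
    using denergy_radial[OF a, of \<xi>] denergy_symplectic[OF x, of "(a, - \<xi>)"]
    by (simp add: z symplectic_form_def inner_commute split: prod.splits)
qed

end

section \<open>The geodesic flow on the cosphere bundle\<close>

lemma lipschitz_of_components:
  fixes V :: "'a::metric_space \<Rightarrow> 'b::euclidean_space"
  assumes "\<And>b. b \<in> Basis \<Longrightarrow> \<exists>e>0. \<exists>L. L-lipschitz_on (ball x e) (\<lambda>y. V y \<bullet> b)"
  shows "\<exists>e>0. \<exists>L. L-lipschitz_on (ball x e) V"
proof -
  obtain e L where e: "\<And>b. b \<in> Basis \<Longrightarrow> 0 < e b"
    and L: "\<And>b. b \<in> Basis \<Longrightarrow> (L b)-lipschitz_on (ball x (e b)) (\<lambda>y. V y \<bullet> b)"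
    using assms by metis
  define r where "r = Min (e ` (Basis :: 'b set))"
  have r: "0 < r" unfolding r_def using e by (subst Min_gr_iff) auto
  have "(\<Sum>b\<in>Basis. L b)-lipschitz_on (ball x r) V"
  proof (rule lipschitz_onI)
    fix y z assume yz: "y \<in> ball x r" "z \<in> ball x r"
    have "dist (V y) (V z) \<le> (\<Sum>b\<in>Basis. \<bar>(V y - V z) \<bullet> b\<bar>)"
      unfolding dist_norm by (rule norm_le_l1)
    also have "\<dots> \<le> (\<Sum>b\<in>Basis. L b * dist y z)"
    proof (rule sum_mono)
      fix b :: 'b assume b: "b \<in> Basis"
      have "r \<le> e b" using b by (simp add: r_def)
      then have "dist (V y \<bullet> b) (V z \<bullet> b) \<le> L b * dist y z"
        using yz by (intro lipschitz_onD[OF L[OF b]]) auto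
      then show "\<bar>(V y - V z) \<bullet> b\<bar> \<le> L b * dist y z" by (simp add: dist_real_def inner_diff_left)
    qed
    finally show "dist (V y) (V z) \<le> (\<Sum>b\<in>Basis. L b) * dist y z" by (simp add: sum_distrib_right)
  qed (auto intro!: sum_nonneg lipschitz_on_nonneg[OF L])
  then show ?thesis using r by blast
qed

section \<open>Hamilton vectors and Hamilton curves on the cotangent bundle\<close>

lemma symplectic_form_eq: "symplectic_form X Y = fst X \<bullet> snd Y - snd X \<bullet> fst Y"
  by (simp add: symplectic_form_def case_prod_beta)

text \<open>A derivative within the cotangent bundle is determined on tangent vectors, because each
  of them is the velocity of a curve in the bundle. On tangent vectors the symplectic form is
  nondegenerate, so it determines the Hamilton vector.\<close>

lemma hamilton_vector_unique:
  assumes z: "z \<in> cotangent_nonzero" and X: "hamilton_vector g z X" and X': "hamilton_vector g z X'"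
  shows "X = X'"
proof -
  obtain D where D: "(hamiltonian g has_derivative D) (at z within cotangent_nonzero)"
    "\<And>Y. Y \<in> phase_tangent z \<Longrightarrow> symplectic_form X Y = D Y" and XT: "X \<in> phase_tangent z"
    using X unfolding hamilton_vector_def by blast
  obtain D' where D': "(hamiltonian g has_derivative D') (at z within cotangent_nonzero)"
    "\<And>Y. Y \<in> phase_tangent z \<Longrightarrow> symplectic_form X' Y = D' Y" and XT': "X' \<in> phase_tangent z"
    using X' unfolding hamilton_vector_def by blast
  obtain x \<xi> where zx: "z = (x, \<xi>)" by fastforce
  have x: "norm x = 1" "x \<bullet> x = 1" "\<xi> \<bullet> x = 0" "\<xi> \<noteq> 0" "x \<noteq> 0"
    using z by (auto simp: zx cotangent_nonzero_def tangent_plane_def norm_eq_1)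
  have DD': "D Y = D' Y" if Y: "Y \<in> phase_tangent z" for Y
  proof -
    obtain a \<alpha> where Ya: "Y = (a, \<alpha>)" by fastforce
    have a: "a \<bullet> x = 0" "\<alpha> \<bullet> x + \<xi> \<bullet> a = 0" using Y by (auto simp: Ya zx phase_tangent_def)
    \<comment> \<open>A curve in the bundle with velocity \<open>Y\<close>: normalise the moving
      base point, then remove from the covector its component along the new base point. Tangency of
      \<open>Y\<close> makes both corrections vanish to first order.\<close>
    define n where "n s = (1 / norm (x + s *\<^sub>R a)) *\<^sub>R (x + s *\<^sub>R a)" for s
    define \<gamma> where "\<gamma> s = (n s, (\<xi> + s *\<^sub>R \<alpha>) - ((\<xi> + s *\<^sub>R \<alpha>) \<bullet> n s) *\<^sub>R n s)" for s
    have n0: "n 0 = x" by (simp add: n_def x)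
    have \<gamma>0: "\<gamma> 0 = z" by (simp add: \<gamma>_def n0 x zx)
    have norm': "((\<lambda>s. norm (x + s *\<^sub>R a)) has_derivative (\<lambda>s. 0)) (at 0)"
    proof -
      have "((\<lambda>s. x + s *\<^sub>R a) has_derivative (\<lambda>s. s *\<^sub>R a)) (at 0)"
        by (auto intro!: derivative_eq_intros)
      moreover have "(norm has_derivative (\<lambda>h. h \<bullet> sgn (x + 0 *\<^sub>R a))) (at (x + 0 *\<^sub>R a))"
        using has_derivative_norm[OF x(5)] by simp
      ultimately have "((\<lambda>s. norm (x + s *\<^sub>R a)) has_derivative (\<lambda>s. (s *\<^sub>R a) \<bullet> sgn (x + 0 *\<^sub>R a))) (at 0)"
        by (rule has_derivative_compose)
      then show ?thesis using a by (simp add: sgn_div_norm x)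
    qed
    have n': "(n has_derivative (\<lambda>s. s *\<^sub>R a)) (at 0)"
      unfolding n_def[abs_def] by (rule derivative_eq_intros norm' refl | simp add: x)+
    have \<gamma>': "(\<gamma> has_derivative (\<lambda>s. s *\<^sub>R Y)) (at 0)"
    proof -
      have "(\<gamma> has_derivative (\<lambda>s. (s *\<^sub>R a, s *\<^sub>R \<alpha> - ((\<xi> + 0 *\<^sub>R \<alpha>) \<bullet> n 0) *\<^sub>R (s *\<^sub>R a)
          - ((\<xi> + 0 *\<^sub>R \<alpha>) \<bullet> (s *\<^sub>R a) + (s *\<^sub>R \<alpha>) \<bullet> n 0) *\<^sub>R n 0))) (at 0)"
        unfolding \<gamma>_def[abs_def] by (rule derivative_eq_intros n' refl | simp add: algebra_simps)+
      moreover have "\<xi> \<bullet> (s *\<^sub>R a) + (s *\<^sub>R \<alpha>) \<bullet> x = 0" for s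
        using a(2) by (simp add: distrib_left[symmetric] add.commute)
      ultimately show ?thesis by (simp add: n0 x Ya)
    qed
    have "isCont \<gamma> 0" using \<gamma>' has_derivative_continuous by blast
    then have "isCont (\<lambda>s. snd (\<gamma> s)) 0" by (intro continuous_intros)
    then obtain e1 where e1: "0 < e1" "\<And>s. dist s 0 < e1 \<Longrightarrow> snd (\<gamma> s) \<noteq> 0"
      using continuous_at_avoid[of 0 "\<lambda>s. snd (\<gamma> s)" 0] x(4) \<gamma>0 by (auto simp: zx)
    have "isCont (\<lambda>s. x + s *\<^sub>R a) 0" by (intro continuous_intros)
    then obtain e2 where e2: "0 < e2" "\<And>s. dist s 0 < e2 \<Longrightarrow> x + s *\<^sub>R a \<noteq> 0"
      using continuous_at_avoid[of 0 "\<lambda>s. x + s *\<^sub>R a" 0] x(5) by auto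
    define S where "S = ball (0::real) (min e1 e2)"
    have S: "open S" "0 \<in> S" using e1 e2 by (auto simp: S_def)
    have "\<gamma> s \<in> cotangent_nonzero" if "s \<in> S" for s
    proof -
      have s: "dist s 0 < e1" "dist s 0 < e2" using that by (auto simp: S_def dist_commute)
      have "norm (n s) = 1" using e2(2)[OF s(2)] by (simp add: n_def)
      then show ?thesis
        using e1(2)[OF s(1)]
        by (auto simp: \<gamma>_def cotangent_nonzero_def tangent_plane_def inner_diff_left norm_eq_1)
    qed
    then have sub: "\<gamma> ` S \<subseteq> cotangent_nonzero" by blast
    have \<gamma>S: "(\<gamma> has_derivative (\<lambda>s. s *\<^sub>R Y)) (at 0 within S)" using \<gamma>' by (rule has_derivative_at_withinI)
    have chain: "((\<lambda>s. hamiltonian g (\<gamma> s)) has_derivative (\<lambda>s. E (s *\<^sub>R Y))) (at 0)"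
      if "(hamiltonian g has_derivative E) (at z within cotangent_nonzero)" for E
    proof -
      have "(hamiltonian g has_derivative E) (at (\<gamma> 0) within \<gamma> ` S)"
        using has_derivative_subset[OF that sub] by (simp add: \<gamma>0)
      then have "((\<lambda>s. hamiltonian g (\<gamma> s)) has_derivative (\<lambda>s. E (s *\<^sub>R Y))) (at 0 within S)"
        by (rule has_derivative_in_compose[OF \<gamma>S])
      then show ?thesis unfolding at_within_open[OF S(2,1)] .
    qed
    have "(\<lambda>s::real. D (s *\<^sub>R Y)) = (\<lambda>s. D' (s *\<^sub>R Y))"
      using chain[OF D(1)] chain[OF D'(1)] by (rule has_derivative_unique)
    from fun_cong[OF this, of 1] show ?thesis by simp
  qed
  define a \<alpha> where "a = fst X - fst X'" and "\<alpha> = snd X - snd X'"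
  have T: "a \<bullet> x = 0" "\<alpha> \<bullet> x + \<xi> \<bullet> a = 0"
    using XT XT' by (auto simp: a_def \<alpha>_def zx phase_tangent_def inner_diff_left inner_diff_right split: prod.splits)
  have form: "a \<bullet> \<beta> - \<alpha> \<bullet> b = 0" if "b \<bullet> x = 0" "\<beta> \<bullet> x + \<xi> \<bullet> b = 0" for b \<beta>
  proof -
    have Y: "(b, \<beta>) \<in> phase_tangent z" using that by (simp add: zx phase_tangent_def)
    have "symplectic_form X (b, \<beta>) = symplectic_form X' (b, \<beta>)"
      using D(2)[OF Y] D'(2)[OF Y] DD'[OF Y] by simp
    then show ?thesis
      by (simp add: a_def \<alpha>_def symplectic_form_def inner_diff_left split: prod.splits)
  qed
  \<comment> \<open>Nondegeneracy: test first with \<open>(0, a)\<close>, then with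
    \<open>(\<alpha>, - (\<xi> \<bullet> \<alpha>) *\<^sub>R x)\<close>, whose second entry restores
    tangency.\<close>
  have "a \<bullet> a - \<alpha> \<bullet> 0 = 0" using T by (intro form) auto
  then have a0: "a = 0" by simp
  then have "\<alpha> \<bullet> x = 0" using T by simp
  then have "a \<bullet> (- (\<xi> \<bullet> \<alpha>) *\<^sub>R x) - \<alpha> \<bullet> \<alpha> = 0" using x by (intro form) auto
  then have "\<alpha> = 0" using a0 by simp
  then show ?thesis using a0 by (simp add: a_def \<alpha>_def prod_eq_iff)
qed

text \<open>The derivative of the Hamiltonian along the curve is \<open>symplectic_form X X\<close>,
  which vanishes by antisymmetry. The chain rule applies within \<open>range c\<close>, since the
  curve stays in the bundle.\<close>

lemma hamilton_curve_hamiltonian_const: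
  assumes "hamilton_curve g c"
  shows "hamiltonian g (c t) = hamiltonian g (c 0)"
proof -
  have "((\<lambda>t. hamiltonian g (c t)) has_real_derivative 0) (at t)" for t
  proof -
    obtain X where X: "hamilton_vector g (c t) X" and c': "(c has_vector_derivative X) (at t)"
      using assms unfolding hamilton_curve_def by blast
    obtain D where D: "(hamiltonian g has_derivative D) (at (c t) within cotangent_nonzero)"
      "symplectic_form X X = D X"
      using X unfolding hamilton_vector_def by blast
    have "range c \<subseteq> cotangent_nonzero" using assms by (auto simp: hamilton_curve_def)
    then have "(hamiltonian g has_derivative D) (at (c t) within range c)"
      using D(1) has_derivative_subset by blast
    then have "((\<lambda>t. hamiltonian g (c t)) has_derivative (\<lambda>s. D (s *\<^sub>R X))) (at t)"
      using has_derivative_in_compose[of c "\<lambda>s. s *\<^sub>R X" t UNIV] c' by (simp add: has_vector_derivative_def)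
    moreover have "D (s *\<^sub>R X) = 0" for s
    proof -
      have "D X = 0" using D(2) by (simp add: symplectic_form_def inner_commute split: prod.splits)
      then show ?thesis using linear_scale[OF has_derivative_linear[OF D(1)]] by simp
    qed
    ultimately show ?thesis by (simp add: has_field_derivative_def lambda_zero[symmetric])
  qed
  then show ?thesis by (intro DERIV_isconst_all) blast
qed

lemma hamilton_curve_cosphere:
  assumes "hamilton_curve g c" "c 0 \<in> cosphere_bundle g" shows "c t \<in> cosphere_bundle g"
  using assms hamilton_curve_hamiltonian_const[OF assms(1), of t]
  by (simp add: cosphere_bundle_def hamilton_curve_def)

lemma hamilton_curve_shift:
  assumes "hamilton_curve g c" shows "hamilton_curve g (\<lambda>t. c (t + s))"
  unfolding hamilton_curve_def
proof (intro allI conjI)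
  fix t
  obtain X where X: "hamilton_vector g (c (t + s)) X" "(c has_vector_derivative X) (at (t + s))"
    using assms unfolding hamilton_curve_def by blast
  have "((\<lambda>t. c (t + s)) has_vector_derivative X) (at t)"
  proof -
    have "((\<lambda>t. t + s) has_vector_derivative 1) (at t)"
      unfolding has_real_derivative_iff_has_vector_derivative[symmetric]
      by (auto intro!: derivative_eq_intros)
    then show ?thesis using vector_diff_chain_at[of "\<lambda>t. t + s" 1 t c X] X(2) by (simp add: o_def)
  qed
  then show "\<exists>X. hamilton_vector g (c (t + s)) X \<and> ((\<lambda>t. c (t + s)) has_vector_derivative X) (at t)"
    using X(1) by blast
  show "c (t + s) \<in> cotangent_nonzero" using assms by (simp add: hamilton_curve_def)
qed

section \<open>The cosphere bundle, the flow on it, and time reversal\<close>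

context
  fixes g :: metric
  assumes g: "real_analytic_metric g"
begin

lemma energy_eq_cometric: "x \<in> S2 \<Longrightarrow> 2 * ambient_energy g (x, \<xi>) = cometric g x \<xi> \<xi>"
  by (simp add: ambient_energy_def)

lemma cosphere_bundle_iff:
  "z \<in> cosphere_bundle g \<longleftrightarrow> norm (fst z) = 1 \<and> snd z \<bullet> fst z = 0 \<and> 2 * ambient_energy g z = 1"
proof -
  obtain x \<xi> where z: "z = (x, \<xi>)" by fastforce
  \<comment> \<open>The zero covector is excluded on the right-hand side by its zero energy.\<close>
  have "ambient_energy g (x, 0) = 0" if "norm x = 1"
    using cometric_smul[OF g, of x 0 0] energy_eq_cometric[of x 0] that by simp
  then show ?thesis
    using energy_eq_cometric[of x \<xi>]
    by (auto simp: z cosphere_bundle_def cotangent_nonzero_def tangent_plane_def hamiltonian_def)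
qed

lemma isCont_energy: "fst z \<noteq> 0 \<Longrightarrow> isCont (ambient_energy g) z"
  using energy_has_derivative[OF g] has_derivative_continuous by blast

text \<open>Closed as a level set. For boundedness, the energy has a positive minimum on the
  covectors of Euclidean length one and is quadratic along rays.\<close>

lemma compact_cosphere_bundle: "compact (cosphere_bundle g)"
proof -
  define C where "C = {z::phase. norm (fst z) = 1 \<and> snd z \<bullet> fst z = 0}"
  have C: "closed C" unfolding C_def by (intro closed_Collect_conj closed_Collect_eq continuous_intros)
  have contC: "continuous_on C (ambient_energy g)"
    by (intro continuous_at_imp_continuous_on ballI isCont_energy) (auto simp: C_def)
  have K: "cosphere_bundle g = {z \<in> C. ambient_energy g z = 1/2}"
    by (auto simp: C_def cosphere_bundle_iff)
  have "closed (cosphere_bundle g)"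
    unfolding K using continuous_closed_preimage_constant[OF contC C] .
  moreover have "bounded (cosphere_bundle g)"
  proof -
    define Q where "Q = C \<inter> {z. norm (snd z) = 1}"
    have "closed Q" unfolding Q_def by (intro closed_Int C closed_Collect_eq continuous_intros)
    moreover have "norm z \<le> 2" if "z \<in> Q" for z
      using that norm_Pair_le[of "fst z" "snd z"] by (simp add: Q_def C_def)
    then have "bounded Q" by (rule boundedI)
    ultimately have Q: "compact Q" by (simp add: compact_eq_bounded_closed)
    have pos: "0 < ambient_energy g z" if "z \<in> Q" for z
    proof -
      obtain x \<xi> where z: "z = (x, \<xi>)" by fastforce
      have hx: "x \<in> S2" "\<xi> \<in> tangent_plane x" "\<xi> \<noteq> 0" using that by (auto simp: Q_def C_def z tangent_plane_def)
      obtain b1 b2 where "tangent_frame g x b1 b2" using exists_tangent_frame[OF riem[OF g] hx(1)] .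
      then have "0 < cometric g x \<xi> \<xi>" using hx(2,3) by (rule tangent_frame.cometric_pos)
      then show ?thesis using energy_eq_cometric[OF hx(1), of \<xi>] by (simp add: z)
    qed
    have "\<exists>m>0. \<forall>z\<in>Q. m \<le> ambient_energy g z"
    proof (cases "Q = {}")
      case False
      have "continuous_on Q (ambient_energy g)" using contC by (rule continuous_on_subset) (simp add: Q_def)
      then obtain z0 where "z0 \<in> Q" "\<forall>z\<in>Q. ambient_energy g z0 \<le> ambient_energy g z"
        using continuous_attains_inf[OF Q False] by blast
      then show ?thesis using pos by blast
    qed (auto intro: exI[of _ 1])
    then obtain m where m: "0 < m" "\<And>z. z \<in> Q \<Longrightarrow> m \<le> ambient_energy g z" by blast
    have "norm z \<le> 1 + sqrt (1 / (2 * m))" if zK: "z \<in> cosphere_bundle g" for z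
    proof -
      obtain x \<xi> where z: "z = (x, \<xi>)" by fastforce
      have x: "x \<in> S2" "\<xi> \<bullet> x = 0" "\<xi> \<noteq> 0" "2 * ambient_energy g (x, \<xi>) = 1"
        using zK zK[unfolded cosphere_bundle_iff] by (auto simp: z cosphere_bundle_def cotangent_nonzero_def)
      define v where "v = (1 / norm \<xi>) *\<^sub>R \<xi>"
      have "(x, v) \<in> Q" using x by (simp add: Q_def C_def v_def)
      then have "m \<le> ambient_energy g (x, v)" by (rule m(2))
      moreover have "ambient_energy g (x, \<xi>) = norm \<xi> * norm \<xi> * ambient_energy g (x, v)"
      proof -
        have "norm \<xi> *\<^sub>R v = \<xi>" using x(3) by (simp add: v_def)
        then have "2 * ambient_energy g (x, \<xi>) = norm \<xi> * norm \<xi> * (2 * ambient_energy g (x, v))"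
          using cometric_smul[OF g x(1), of "norm \<xi>" v] unfolding energy_eq_cometric[OF x(1)] by simp
        then show ?thesis by simp
      qed
      ultimately have "(norm \<xi>)\<^sup>2 * m \<le> 1/2"
        using mult_left_mono[of m "ambient_energy g (x, v)" "(norm \<xi>)\<^sup>2"] x(4) by (simp add: power2_eq_square)
      then have "(norm \<xi>)\<^sup>2 \<le> 1 / (2 * m)" using m(1) by (simp add: field_simps)
      then have "norm \<xi> \<le> sqrt (1 / (2 * m))" by (rule real_le_rsqrt)
      then show ?thesis using norm_Pair_le[of x \<xi>] x(1) by (simp add: z)
    qed
    then show ?thesis by (rule boundedI)
  qed
  ultimately show ?thesis by (simp add: compact_eq_bounded_closed)
qed

text \<open>The Hamiltonian is the square root of twice the energy. The square root has slope
  \<open>1/2\<close> at 1, so on the cosphere bundle both functions have the same differential along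
  the cotangent bundle.\<close>

lemma hamilton_vector_energy_field:
  assumes z: "z \<in> cosphere_bundle g" shows "hamilton_vector g z (energy_field g z)"
proof -
  have fz: "fst z \<noteq> 0" using z by (auto simp: cosphere_bundle_iff)
  have E1: "2 * ambient_energy g z = 1" using z by (simp add: cosphere_bundle_iff)
  have zC: "z \<in> cotangent_nonzero" using z by (simp add: cosphere_bundle_def)
  have 1: "((\<lambda>w. 2 * ambient_energy g w) has_derivative (\<lambda>Y. 2 * denergy g z Y)) (at z)"
    by (intro has_derivative_mult_right energy_has_derivative[OF g fz])
  have 2: "(sqrt has_derivative (*) (1/2)) (at (2 * ambient_energy g z))"
    using DERIV_real_sqrt[of 1] unfolding E1 by (simp add: has_field_derivative_def)
  have "((\<lambda>w. sqrt (2 * ambient_energy g w)) has_derivative denergy g z) (at z)"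
    using has_derivative_compose[OF 1 2] by simp
  then have "((\<lambda>w. sqrt (2 * ambient_energy g w)) has_derivative denergy g z) (at z within cotangent_nonzero)"
    by (rule has_derivative_at_withinI)
  then have "(hamiltonian g has_derivative denergy g z) (at z within cotangent_nonzero)"
    by (rule has_derivative_transform[OF zC, rotated])
      (auto simp: hamiltonian_def cotangent_nonzero_def energy_eq_cometric)
  moreover have "energy_field g z \<in> phase_tangent z"
    using energy_field_tangency[OF g fz] by (auto simp: phase_tangent_def split: prod.splits)
  ultimately show ?thesis
    unfolding hamilton_vector_def using denergy_symplectic[OF g fz] by auto
qed

lemma hamilton_curve_energy_field:
  assumes "hamilton_curve g c" "c 0 \<in> cosphere_bundle g"
  shows "(c has_vector_derivative energy_field g (c t)) (at t)"
proof -
  obtain X where X: "hamilton_vector g (c t) X" "(c has_vector_derivative X) (at t)" "c t \<in> cotangent_nonzero"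
    using assms(1) unfolding hamilton_curve_def by blast
  then have "X = energy_field g (c t)"
    using hamilton_vector_unique hamilton_vector_energy_field hamilton_curve_cosphere[OF assms] by blast
  then show ?thesis using X(2) by simp
qed

text \<open>Stated for zero or rescaled velocities, so that it covers solutions of the cut-off
  field. The three conserved quantities cut out the cosphere bundle; conservation of the first comes
  first, because it keeps the base point away from 0, where the energy is differentiated.\<close>

lemma conserved_by_energy_field:
  assumes c: "\<And>t. (c has_vector_derivative X t) (at t)" and x0: "fst (c 0) \<noteq> 0"
    and X: "\<And>t. X t = 0 \<or> fst (c t) \<noteq> 0 \<and> X t = \<kappa> t *\<^sub>R energy_field g (c t)"
  shows "fst (c t) \<bullet> fst (c t) = fst (c 0) \<bullet> fst (c 0)" "snd (c t) \<bullet> fst (c t) = snd (c 0) \<bullet> fst (c 0)"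
    "ambient_energy g (c t) = ambient_energy g (c 0)"
proof -
  have fc: "((\<lambda>t. fst (c t)) has_derivative (\<lambda>s. s *\<^sub>R fst (X t))) (at t)" for t
    using has_derivative_fst[OF c[of t, unfolded has_vector_derivative_def]] by simp
  have sc: "((\<lambda>t. snd (c t)) has_derivative (\<lambda>s. s *\<^sub>R snd (X t))) (at t)" for t
    using has_derivative_snd[OF c[of t, unfolded has_vector_derivative_def]] by simp
  have "((\<lambda>t. fst (c t) \<bullet> fst (c t)) has_real_derivative 0) (at t)" for t
  proof -
    have "fst (X t) \<bullet> fst (c t) = 0"
      using X[of t] energy_field_tangency(1)[OF g, of "c t"] by auto
    then have "(\<lambda>s. fst (c t) \<bullet> (s *\<^sub>R fst (X t)) + (s *\<^sub>R fst (X t)) \<bullet> fst (c t)) = (*) 0"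
      by (auto simp: inner_commute)
    then show ?thesis using has_derivative_inner[OF fc fc, of t] by (simp add: has_field_derivative_def)
  qed
  then show 1: "fst (c t) \<bullet> fst (c t) = fst (c 0) \<bullet> fst (c 0)" for t
    by (intro DERIV_isconst_all[of "\<lambda>t. fst (c t) \<bullet> fst (c t)"]) blast
  have "((\<lambda>t. snd (c t) \<bullet> fst (c t)) has_real_derivative 0) (at t)" for t
  proof -
    have "snd (X t) \<bullet> fst (c t) + snd (c t) \<bullet> fst (X t) = 0"
      using X[of t] energy_field_tangency(2)[OF g, of "c t"] by (auto simp flip: distrib_left)
    then have "(\<lambda>s. snd (c t) \<bullet> (s *\<^sub>R fst (X t)) + (s *\<^sub>R snd (X t)) \<bullet> fst (c t)) = (*) 0"
      by (auto simp: fun_eq_iff add.commute simp flip: distrib_left)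
    then show ?thesis using has_derivative_inner[OF sc fc, of t] by (simp add: has_field_derivative_def)
  qed
  then show "snd (c t) \<bullet> fst (c t) = snd (c 0) \<bullet> fst (c 0)"
    by (intro DERIV_isconst_all[of "\<lambda>t. snd (c t) \<bullet> fst (c t)"]) blast
  have "((\<lambda>t. ambient_energy g (c t)) has_real_derivative 0) (at t)" for t
  proof -
    have ne: "fst (c t) \<noteq> 0" using 1[of t] x0 by auto
    have "((\<lambda>t. ambient_energy g (c t)) has_derivative (\<lambda>s. denergy g (c t) (s *\<^sub>R X t))) (at t)"
      using has_derivative_compose[OF c[of t, unfolded has_vector_derivative_def] energy_has_derivative[OF g ne]] .
    moreover have "denergy g (c t) (s *\<^sub>R X t) = 0" for s
      using X[of t] by (elim disjE) (auto simp: denergy_symplectic[OF g ne] symplectic_form_eq inner_commute)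
    ultimately show ?thesis by (simp add: has_field_derivative_def lambda_zero[symmetric])
  qed
  then show "ambient_energy g (c t) = ambient_energy g (c 0)"
    by (intro DERIV_isconst_all[of "\<lambda>t. ambient_energy g (c t)"]) blast
qed

text \<open>Collects what the theorems on differential equations ask for: a bounded, globally
  Lipschitz substitute for the energy field that equals it on the cosphere bundle, is analytic
  there, and has complete orbits inside it.\<close>

definition cosphere_field :: "real \<Rightarrow> real \<Rightarrow> (phase \<Rightarrow> phase) \<Rightarrow> bool" where
  "cosphere_field L M W \<longleftrightarrow> L-lipschitz_on UNIV W \<and> (\<forall>z. norm (W z) \<le> M) \<and>
    (\<forall>z\<in>cosphere_bundle g. W z = energy_field g z \<and> (\<forall>b\<in>Basis. ranalytic_at (\<lambda>w. W w \<bullet> b) z) \<and>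
      (\<exists>c. c 0 = z \<and> (\<forall>t. (c has_vector_derivative W (c t)) (at t)) \<and> (\<forall>t. c t \<in> cosphere_bundle g)))"

lemma exists_cosphere_field:
  assumes ne: "cosphere_bundle g \<noteq> {}" shows "\<exists>L M W. cosphere_field L M W"
proof -
  define U where "U = {z::phase. fst z \<noteq> 0}"
  have U: "open U" unfolding U_def by (intro open_Collect_neq continuous_intros)
  have KU: "cosphere_bundle g \<subseteq> U" by (auto simp: U_def cosphere_bundle_iff)
  have lip: "\<exists>e>0. \<exists>L. L-lipschitz_on (ball z e) (energy_field g)" if "z \<in> U" for z
  proof (rule lipschitz_of_components)
    fix b :: phase assume b: "b \<in> Basis"
    have "fst z \<noteq> 0" using that by (simp add: U_def)
    then obtain e L where "0 < e" "L-lipschitz_on (ball z e) (\<lambda>w. energy_field g w \<bullet> b)"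
      using ranalytic_at_lipschitz[OF ranalytic_at_energy_field[OF g _ b]] by metis
    then show "\<exists>e>0. \<exists>L. L-lipschitz_on (ball z e) (\<lambda>w. energy_field g w \<bullet> b)" by blast
  qed
  obtain W L M d \<kappa> where L: "L-lipschitz_on UNIV W" and M: "\<And>z. norm (W z) \<le> M" and d: "0 < d"
    and near: "\<And>z. infdist z (cosphere_bundle g) < d \<Longrightarrow> z \<in> U \<and> W z = energy_field g z"
    and cut: "\<And>z. W z = 0 \<or> z \<in> U \<and> W z = \<kappa> z *\<^sub>R energy_field g z"
    by (rule lipschitz_cutoff[OF compact_cosphere_bundle ne U KU lip], assumption, rule that)
  have "cosphere_field L M W"
    unfolding cosphere_field_def
  proof (intro conjI ballI allI L M)
    fix z assume z: "z \<in> cosphere_bundle g"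
    show "W z = energy_field g z" using near[of z] z d by simp
    obtain c where c: "c 0 = z" "\<And>t. (c has_vector_derivative W (c t)) (at t)"
      using ode_exists[OF L, of z] by blast
    have z0: "fst (c 0) \<noteq> 0" using z c(1) by (auto simp: cosphere_bundle_iff)
    have "c t \<in> cosphere_bundle g" for t
    proof -
      note cons = conserved_by_energy_field[OF c(2) z0, of "\<lambda>t. \<kappa> (c t)" t]
      have X: "W (c t) = 0 \<or> fst (c t) \<noteq> 0 \<and> W (c t) = \<kappa> (c t) *\<^sub>R energy_field g (c t)" for t
        using cut[of "c t"] by (auto simp: U_def)
      show ?thesis using cons[OF X] z c(1) by (simp add: cosphere_bundle_iff norm_eq_1)
    qed
    then show "\<exists>c. c 0 = z \<and> (\<forall>t. (c has_vector_derivative W (c t)) (at t)) \<and> (\<forall>t. c t \<in> cosphere_bundle g)"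
      using c by blast
    fix b :: phase assume b: "b \<in> Basis"
    have fz: "fst z \<noteq> 0" using z by (auto simp: cosphere_bundle_iff)
    show "ranalytic_at (\<lambda>w. W w \<bullet> b) z"
    proof (rule ranalytic_at_cong[OF ranalytic_at_energy_field[OF g fz b] d])
      fix w assume "w \<in> ball z d"
      then have "infdist w (cosphere_bundle g) < d"
        using infdist_le[OF z, of w] by (simp add: dist_commute)
      then show "W w \<bullet> b = energy_field g w \<bullet> b" using near by simp
    qed
  qed
  then show ?thesis by blast
qed

text \<open>Justifies the definite description in \<open>geodesic_flow\<close>: Hamilton curves with
  the same start in the bundle solve one Lipschitz equation and so agree.\<close>

lemma geodesic_flow_eq:
  assumes c: "hamilton_curve g c" and z: "c 0 \<in> cosphere_bundle g"
  shows "geodesic_flow g t (c 0) = c t"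
proof -
  obtain L M W where "cosphere_field L M W" using exists_cosphere_field z by blast
  then have W: "L-lipschitz_on UNIV W" "\<And>z. norm (W z) \<le> M"
    "\<And>z. z \<in> cosphere_bundle g \<Longrightarrow> W z = energy_field g z"
    "\<And>z b. z \<in> cosphere_bundle g \<Longrightarrow> b \<in> Basis \<Longrightarrow> ranalytic_at (\<lambda>w. W w \<bullet> b) z"
    "\<And>z. z \<in> cosphere_bundle g \<Longrightarrow> \<exists>c. c 0 = z \<and> (\<forall>t. (c has_vector_derivative W (c t)) (at t)) \<and> (\<forall>t. c t \<in> cosphere_bundle g)"
    unfolding cosphere_field_def by blast+
  have sol: "(c has_vector_derivative W (c t)) (at t)" if "hamilton_curve g c" "c 0 \<in> cosphere_bundle g" for c t
    using hamilton_curve_energy_field[OF that] W(3)[OF hamilton_curve_cosphere[OF that]] by simp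
  have "(THE c'. hamilton_curve g c' \<and> c' 0 = c 0) = c"
  proof (rule the_equality)
    fix c' assume c': "hamilton_curve g c' \<and> c' 0 = c 0"
    show "c' = c"
      by (rule ext, rule ode_unique[OF W(1) sol sol]) (use c c' z in auto)
  qed (use c in simp)
  then show ?thesis by (simp add: geodesic_flow_def)
qed

lemma hamilton_curve_geodesic_flow:
  assumes z: "z \<in> cosphere_bundle g"
  shows "hamilton_curve g (\<lambda>t. geodesic_flow g t z)" "geodesic_flow g 0 z = z"
    "geodesic_flow g t z \<in> cosphere_bundle g"
proof -
  obtain L M W where "cosphere_field L M W" using exists_cosphere_field z by blast
  then have W: "L-lipschitz_on UNIV W" "\<And>z. norm (W z) \<le> M"
    "\<And>z. z \<in> cosphere_bundle g \<Longrightarrow> W z = energy_field g z"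
    "\<And>z b. z \<in> cosphere_bundle g \<Longrightarrow> b \<in> Basis \<Longrightarrow> ranalytic_at (\<lambda>w. W w \<bullet> b) z"
    "\<And>z. z \<in> cosphere_bundle g \<Longrightarrow> \<exists>c. c 0 = z \<and> (\<forall>t. (c has_vector_derivative W (c t)) (at t)) \<and> (\<forall>t. c t \<in> cosphere_bundle g)"
    unfolding cosphere_field_def by blast+
  obtain c where c: "c 0 = z" "\<And>t. (c has_vector_derivative W (c t)) (at t)" "\<And>t. c t \<in> cosphere_bundle g"
    using W(5)[OF z] by blast
  have "hamilton_curve g c"
    unfolding hamilton_curve_def
    using c(2,3) W(3) hamilton_vector_energy_field by (metis (no_types, lifting) cosphere_bundle_def mem_Collect_eq)
  then have eq: "geodesic_flow g t z = c t" for t using geodesic_flow_eq[of c] c(1) z by auto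
  show "hamilton_curve g (\<lambda>t. geodesic_flow g t z)" "geodesic_flow g 0 z = z"
    "geodesic_flow g t z \<in> cosphere_bundle g"
    using \<open>hamilton_curve g c\<close> c unfolding eq by auto
qed

theorem param_analytic_geodesic_flow:
  assumes z: "\<And>x. \<zeta> x \<in> cosphere_bundle g" and an: "param_analytic \<zeta> x0" and T: "0 \<le> T"
  shows "param_analytic (\<lambda>x. geodesic_flow g T (\<zeta> x)) x0"
proof -
  obtain L M W where "cosphere_field L M W" using exists_cosphere_field z by blast
  then have W: "L-lipschitz_on UNIV W" "\<And>z. norm (W z) \<le> M"
    "\<And>z. z \<in> cosphere_bundle g \<Longrightarrow> W z = energy_field g z"
    "\<And>z b. z \<in> cosphere_bundle g \<Longrightarrow> b \<in> Basis \<Longrightarrow> ranalytic_at (\<lambda>w. W w \<bullet> b) z"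
    "\<And>z. z \<in> cosphere_bundle g \<Longrightarrow> \<exists>c. c 0 = z \<and> (\<forall>t. (c has_vector_derivative W (c t)) (at t)) \<and> (\<forall>t. c t \<in> cosphere_bundle g)"
    unfolding cosphere_field_def by blast+
  show ?thesis
  proof (rule param_analytic_flow[OF W(1,2,4), where c = "\<lambda>x t. geodesic_flow g t (\<zeta> x)"])
    show "((\<lambda>t. geodesic_flow g t (\<zeta> x)) has_vector_derivative W (geodesic_flow g t (\<zeta> x))) (at t)" for x t
      using hamilton_curve_energy_field[OF hamilton_curve_geodesic_flow(1)[OF z]]
        hamilton_curve_geodesic_flow(2,3)[OF z] W(3) z by simp
    show "geodesic_flow g t (\<zeta> x) \<in> cosphere_bundle g" for x t
      by (rule hamilton_curve_geodesic_flow(3)[OF z])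
    show "param_analytic (\<lambda>x. geodesic_flow g 0 (\<zeta> x)) x0"
      using an hamilton_curve_geodesic_flow(2)[OF z] by simp
  qed (use T in auto)
qed

text \<open>The map \<open>(x, \<xi>) \<mapsto> (x, - \<xi>)\<close> preserves the Hamiltonian and
  reverses the sign of the symplectic form, so it carries the Hamilton field to its
  negative.\<close>

lemma hamilton_vector_reverse:
  assumes z: "(x, \<xi>) \<in> cotangent_nonzero" and X: "hamilton_vector g (x, \<xi>) (a, \<alpha>)"
  shows "hamilton_vector g (x, - \<xi>) (- a, \<alpha>)"
proof -
  obtain D where D: "(hamiltonian g has_derivative D) (at (x, \<xi>) within cotangent_nonzero)"
    "\<And>Y. Y \<in> phase_tangent (x, \<xi>) \<Longrightarrow> symplectic_form (a, \<alpha>) Y = D Y" and T: "(a, \<alpha>) \<in> phase_tangent (x, \<xi>)"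
    using X unfolding hamilton_vector_def by blast
  define R where "R = (\<lambda>z::phase. (fst z, - snd z))"
  have R': "(R has_derivative R) (at w within A)" for w A
    unfolding R_def
    by (intro has_derivative_Pair has_derivative_fst has_derivative_minus has_derivative_snd has_derivative_ident)
  have RC: "R ` cotangent_nonzero \<subseteq> cotangent_nonzero"
    by (auto simp: R_def cotangent_nonzero_def tangent_plane_def)
  have "(hamiltonian g has_derivative D) (at (R (x, - \<xi>)) within R ` cotangent_nonzero)"
    using has_derivative_subset[OF D(1) RC] by (simp add: R_def)
  then have 1: "((\<lambda>z. hamiltonian g (R z)) has_derivative (\<lambda>Y. D (R Y))) (at (x, - \<xi>) within cotangent_nonzero)"
    by (rule has_derivative_in_compose[OF R'])
  have "(hamiltonian g has_derivative (\<lambda>Y. D (R Y))) (at (x, - \<xi>) within cotangent_nonzero)"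
  proof (rule has_derivative_transform[OF _ _ 1])
    show "(x, - \<xi>) \<in> cotangent_nonzero" using z by (auto simp: cotangent_nonzero_def tangent_plane_def)
    show "hamiltonian g w = hamiltonian g (R w)" if "w \<in> cotangent_nonzero" for w
      using that cometric_smul[OF g, of "fst w" "-1" "snd w"]
      by (auto simp: hamiltonian_def R_def cotangent_nonzero_def)
  qed
  moreover have "symplectic_form (- a, \<alpha>) Y = D (R Y)" if "Y \<in> phase_tangent (x, - \<xi>)" for Y
  proof -
    have "R Y \<in> phase_tangent (x, \<xi>)" using that by (auto simp: phase_tangent_def R_def)
    then show ?thesis using D(2)[of "R Y"] by (simp add: R_def symplectic_form_eq)
  qed
  moreover have "(- a, \<alpha>) \<in> phase_tangent (x, - \<xi>)" using T by (simp add: phase_tangent_def)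
  ultimately show ?thesis unfolding hamilton_vector_def by blast
qed

lemma hamilton_curve_reverse:
  assumes c: "hamilton_curve g c"
  shows "hamilton_curve g (\<lambda>t. (fst (c (s - t)), - snd (c (s - t))))"
  unfolding hamilton_curve_def
proof (intro allI conjI)
  fix t
  obtain X where X: "hamilton_vector g (c (s - t)) X" "(c has_vector_derivative X) (at (s - t))"
    and C: "c (s - t) \<in> cotangent_nonzero"
    using c unfolding hamilton_curve_def by blast
  have 1: "((\<lambda>t. c (s - t)) has_vector_derivative - X) (at t)"
  proof -
    have "((\<lambda>t. s - t) has_vector_derivative - 1) (at t)"
      unfolding has_real_derivative_iff_has_vector_derivative[symmetric]
      by (auto intro!: derivative_eq_intros)
    then show ?thesis using vector_diff_chain_at[of "\<lambda>t. s - t" "-1" t c X] X(2) by (simp add: o_def)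
  qed
  have "((\<lambda>t. (fst (c (s - t)), - snd (c (s - t)))) has_vector_derivative (- fst X, snd X)) (at t)"
    using has_derivative_Pair[OF has_derivative_fst[OF 1[unfolded has_vector_derivative_def]]
        has_derivative_minus[OF has_derivative_snd[OF 1[unfolded has_vector_derivative_def]]]]
    by (simp add: has_vector_derivative_def)
  moreover have "hamilton_vector g (fst (c (s - t)), - snd (c (s - t))) (- fst X, snd X)"
    by (rule hamilton_vector_reverse) (use X(1) C in simp_all)
  ultimately show "\<exists>X. hamilton_vector g (fst (c (s - t)), - snd (c (s - t))) X \<and>
     ((\<lambda>t. (fst (c (s - t)), - snd (c (s - t)))) has_vector_derivative X) (at t)" by blast
  show "(fst (c (s - t)), - snd (c (s - t))) \<in> cotangent_nonzero"
    using C by (auto simp: cotangent_nonzero_def tangent_plane_def split: prod.splits)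
qed

text \<open>Euler's identity: the energy is homogeneous of degree 2 in the covector, so its radial
  derivative is twice its value. This shows that a geodesic leaves its starting point with nonzero
  velocity.\<close>

lemma energy_field_velocity:
  assumes z: "z \<in> cosphere_bundle g" shows "fst (energy_field g z) \<bullet> snd z = 1"
proof -
  obtain x \<xi> where zx: "z = (x, \<xi>)" by fastforce
  have x: "x \<in> S2" "x \<noteq> 0" "2 * ambient_energy g (x, \<xi>) = 1" using z by (auto simp: zx cosphere_bundle_iff)
  have 1: "((\<lambda>r::real. (x, (1 + r) *\<^sub>R \<xi>)) has_derivative (\<lambda>r. (0, r *\<^sub>R \<xi>))) (at 0)"
    by (auto intro!: derivative_eq_intros)
  have "((\<lambda>r. ambient_energy g (x, (1 + r) *\<^sub>R \<xi>)) has_derivative (\<lambda>r. denergy g (x, \<xi>) (0, r *\<^sub>R \<xi>))) (at 0)"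
    using has_derivative_compose[OF 1, of "ambient_energy g" "denergy g (x, \<xi>)"] energy_has_derivative[OF g, of "(x, \<xi>)"] x by simp
  moreover have "ambient_energy g (x, (1 + r) *\<^sub>R \<xi>) = (1 + r) * (1 + r) / 2" for r
    using cometric_smul[OF g x(1), of "1 + r" \<xi>] energy_eq_cometric[OF x(1), of \<xi>]
      energy_eq_cometric[OF x(1), of "(1 + r) *\<^sub>R \<xi>"] x(3) by simp
  ultimately have "((\<lambda>r::real. (1 + r) * (1 + r) / 2) has_derivative (\<lambda>r. denergy g (x, \<xi>) (0, r *\<^sub>R \<xi>))) (at 0)"
    by simp
  moreover have "((\<lambda>r::real. (1 + r) * (1 + r) / 2) has_derivative (\<lambda>r. r)) (at 0)"
    by (auto intro!: derivative_eq_intros)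
  ultimately have "(\<lambda>r. denergy g (x, \<xi>) (0, r *\<^sub>R \<xi>)) = (\<lambda>r. r)" by (rule has_derivative_unique)
  from fun_cong[OF this, of 1] have "denergy g (x, \<xi>) (0, \<xi>) = 1" by simp
  then show ?thesis
    using denergy_symplectic[OF g, of "(x, \<xi>)" "(0, \<xi>)"] x(2)
    by (simp add: zx symplectic_form_def split: prod.splits)
qed

end

section \<open>Reversible circle maps with an invariant density\<close>

lemma continuous_2pi_int_const:
  fixes f :: "real \<Rightarrow> real"
  assumes "continuous_on UNIV f" "\<And>x. \<exists>k::int. f x = c + 2 * pi * k"
  shows "\<exists>k::int. \<forall>x. f x = c + 2 * pi * k"
proof -
  have "f constant_on UNIV"
  proof (rule continuous_discrete_range_constant[OF connected_UNIV assms(1)])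
    fix x
    obtain k where k: "f x = c + 2 * pi * of_int k" using assms(2) by blast
    have "2 * pi \<le> norm (f y - f x)" if "f y \<noteq> f x" for y
    proof -
      obtain j where j: "f y = c + 2 * pi * of_int j" using assms(2) by blast
      have "j \<noteq> k" using that k j by auto
      then have "1 \<le> \<bar>j - k\<bar>" by linarith
      then have "1 \<le> \<bar>real_of_int j - real_of_int k\<bar>" by linarith
      moreover have "f y - f x = 2 * pi * (of_int j - of_int k)" using j k by (simp add: algebra_simps)
      ultimately show ?thesis using pi_gt_zero by (simp add: abs_mult)
    qed
    then show "\<exists>e>0. \<forall>y. y \<in> UNIV \<and> f y \<noteq> f x \<longrightarrow> e \<le> norm (f y - f x)"
      using pi_gt_zero by (intro exI[of _ "2 * pi"]) auto
  qed
  then obtain d where d: "\<And>x. f x = d" unfolding constant_on_def by auto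
  obtain k where "f 0 = c + 2 * pi * of_int k" using assms(2) by blast
  then show ?thesis using d by auto
qed

lemma floor_2pi:
  fixes x0 y :: real
  defines "k \<equiv> \<lfloor>(y - x0) / (2 * pi)\<rfloor>"
  shows "x0 \<le> y - 2 * pi * of_int k" "y - 2 * pi * of_int k < x0 + 2 * pi"
proof -
  define r where "r = (y - x0) / (2 * pi)"
  have r: "y = x0 + 2 * pi * r" by (simp add: r_def)
  have "2 * pi * of_int k \<le> 2 * pi * r" unfolding k_def r_def[symmetric] by (intro mult_left_mono) auto
  then show "x0 \<le> y - 2 * pi * of_int k" using r by linarith
  have "r < of_int k + 1" unfolding k_def r_def[symmetric] by (simp add: floor_correct)
  then have "2 * pi * r < 2 * pi * (of_int k + 1)" by (intro mult_strict_left_mono) auto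
  then show "y - 2 * pi * of_int k < x0 + 2 * pi" using r by (simp add: distrib_left)
qed

lemma unit_circle_lift:
  fixes h :: "real \<Rightarrow> complex"
  assumes h: "continuous_on UNIV h" "\<And>x. norm (h x) = 1"
  obtains F where "continuous_on UNIV F" "\<And>x. h x = cis (F x)"
proof -
  have nz: "h x \<noteq> 0" for x using h(2)[of x] by auto
  have contr: "contractible (UNIV :: real set)" by (simp add: convex_imp_contractible)
  have "\<exists>G. continuous_on UNIV G \<and> (\<forall>x. h x = exp (G x))"
    by (rule continuous_logarithm_on_contractible[OF h(1) contr]) (auto simp: nz)
  then obtain G where G: "continuous_on UNIV G" "\<And>x. h x = exp (G x)" by blast
  have "Re (G x) = 0" for x using h(2)[of x] by (simp add: G(2))
  then have "h x = cis (Im (G x))" for x by (simp add: G(2) exp_eq_polar)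
  moreover have "continuous_on UNIV (\<lambda>x. Im (G x))" using G(1) by (intro continuous_intros)
  ultimately show ?thesis using that by blast
qed

text \<open>\<open>F\<close> lifts a circle map \<open>\<eta>\<close> with \<open>\<eta> (- \<eta> \<xi>) = - \<xi>\<close>. If \<open>F\<close> has degree \<open>1\<close>, this relation
  shows that the displacements \<open>G\<close> of \<open>F \<circ> F\<close> at \<open>u\<close> and at \<open>F (F u) + pi\<close> add up to a multiple of
  \<open>4 * pi\<close>, which is impossible when all displacements lie strictly between two consecutive
  multiples of \<open>2 * pi\<close>.\<close>

theorem reversible_lift:
  fixes F :: "real \<Rightarrow> real"
  assumes F: "continuous_on UNIV F" and per: "\<And>x. \<exists>k::int. F (x + 2 * pi) = F x + 2 * pi * k"
    and rev: "\<And>x. \<exists>k::int. F (F x + pi) = x + pi + 2 * pi * k"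
  obtains x0 m where "strict_mono (\<lambda>x. F (F x))" "F (F x0) = x0 + 2 * pi * of_int m"
    "\<And>x. F (F (x + 2 * pi)) = F (F x) + 2 * pi"
proof -
  have cont: "continuous_on S (\<lambda>x. F (f x))" if "continuous_on S f" for S and f :: "real \<Rightarrow> real"
    using continuous_on_compose2[OF F that] by simp
  have "\<exists>k::int. \<forall>x. F (x + 2 * pi) - F x = 0 + 2 * pi * k"
    by (rule continuous_2pi_int_const) (use per in \<open>auto intro!: continuous_intros cont simp: algebra_simps\<close>)
  then obtain d :: int where d: "\<And>x. F (x + 2 * pi) = F x + 2 * pi * d" by (force simp: algebra_simps)
  have "\<exists>k::int. \<forall>x. F (F x + pi) - x = pi + 2 * pi * k"
    by (rule continuous_2pi_int_const) (use rev in \<open>auto intro!: continuous_intros cont simp: algebra_simps\<close>)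
  then obtain k :: int where k: "\<And>x. F (F x + pi) = x + pi + 2 * pi * k" by (force simp: algebra_simps)
  have dn: "F (x + 2 * pi * real n) = F x + 2 * pi * d * real n" for x n
  proof (induction n)
    case (Suc n)
    have "F (x + 2 * pi * real (Suc n)) = F ((x + 2 * pi * real n) + 2 * pi)" by (simp add: algebra_simps)
    also have "\<dots> = F (x + 2 * pi * real n) + 2 * pi * d" by (rule d)
    finally show ?case using Suc by (simp add: algebra_simps)
  qed simp
  have dj: "F (x + 2 * pi * of_int j) = F x + 2 * pi * d * of_int j" for x j
  proof (cases "0 \<le> j")
    case True then show ?thesis using dn[of x "nat j"] by simp
  next
    case False
    then show ?thesis using dn[of "x + 2 * pi * of_int j" "nat (- j)"] by simp
  qed
  \<comment> \<open>Degrees multiply: \<open>F (F x + pi)\<close> has degree \<open>d * d\<close> in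
    \<open>x\<close>, but it is a translation and so has degree 1.\<close>
  have "d * d = 1"
  proof -
    have "F (F (0 + 2 * pi) + pi) = F ((F 0 + pi) + 2 * pi * of_int d)" 
      unfolding d[of 0] by (simp only: add_ac)
    then have "2 * pi + pi + 2 * pi * k = 0 + pi + 2 * pi * k + 2 * pi * d * d"
      unfolding k dj by (simp add: k)
    then have "(2 * pi) * 1 = (2 * pi) * real_of_int (d * d)" by simp
    then have "real_of_int (d * d) = 1" using pi_gt_zero by (simp only: mult_cancel_left) simp
    then show ?thesis by (simp only: of_int_eq_1_iff)
  qed
  then have d1: "d = 1 \<or> d = - 1" by (simp add: zmult_eq_1_iff)
  have "inj F"
  proof (rule injI)
    fix x y assume "F x = F y"
    then have "F (F x + pi) = F (F y + pi)" by (simp only:)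
    then show "x = y" unfolding k by simp
  qed
  then have "strict_mono F \<or> strict_antimono_on UNIV F"
    using injective_eq_monotone_map[OF _ F] by simp
  then have mono: "strict_mono (\<lambda>x. F (F x))"
  proof
    assume "strict_mono F" then show ?thesis by (simp add: strict_mono_def)
  next
    assume "strict_antimono_on UNIV F"
    then have "x < y \<Longrightarrow> F y < F x" for x y by (auto simp: monotone_on_def)
    then show ?thesis by (simp add: strict_mono_def)
  qed
  have FF: "F (F (x + 2 * pi)) = F (F x) + 2 * pi" for x
    using d1 unfolding d dj by auto
  have "\<exists>x0 m. F (F x0) = x0 + 2 * pi * of_int (m::int)"
  proof (cases "d = 1")
    case False
    \<comment> \<open>For degree \<open>-1\<close> the displacement \<open>F x - x\<close> drops by
      \<open>4 * pi\<close> over each period and therefore has a zero.\<close>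
    then have dm: "d = - 1" using d1 by simp
    define p where "p x = F x - x" for x
    have pc: "continuous_on S p" for S unfolding p_def using F by (intro continuous_intros continuous_on_subset[OF F]) auto
    obtain n where n: "\<bar>p 0\<bar> < 4 * pi * real n"
    proof -
      obtain n where "\<bar>p 0\<bar> < real n" using reals_Archimedean2 by blast
      moreover have "1 * real n \<le> 4 * pi * real n" using pi_gt3 by (intro mult_right_mono) auto
      ultimately show ?thesis using that[of n] by linarith
    qed
    have p1: "p (2 * pi * of_int j) = p 0 - 4 * pi * of_int j" for j
      using dj[of 0 j] by (simp add: p_def dm algebra_simps)
    have "p (2 * pi * of_int (int n)) \<le> 0" "0 \<le> p (2 * pi * of_int (- int n))"
      unfolding p1 using n by auto
    moreover have "2 * pi * of_int (- int n) \<le> 2 * pi * of_int (int n)" by simp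
    ultimately have "\<exists>x\<ge>2 * pi * of_int (- int n). x \<le> 2 * pi * of_int (int n) \<and> p x = 0"
      by (intro IVT2' pc)
    then obtain x where "F x = x" by (auto simp: p_def)
    then have "F (F x) = x + 2 * pi * of_int 0" by simp
    then show ?thesis by blast
  next
    case True
    show ?thesis
    proof (rule ccontr)
      assume "\<not> ?thesis"
      then have no: "F (F x) \<noteq> x + 2 * pi * of_int m" for x and m :: int by blast
      define G where "G x = F (F x) - x" for x
      have Gc: "continuous_on S G" for S unfolding G_def by (intro continuous_intros cont continuous_on_subset[OF F]) auto
      define m where "m = \<lfloor>G 0 / (2 * pi)\<rfloor>"
      have G0: "2 * pi * of_int m \<le> G 0" "G 0 < 2 * pi * of_int (m + 1)"
        using floor_2pi[where ?x0.0 = 0 and y = "G 0"] by (simp_all add: m_def distrib_left)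
      have noG: "G x \<noteq> 2 * pi * of_int j" for x and j :: int using no[of x j] by (simp add: G_def)
      have connG: "connected (range G)" by (intro connected_continuous_image Gc connected_UNIV)
      have lo: "2 * pi * of_int m < G x" for x
      proof (rule ccontr)
        assume "\<not> ?thesis"
        then have "2 * pi * of_int m \<in> range G"
          using connectedD_interval[OF connG, of "G x" "G 0" "2 * pi * of_int m"] G0 by auto
        then show False using noG by (metis imageE)
      qed
      have hi: "G x < 2 * pi * of_int (m + 1)" for x
      proof (rule ccontr)
        assume "\<not> ?thesis"
        then have "2 * pi * of_int (m + 1) \<in> range G"
          using connectedD_interval[OF connG, of "G 0" "G x" "2 * pi * of_int (m + 1)"] G0 by auto
        then show False using noG by (metis imageE)
      qed
      have "F (F (F x + pi)) = F (x + pi) + 2 * pi * k" for x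
        unfolding k using dj[of "x + pi" k] True by (simp add: add.assoc)
      from this[of "F 0"] have "G (F (F 0) + pi) + G 0 = 4 * pi * k"
        unfolding G_def by (simp add: k)
      then have "4 * pi * of_int m < 4 * pi * of_int k" "4 * pi * of_int k < 4 * pi * of_int (m + 1)"
        using lo[of 0] lo[of "F (F 0) + pi"] hi[of 0] hi[of "F (F 0) + pi"] by linarith+
      then have "m < k" "k < m + 1" by (simp_all only: mult_less_cancel_left_pos pi_gt_zero of_int_less_iff zero_less_mult_iff zero_less_numeral simp_thms)
      then show False by simp
    qed
  qed
  then show ?thesis using that mono FF by blast
qed

section \<open>Invariant measures concentrate on fixed points\<close>

lemma strict_mono_image_interval:
  fixes Q :: "real \<Rightarrow> real"
  assumes "strict_mono Q" "continuous_on UNIV Q" "a \<le> b"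
  shows "Q ` {a..b} = {Q a..Q b}"
proof
  show "Q ` {a..b} \<subseteq> {Q a..Q b}" using assms(1) by (auto simp: strict_mono_less_eq)
  show "{Q a..Q b} \<subseteq> Q ` {a..b}"
  proof
    fix y assume "y \<in> {Q a..Q b}"
    then obtain x where "a \<le> x" "x \<le> b" "Q x = y"
      using IVT'[of Q a y b] assms(3) continuous_on_subset[OF assms(2)] by auto
    then show "y \<in> Q ` {a..b}" by auto
  qed
qed

text \<open>\<open>E\<close> is the covering of the circle. By continuity of \<open>Q\<close>, every
  point it moves lies strictly between some rational \<open>q\<close> and \<open>Q q\<close>, so
  countably many null arcs and the finitely many fixed points cover the circle. Finiteness of the
  measure allows masses of arcs to be subtracted.\<close>

theorem invariant_measure_null:
  fixes E :: "real \<Rightarrow> 'a::metric_space" and \<nu> :: "'a measure"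
  assumes E: "continuous_on UNIV E" and E_eq: "\<And>x y. E x = E y \<longleftrightarrow> (\<exists>k::int. y = x + 2 * pi * k)"
    and \<nu>: "sets \<nu> = sets (restrict_space borel (range E))" "finite_measure \<nu>"
    and inv: "\<And>A. A \<in> sets \<nu> \<Longrightarrow> emeasure \<nu> (\<eta> ` A) = emeasure \<nu> A"
    and F: "continuous_on UNIV F" "\<And>x. \<eta> (E x) = E (F x)"
    and mono: "strict_mono (\<lambda>x. F (F x))" and x0: "F (F x0) = x0 + 2 * pi * of_int m"
    and per: "F (F (x0 + 2 * pi)) = F (F x0) + 2 * pi"
    and pts: "\<And>x. emeasure \<nu> {E x} = 0" and fin: "finite {x \<in> {x0..x0 + 2 * pi}. \<eta> (\<eta> (E x)) = E x}"
  shows "emeasure \<nu> (range E) = 0"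
proof -
  interpret finite_measure \<nu> by fact
  define Q where "Q x = F (F x) - 2 * pi * of_int m" for x
  have Qm: "strict_mono Q" using mono by (simp add: Q_def strict_mono_def)
  have Qc: "continuous_on UNIV Q"
    unfolding Q_def using continuous_on_compose2[OF F(1) F(1)] by (intro continuous_intros) auto
  have Q0: "Q x0 = x0" "Q (x0 + 2 * pi) = x0 + 2 * pi" using x0 per by (simp_all add: Q_def)
  have E_shift: "E (x + 2 * pi * of_int k) = E x" for x and k :: int using E_eq by metis
  have \<eta>Q: "\<eta> (\<eta> (E x)) = E (Q x)" for x
    unfolding F(2) Q_def using E_shift[of "F (F x)" "- m"] by simp
  have meas: "E ` S \<in> sets \<nu>" if "compact S" for S
  proof -
    have "compact (E ` S)" using that continuous_on_subset[OF E] by (intro compact_continuous_image) auto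
    then have "E ` S \<in> sets borel" by (intro borel_closed compact_imp_closed)
    then show ?thesis unfolding \<nu>(1) sets_restrict_space by (auto intro!: image_eqI[where x = "E ` S"])
  qed
  have inv2: "emeasure \<nu> (E ` {Q a..Q b}) = emeasure \<nu> (E ` {a..b})" if "a \<le> b" for a b
  proof -
    have 1: "\<eta> ` E ` {a..b} = E ` F ` {a..b}" by (auto simp: image_image F(2))
    have 2: "\<eta> ` \<eta> ` E ` {a..b} = E ` {Q a..Q b}"
      using strict_mono_image_interval[OF Qm Qc that] by (auto simp: image_image \<eta>Q simp flip: \<open>Q ` {a..b} = _\<close>)
    \<comment> \<open>Invariance is applied twice, so the intermediate image must be measurable as
      well; it is compact.\<close>
    have "compact (F ` {a..b})" using continuous_on_subset[OF F(1)] by (intro compact_continuous_image) auto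
    then have "emeasure \<nu> (\<eta> ` \<eta> ` E ` {a..b}) = emeasure \<nu> (\<eta> ` E ` {a..b})"
      unfolding 1 by (intro inv meas)
    also have "\<dots> = emeasure \<nu> (E ` {a..b})" by (intro inv meas) simp
    finally show ?thesis unfolding 2 .
  qed
  \<comment> \<open>All these arcs share the end point \<open>x0 + 2 * pi\<close>, which
    \<open>Q\<close> fixes, so the arcs from \<open>q\<close> and from \<open>Q q\<close> are nested
    and have equal mass.\<close>
  define J where "J a = E ` {a..x0 + 2 * pi}" for a
  have J: "J a \<in> sets \<nu>" for a unfolding J_def by (intro meas) simp
  have Jinv: "emeasure \<nu> (J (Q q)) = emeasure \<nu> (J q)" if "q \<in> {x0..x0 + 2 * pi}" for q
    using inv2[of q "x0 + 2 * pi"] that by (simp add: J_def Q0)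
  define N where "N q = (J q - J (Q q)) \<union> (J (Q q) - J q)" for q
  have N: "N q \<in> null_sets \<nu>" if q: "q \<in> {x0..x0 + 2 * pi}" for q
  proof -
    have diff: "emeasure \<nu> (J a - J b) = emeasure \<nu> (J a) - emeasure \<nu> (J b)" if "a \<le> b" for a b
      using that by (intro emeasure_Diff J) (auto simp: J_def)
    have sub: "J b \<subseteq> J a" if "a \<le> b" for a b using that by (auto simp: J_def)
    have "emeasure \<nu> (J q - J (Q q)) = 0"
    proof (cases "q \<le> Q q")
      case True then show ?thesis using diff[OF True] Jinv[OF q] by simp
    next
      case False then have "J q - J (Q q) = {}" using sub[of "Q q" q] by auto
      then show ?thesis by (simp only: emeasure_empty)
    qed
    moreover have "emeasure \<nu> (J (Q q) - J q) = 0"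
    proof (cases "q \<le> Q q")
      case False then show ?thesis using diff[of "Q q" q] Jinv[OF q] by simp
    next
      case True then have "J (Q q) - J q = {}" using sub[of q "Q q"] by auto
      then show ?thesis by (simp only: emeasure_empty)
    qed
    ultimately show ?thesis unfolding N_def using J by (intro null_sets.Un null_setsI) auto
  qed
  define P where "P = {x \<in> {x0..x0 + 2 * pi}. \<eta> (\<eta> (E x)) = E x}"
  \<comment> \<open>Excludes wrapping around the circle. The strict inequality \<open>x0 < x\<close>
    matters: the image of \<open>x0\<close> is also that of \<open>x0 + 2 * pi\<close> and lies in
    every arc starting at or before the end point.\<close>
  have outside: "E x \<notin> J b" if "x0 < x" "x < b" for x b
  proof
    assume "E x \<in> J b"
    then obtain y where y: "b \<le> y" "y \<le> x0 + 2 * pi" "E x = E y" by (auto simp: J_def)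
    then obtain k :: int where k: "y = x + 2 * pi * k" using E_eq by blast
    then have "0 < 2 * pi * real_of_int k" "2 * pi * real_of_int k < 2 * pi * 1" using y that by linarith+
    then have "0 < real_of_int k" "real_of_int k < 1"
      using pi_gt_zero by (simp_all add: zero_less_mult_iff)
    then have "0 < k" "k < 1" by simp_all
    then show False by simp
  qed
  have cover: "range E \<subseteq> (\<Union>q\<in>\<rat> \<inter> {x0..x0 + 2 * pi}. N q) \<union> (\<Union>x\<in>P. {E x})"
  proof
    fix w assume "w \<in> range E"
    then obtain y where y: "w = E y" by blast
    define k where "k = \<lfloor>(y - x0) / (2 * pi)\<rfloor>"
    define x where "x = y - 2 * pi * of_int k"
    have wx: "w = E x" using E_shift[of y "- k"] by (simp add: x_def y)
    have x: "x0 \<le> x" "x < x0 + 2 * pi"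
      using floor_2pi[where ?x0.0 = x0 and y = y] by (simp_all add: x_def k_def)
    have Qi: "isCont Q x" using Qc by (simp add: continuous_on_eq_continuous_at)
    consider "Q x = x" | "x < Q x" | "Q x < x" by linarith
    then show "w \<in> (\<Union>q\<in>\<rat> \<inter> {x0..x0 + 2 * pi}. N q) \<union> (\<Union>x\<in>P. {E x})"
    proof cases
      case 1
      then have "x \<in> P" using x \<eta>Q[of x] by (simp add: P_def)
      then show ?thesis using wx by blast
    next
      case 2
      then have "x \<noteq> x0" using Q0 by auto
      then have xx: "x0 < x" using x by simp
      obtain e where e: "0 < e" "\<And>y. dist y x < e \<Longrightarrow> dist (Q y) (Q x) < Q x - x"
        using Qi 2 unfolding continuous_at_eps_delta by (metis diff_gt_0_iff_gt)
      obtain q where q: "q \<in> \<rat>" "max x0 (x - e) < q" "q < x"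
        using Rats_dense_in_real[of "max x0 (x - e)" x] xx e(1) by auto
      then have "x < Q q" using e(2)[of q] by (auto simp: dist_real_def)
      then have "E x \<in> N q" using outside[OF xx, of "Q q"] q x by (auto simp: N_def J_def)
      then show ?thesis using q x wx by auto
    next
      case 3
      then have "x \<noteq> x0" using Q0 by auto
      then have xx: "x0 < x" using x by simp
      obtain e where e: "0 < e" "\<And>y. dist y x < e \<Longrightarrow> dist (Q y) (Q x) < x - Q x"
        using Qi 3 unfolding continuous_at_eps_delta by (metis diff_gt_0_iff_gt)
      obtain q where q: "q \<in> \<rat>" "x < q" "q < min (x0 + 2 * pi) (x + e)"
        using Rats_dense_in_real[of x "min (x0 + 2 * pi) (x + e)"] x(2) e(1) by auto
      then have "Q q < x" using e(2)[of q] by (auto simp: dist_real_def)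
      then have "E x \<in> N q" using outside[OF xx, of q] q x by (auto simp: N_def J_def)
      then show ?thesis using q x wx by auto
    qed
  qed
  have pt: "{E x} \<in> null_sets \<nu>" for x
    using meas[of "{x}"] pts by (intro null_setsI) auto
  have "(\<Union>q\<in>\<rat> \<inter> {x0..x0 + 2 * pi}. N q) \<in> null_sets \<nu>"
    using countable_rat by (intro null_sets_UN') (auto intro: N)
  moreover have "(\<Union>x\<in>P. {E x}) \<in> null_sets \<nu>"
    using fin by (intro null_sets_UN' pt) (auto simp: P_def intro: countable_finite)
  ultimately have "(\<Union>q\<in>\<rat> \<inter> {x0..x0 + 2 * pi}. N q) \<union> (\<Union>x\<in>P. {E x}) \<in> null_sets \<nu>"
    by (rule null_sets.Un)
  moreover have "range E \<in> sets \<nu>"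
  proof -
    have "range E \<subseteq> E ` {x0..x0 + 2 * pi}"
    proof
      fix w assume "w \<in> range E"
      then obtain y where y: "w = E y" by blast
      define k where "k = \<lfloor>(y - x0) / (2 * pi)\<rfloor>"
      have "w = E (y - 2 * pi * of_int k)" using E_shift[of y "- k"] by (simp add: y)
      moreover have "y - 2 * pi * of_int k \<in> {x0..x0 + 2 * pi}"
        using floor_2pi[where ?x0.0 = x0 and y = y] by (simp add: k_def)
      ultimately show "w \<in> E ` {x0..x0 + 2 * pi}" by blast
    qed
    then have "range E = E ` {x0..x0 + 2 * pi}" by auto
    then show ?thesis using meas[of "{x0..x0 + 2 * pi}"] by simp
  qed
  ultimately show ?thesis using cover null_sets_subset by (metis null_setsD1)
qed

section \<open>The cosphere at a point\<close>

context tangent_frame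
begin

lemma cometric_sym: "cometric g x \<xi> \<zeta> = cometric g x \<zeta> \<xi>"
  unfolding cometric_eq by (simp add: algebra_simps)

lemma cometric_linear: "linear (\<lambda>\<xi>. cometric g x \<xi> \<zeta>)"
  unfolding cometric_eq
  by (rule linearI)
    (simp_all add: inner_add_left algebra_simps flip: add_divide_distrib diff_divide_distrib)

lemma cometric_comb_left: "cometric g x (r *\<^sub>R \<xi> + s *\<^sub>R \<xi>') \<zeta> = r * cometric g x \<xi> \<zeta> + s * cometric g x \<xi>' \<zeta>"
  using linear_add[OF cometric_linear] linear_scale[OF cometric_linear] by simp

lemma cometric_comb_right: "cometric g x \<zeta> (r *\<^sub>R \<xi> + s *\<^sub>R \<xi>') = r * cometric g x \<zeta> \<xi> + s * cometric g x \<zeta> \<xi>'"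
  using cometric_comb_left cometric_sym by metis

lemma cometric_normalize:
  assumes "\<xi> \<in> tangent_plane x" "\<xi> \<noteq> 0"
  defines "v \<equiv> (1 / sqrt (cometric g x \<xi> \<xi>)) *\<^sub>R \<xi>"
  shows "v \<in> tangent_plane x" "cometric g x v v = 1" "cometric g x v \<zeta> = cometric g x \<xi> \<zeta> / sqrt (cometric g x \<xi> \<xi>)"
proof -
  have pos: "0 < cometric g x \<xi> \<xi>" using cometric_pos assms by blast
  show "v \<in> tangent_plane x" using assms(1) by (simp add: v_def tangent_plane_def)
  have v1: "cometric g x v \<zeta> = cometric g x \<xi> \<zeta> / sqrt (cometric g x \<xi> \<xi>)" for \<zeta>
    unfolding v_def using linear_scale[OF cometric_linear] by simp
  show "cometric g x v \<zeta> = cometric g x \<xi> \<zeta> / sqrt (cometric g x \<xi> \<xi>)" by (rule v1)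
  have "cometric g x v v = cometric g x \<xi> \<xi> / sqrt (cometric g x \<xi> \<xi>) / sqrt (cometric g x \<xi> \<xi>)"
    using v1[of v] v1[of \<xi>] cometric_sym[of \<xi> v] by simp
  also have "\<dots> = 1" using pos by (simp add: field_simps)
  finally show "cometric g x v v = 1" .
qed

lemma exists_orthonormal_coframe: "\<exists>ef. orthonormal_coframe g x ef"
proof -
  define e where "e = (1 / sqrt (cometric g x b1 b1)) *\<^sub>R b1"
  have e: "e \<in> tangent_plane x" "cometric g x e e = 1"
    using cometric_normalize[OF b(1,3)] by (auto simp: e_def)
  define w where "w = 1 *\<^sub>R b2 + (- cometric g x b2 e) *\<^sub>R e"
  have w: "w \<in> tangent_plane x" unfolding w_def by (intro tangent_comb b e)
  \<comment> \<open>Gram-Schmidt for the cometric; \<open>e\<close> is parallel to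
    \<open>b1\<close>, so subtracting it cannot cancel the Euclidean component along
    \<open>b2\<close>.\<close>
  have "w \<bullet> b2 = b2 \<bullet> b2" using b(5) by (simp add: w_def e_def inner_diff_left)
  then have w0: "w \<noteq> 0" using b(4) by auto
  have we: "cometric g x w e = 0"
    unfolding w_def cometric_comb_left using e(2) by simp
  define f where "f = (1 / sqrt (cometric g x w w)) *\<^sub>R w"
  have f: "f \<in> tangent_plane x" "cometric g x f f = 1" "cometric g x f e = 0"
    using cometric_normalize[OF w w0] we by (auto simp: f_def)
  then have "orthonormal_coframe g x (e, f)"
    using e cometric_sym[of e f] by (simp add: orthonormal_coframe_def)
  then show ?thesis by blast
qed

end

locale cosphere_circle =
  fixes g :: metric and p e f :: "real^3"
  assumes g: "real_analytic_metric g" and p: "p \<in> S2" and ef: "orthonormal_coframe g p (e, f)"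
begin

definition circ :: "real \<Rightarrow> real^3" where
  "circ \<theta> = cos \<theta> *\<^sub>R e + sin \<theta> *\<^sub>R f"

lemma frame: obtains b1 b2 where "tangent_frame g p b1 b2"
  using exists_tangent_frame[OF riem[OF g] p] by blast

lemma ef': "e \<in> tangent_plane p" "f \<in> tangent_plane p" "cometric g p e e = 1" "cometric g p f f = 1"
  "cometric g p e f = 0" "cometric g p f e = 0"
proof -
  obtain b1 b2 where "tangent_frame g p b1 b2" using frame .
  then interpret tangent_frame g p b1 b2 .
  show "e \<in> tangent_plane p" "f \<in> tangent_plane p" "cometric g p e e = 1" "cometric g p f f = 1"
    "cometric g p e f = 0" using ef by (auto simp: orthonormal_coframe_def)
  then show "cometric g p f e = 0" using cometric_sym by metis
qed

lemma cometric_coords: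
  "cometric g p (r *\<^sub>R e + s *\<^sub>R f) e = r" "cometric g p (r *\<^sub>R e + s *\<^sub>R f) f = s"
  "cometric g p (r *\<^sub>R e + s *\<^sub>R f) (r *\<^sub>R e + s *\<^sub>R f) = r * r + s * s"
proof -
  obtain b1 b2 where "tangent_frame g p b1 b2" using frame .
  then interpret tangent_frame g p b1 b2 .
  show "cometric g p (r *\<^sub>R e + s *\<^sub>R f) e = r" "cometric g p (r *\<^sub>R e + s *\<^sub>R f) f = s"
    "cometric g p (r *\<^sub>R e + s *\<^sub>R f) (r *\<^sub>R e + s *\<^sub>R f) = r * r + s * s"
    by (simp_all add: cometric_comb_left cometric_comb_right ef')
qed

lemma continuous_cometric: "continuous_on S (\<lambda>\<xi>. cometric g p \<xi> \<zeta>)"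
proof -
  obtain b1 b2 where "tangent_frame g p b1 b2" using frame .
  then interpret tangent_frame g p b1 b2 .
  show ?thesis using cometric_linear linear_continuous_on linear_conv_bounded_linear by blast
qed

lemma mem_fiber_iff: "\<xi> \<in> cosphere_fiber g p \<longleftrightarrow> \<xi> \<in> tangent_plane p \<and> cometric g p \<xi> \<xi> = 1"
  using p energy_eq_cometric[OF g p, of \<xi>]
  by (auto simp: cosphere_fiber_def cosphere_bundle_iff[OF g] tangent_plane_def)

lemma tangent_coords:
  assumes "\<xi> \<in> tangent_plane p"
  obtains r s where "\<xi> = r *\<^sub>R e + s *\<^sub>R f"
proof -
  have p0: "p \<noteq> 0" using p by auto
  have f0: "f \<noteq> 0"
  proof
    assume "f = 0" then show False using cometric_coords(2)[of 0 0] ef'(4) by simp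
  qed
  have "e \<notin> span {f}"
  proof
    assume "e \<in> span {f}"
    then obtain k where k: "e = k *\<^sub>R f" by (auto simp: span_singleton)
    then have "cometric g p e e = 0" using cometric_coords(1)[of 0 k] by simp
    then show False using ef'(3) by simp
  qed
  moreover have "e \<noteq> f" using ef' by auto
  ultimately have "independent {e, f}" using f0 by (simp add: independent_insert)
  moreover have "tangent_plane p = {v. p \<bullet> v = 0}" by (auto simp: tangent_plane_def inner_commute)
  then have "dim (tangent_plane p) = 2" using dim_hyperplane[OF p0] by simp
  moreover have "card {e, f} = 2" using \<open>e \<noteq> f\<close> by simp
  ultimately have "tangent_plane p \<subseteq> span {e, f}"
    using card_eq_dim[of "{e, f}" "tangent_plane p"] ef' by auto
  then have "\<xi> \<in> span {e, f}" using assms by blast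
  then obtain r where "\<xi> - r *\<^sub>R e \<in> span {f}" by (auto simp: span_insert)
  then obtain s where "\<xi> - r *\<^sub>R e = s *\<^sub>R f" by (auto simp: span_singleton)
  then have "\<xi> = r *\<^sub>R e + s *\<^sub>R f" by (simp add: algebra_simps)
  then show ?thesis by (rule that)
qed

lemma range_circ: "range circ = cosphere_fiber g p"
proof
  show "range circ \<subseteq> cosphere_fiber g p"
  proof (rule image_subsetI)
    fix \<theta>
    have "circ \<theta> \<in> tangent_plane p" using ef' by (simp add: circ_def tangent_plane_def inner_add_left)
    then show "circ \<theta> \<in> cosphere_fiber g p"
      by (simp add: mem_fiber_iff circ_def cometric_coords flip: power2_eq_square)
  qed
  show "cosphere_fiber g p \<subseteq> range circ"
  proof
    fix \<xi> assume \<xi>: "\<xi> \<in> cosphere_fiber g p"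
    then obtain r s where rs: "\<xi> = r *\<^sub>R e + s *\<^sub>R f" using tangent_coords mem_fiber_iff by metis
    have "r\<^sup>2 + s\<^sup>2 = 1" using \<xi> by (simp add: mem_fiber_iff rs cometric_coords power2_eq_square)
    then obtain t where "r = cos t" "s = sin t" using sincos_total_2pi by metis
    then show "\<xi> \<in> range circ" by (auto simp: rs circ_def)
  qed
qed

lemma circ_eq_iff: "circ x = circ y \<longleftrightarrow> (\<exists>k::int. y = x + 2 * pi * k)"
proof
  assume eq: "circ x = circ y"
  have "cos y = cos x" using cometric_coords(1)[of "cos x" "sin x"] cometric_coords(1)[of "cos y" "sin y"] eq
    by (simp add: circ_def)
  moreover have "sin y = sin x" using cometric_coords(2)[of "cos x" "sin x"] cometric_coords(2)[of "cos y" "sin y"] eq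
    by (simp add: circ_def)
  ultimately show "\<exists>k::int. y = x + 2 * pi * k" using sin_cos_eq_iff[of y x] by (auto simp: mult_ac)
next
  assume "\<exists>k::int. y = x + 2 * pi * k"
  then have "sin y = sin x \<and> cos y = cos x" unfolding sin_cos_eq_iff by (auto simp: mult_ac)
  then show "circ x = circ y" by (simp add: circ_def)
qed

lemma continuous_circ: "continuous_on S circ"
  unfolding circ_def[abs_def] by (intro continuous_intros)

lemma circ_pi: "circ (x + pi) = - circ x"
  by (simp add: circ_def)

lemma circ_bundle: "(p, circ x) \<in> cosphere_bundle g"
  using range_circ unfolding cosphere_fiber_def by auto

lemma param_analytic_circ_flow:
  assumes "0 \<le> T" shows "param_analytic (\<lambda>x. snd (geodesic_flow g T (p, circ x))) x0"
proof (rule param_analytic_snd, rule param_analytic_geodesic_flow[OF g circ_bundle _ assms])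
  show "param_analytic (\<lambda>x. (p, circ x)) x0" unfolding circ_def by (rule param_analytic_circle)
qed

subsection \<open>The first return map\<close>

lemma flow_returns_iff:
  assumes "\<xi> \<in> cosphere_fiber g p"
  shows "geodesic_flow g t (p, \<xi>) \<in> {p} \<times> cosphere_fiber g p \<longleftrightarrow> fst (geodesic_flow g t (p, \<xi>)) = p"
proof -
  have "geodesic_flow g t (p, \<xi>) \<in> cosphere_bundle g"
    using assms by (intro hamilton_curve_geodesic_flow(3)[OF g]) (simp add: cosphere_fiber_def)
  then show ?thesis by (auto simp: cosphere_fiber_def mem_Times_iff) (metis prod.collapse)
qed

lemma flow_has_vector_derivative:
  assumes "\<xi> \<in> cosphere_fiber g p"
  shows "((\<lambda>t. geodesic_flow g t (p, \<xi>)) has_vector_derivative energy_field g (geodesic_flow g t (p, \<xi>))) (at t)"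
proof -
  have "(p, \<xi>) \<in> cosphere_bundle g" using assms by (simp add: cosphere_fiber_def)
  then show ?thesis
    using hamilton_curve_energy_field[OF g hamilton_curve_geodesic_flow(1)[OF g]]
      hamilton_curve_geodesic_flow(2)[OF g] by simp
qed

text \<open>Along the geodesic with initial covector \<open>\<xi>\<close> the quantity
  \<open>x \<bullet> \<xi>\<close> has derivative 1 at time 0, so for small positive times the base
  point is not \<open>p\<close>.\<close>

lemma return_times_bounded_below:
  obtains \<epsilon> where "0 < \<epsilon>" "\<And>l. is_return_time g p l \<Longrightarrow> \<epsilon> \<le> l"
proof -
  define \<xi> where "\<xi> = circ 0"
  have \<xi>: "\<xi> \<in> cosphere_fiber g p" using range_circ by (auto simp: \<xi>_def)
  have z: "(p, \<xi>) \<in> cosphere_bundle g" unfolding \<xi>_def by (rule circ_bundle)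
  define h where "h t = fst (geodesic_flow g t (p, \<xi>)) \<bullet> \<xi>" for t
  have "((\<lambda>t. fst (geodesic_flow g t (p, \<xi>))) has_derivative (\<lambda>s. fst (s *\<^sub>R energy_field g (p, \<xi>)))) (at 0)"
    using has_derivative_fst[OF flow_has_vector_derivative[OF \<xi>, of 0, unfolded has_vector_derivative_def]]
      hamilton_curve_geodesic_flow(2)[OF g z] by simp
  then have "(h has_derivative (\<lambda>s. fst (s *\<^sub>R energy_field g (p, \<xi>)) \<bullet> \<xi>)) (at 0)"
    unfolding h_def by (rule has_derivative_inner_left)
  moreover have "(\<lambda>s. fst (s *\<^sub>R energy_field g (p, \<xi>)) \<bullet> \<xi>) = (*) 1"
    using energy_field_velocity[OF g z] by auto
  ultimately have "(h has_real_derivative 1) (at 0)" by (simp add: has_field_derivative_def)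
  then obtain d where d: "0 < d" "\<And>t. 0 < t \<Longrightarrow> t < d \<Longrightarrow> h 0 < h (0 + t)"
    using DERIV_pos_inc_right[of h 1 0] by auto
  have h0: "h 0 = p \<bullet> \<xi>" using hamilton_curve_geodesic_flow(2)[OF g z] by (simp add: h_def)
  have "d \<le> l" if "is_return_time g p l" for l
  proof (rule ccontr)
    assume "\<not> d \<le> l"
    moreover have l: "0 < l" "fst (geodesic_flow g l (p, \<xi>)) = p"
      using that \<xi> flow_returns_iff[OF \<xi>] by (auto simp: is_return_time_def)
    ultimately show False using d(2)[of l] h0 by (simp add: h_def)
  qed
  with d(1) that show ?thesis by blast
qed

text \<open>A least element of a set of reals needs an attained infimum. Being at \<open>p\<close>
  is a closed condition on the time, and the lower bound replaces the open condition
  \<open>0 < l\<close> by a closed one.\<close>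

lemma first_return_time:
  assumes "self_focal g p" shows "is_return_time g p (first_return_time g p)"
proof -
  obtain \<epsilon> where \<epsilon>: "0 < \<epsilon>" "\<And>l. is_return_time g p l \<Longrightarrow> \<epsilon> \<le> l" 
    by (rule return_times_bounded_below) (rule that)
  define S where "S = {l. is_return_time g p l}"
  have S_eq: "S = {\<epsilon>..} \<inter> (\<Inter>\<xi>\<in>cosphere_fiber g p. {l. fst (geodesic_flow g l (p, \<xi>)) = p})"
    using \<epsilon> flow_returns_iff by (auto simp: S_def is_return_time_def dest: less_le_trans)
  have cont: "continuous_on UNIV (\<lambda>l. fst (geodesic_flow g l (p, \<xi>)))" if "\<xi> \<in> cosphere_fiber g p" for \<xi>
    using has_vector_derivative_continuous[OF flow_has_vector_derivative[OF that]]
    by (intro continuous_on_fst) (simp add: continuous_on_eq_continuous_at)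
  have "closed S" unfolding S_eq
    by (intro closed_Int closed_INT ballI closed_atLeast closed_Collect_eq cont continuous_on_const)
  moreover have "S \<noteq> {}" using assms by (auto simp: S_def self_focal_def)
  moreover have bdd: "bdd_below S" using \<epsilon>(2) by (intro bdd_belowI[of _ \<epsilon>]) (simp add: S_def)
  ultimately have "Inf S \<in> S" by (intro closed_contains_Inf)
  moreover have "Inf S \<le> l" if "is_return_time g p l" for l
    using that bdd by (intro cInf_lower) (auto simp: S_def)
  ultimately have "first_return_time g p = Inf S"
    unfolding first_return_time_def by (intro Least_equality) (auto simp: S_def)
  then show ?thesis using \<open>Inf S \<in> S\<close> by (simp add: S_def)
qed

end

section \<open>Reversibility and analyticity of the first return map\<close>

locale self_focal_point = cosphere_circle +
  assumes focal: "self_focal g p"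
begin

abbreviation "T \<equiv> first_return_time g p"
abbreviation "ret \<equiv> first_return_map g p"

lemma T_pos: "0 < T"
  using first_return_time[OF focal] by (simp add: is_return_time_def)

lemma flow_T:
  assumes "\<xi> \<in> cosphere_fiber g p"
  shows "geodesic_flow g T (p, \<xi>) = (p, ret \<xi>)" "ret \<xi> \<in> cosphere_fiber g p"
  using first_return_time[OF focal] assms
  by (auto simp: is_return_time_def first_return_map_def prod_eq_iff mem_Times_iff)

lemma circ_fiber: "circ x \<in> cosphere_fiber g p"
  using range_circ by auto

lemma uminus_fiber: "\<xi> \<in> cosphere_fiber g p \<Longrightarrow> - \<xi> \<in> cosphere_fiber g p"
proof -
  assume "\<xi> \<in> cosphere_fiber g p"
  then obtain x where "\<xi> = circ x" unfolding range_circ[symmetric] by blast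
  then show "- \<xi> \<in> cosphere_fiber g p" using circ_fiber[of "x + pi"] by (simp add: circ_pi)
qed

text \<open>Run the geodesic loop backwards: it leaves \<open>p\<close> with covector
  \<open>- ret \<xi>\<close> and arrives after the same time with \<open>- \<xi>\<close>.\<close>

lemma ret_reverse:
  assumes \<xi>: "\<xi> \<in> cosphere_fiber g p" shows "ret (- ret \<xi>) = - \<xi>"
proof -
  have z: "(p, \<xi>) \<in> cosphere_bundle g" using \<xi> by (simp add: cosphere_fiber_def)
  define c where "c t = geodesic_flow g t (p, \<xi>)" for t
  have c: "hamilton_curve g c" "c 0 = (p, \<xi>)" "c T = (p, ret \<xi>)"
    using hamilton_curve_geodesic_flow(1,2)[OF g z] flow_T(1)[OF \<xi>] by (auto simp: c_def[abs_def])
  define c' where "c' t = (fst (c (T - t)), - snd (c (T - t)))" for t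
  have c': "hamilton_curve g c'" unfolding c'_def[abs_def] by (rule hamilton_curve_reverse[OF g c(1)])
  have c'0: "c' 0 = (p, - ret \<xi>)" using c(3) by (simp add: c'_def)
  have r: "- ret \<xi> \<in> cosphere_fiber g p" using uminus_fiber flow_T(2)[OF \<xi>] by blast
  then have "geodesic_flow g T (c' 0) = c' T"
    using c'0 by (intro geodesic_flow_eq[OF g c']) (simp add: cosphere_fiber_def)
  then show ?thesis using flow_T(1)[OF r] c'0 c(2) by (simp add: c'_def)
qed

lemma ret_inj: "\<xi> \<in> cosphere_fiber g p \<Longrightarrow> \<zeta> \<in> cosphere_fiber g p \<Longrightarrow> ret \<xi> = ret \<zeta> \<Longrightarrow> \<xi> = \<zeta>"
  using ret_reverse by (metis neg_equal_iff_equal)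

lemma param_analytic_ret: "param_analytic (\<lambda>x. ret (circ x)) x0"
  unfolding first_return_map_def by (rule param_analytic_circ_flow) (use T_pos in simp)

text \<open>Stands in for the difference between the square of \<open>ret\<close> and the identity.
  It contains \<open>ret\<close> only at parametrised points of the circle, so its analyticity in
  the angle follows directly from that of the flow.\<close>

definition ret_defect :: "real \<Rightarrow> real^3" where
  "ret_defect x = ret (circ x) + ret (circ (x + pi))"

lemma param_analytic_ret_defect: "param_analytic ret_defect x0"
  unfolding ret_defect_def[abs_def]
  by (rule param_analytic_add[OF param_analytic_ret param_analytic_shift[where f = "\<lambda>x. ret (circ x)", OF param_analytic_ret]])

text \<open>By reversibility \<open>ret\<close> sends \<open>- ret (- circ x)\<close> to
  \<open>circ x\<close>. By injectivity, \<open>ret (circ x)\<close> is sent there too exactly when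
  it equals that covector.\<close>

lemma ret_defect_zero_iff: "ret_defect x = 0 \<longleftrightarrow> ret (ret (circ x)) = circ x"
proof -
  have m: "- circ x \<in> cosphere_fiber g p" using uminus_fiber circ_fiber by blast
  have 1: "ret (- ret (- circ x)) = circ x" using ret_reverse[OF m] by simp
  have 2: "- ret (- circ x) \<in> cosphere_fiber g p" using uminus_fiber flow_T(2)[OF m] by blast
  have "ret_defect x = 0 \<longleftrightarrow> ret (circ x) = - ret (- circ x)"
    by (simp add: ret_defect_def circ_pi eq_neg_iff_add_eq_0)
  also have "\<dots> \<longleftrightarrow> ret (ret (circ x)) = circ x"
    using 1 2 ret_inj flow_T(2)[OF circ_fiber] by metis
  finally show ?thesis .
qed

text \<open>Coordinates in the coframe turn the return map into a continuous path of unit complex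
  numbers, whose angle has a continuous choice on the line.\<close>

lemma ret_lift:
  obtains F where "continuous_on UNIV F" "\<And>x. ret (circ x) = circ (F x)"
proof -
  have cont: "continuous_on UNIV (\<lambda>x. ret (circ x))"
    using param_analytic_isCont[OF param_analytic_ret] by (simp add: continuous_on_eq_continuous_at)
  define h where "h x = Complex (cometric g p (ret (circ x)) e) (cometric g p (ret (circ x)) f)" for x
  have "continuous_on UNIV h"
    unfolding h_def Complex_eq using continuous_on_compose2[OF continuous_cometric cont]
    by (intro continuous_intros) auto
  moreover have coords: "\<exists>y. ret (circ x) = circ y \<and> h x = cis y" for x
  proof -
    obtain y where y: "ret (circ x) = circ y" using flow_T(2)[OF circ_fiber] range_circ by (metis imageE)
    then have "h x = cis y" by (simp add: h_def circ_def cometric_coords cis.ctr)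
    then show ?thesis using y by blast
  qed
  then have "norm (h x) = 1" for x by (metis norm_cis)
  ultimately obtain F where F: "continuous_on UNIV F" "\<And>x. h x = cis (F x)" using unit_circle_lift by metis
  have "ret (circ x) = circ (F x)" for x
  proof -
    obtain y where y: "ret (circ x) = circ y" "h x = cis y" using coords by blast
    then have "cos y = cos (F x)" "sin y = sin (F x)" using F(2)[of x] by (auto simp: complex_eq_iff)
    then show ?thesis using y(1) by (simp add: circ_def)
  qed
  then show ?thesis using F(1) that by blast
qed

theorem ret_square_id:
  fixes \<nu> :: "(real^3) measure"
  assumes \<nu>: "sets \<nu> = sets (restrict_space borel (cosphere_fiber g p))" "prob_space \<nu>"
    and inv: "pullback_invariant ret \<nu>" and pts: "\<And>x. emeasure \<nu> {circ x} = 0"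
    and \<xi>: "\<xi> \<in> cosphere_fiber g p"
  shows "ret (ret \<xi>) = \<xi>"
proof -
  interpret prob_space \<nu> by fact
  obtain F where F: "continuous_on UNIV F" "\<And>x. ret (circ x) = circ (F x)" by (rule ret_lift) (rule that)
  have "\<exists>k::int. F (x + 2 * pi) = F x + 2 * pi * k" for x
  proof -
    have "circ x = circ (x + 2 * pi)" unfolding circ_eq_iff by (rule exI[of _ 1]) simp
    then have "circ (F x) = circ (F (x + 2 * pi))" using F(2) by metis
    then show ?thesis unfolding circ_eq_iff .
  qed
  moreover have "\<exists>k::int. F (F x + pi) = x + pi + 2 * pi * k" for x
  proof -
    have "circ (x + pi) = circ (F (F x + pi))"
      using ret_reverse[OF circ_fiber, of x] by (simp add: F(2) flip: circ_pi)
    then show ?thesis unfolding circ_eq_iff .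
  qed
  ultimately obtain x0 m where L: "strict_mono (\<lambda>x. F (F x))" "F (F x0) = x0 + 2 * pi * of_int m"
    "\<And>x. F (F (x + 2 * pi)) = F (F x) + 2 * pi"
    using reversible_lift[OF F(1)] by metis
  have "ret_defect x = 0" for x
  proof (rule ccontr)
    assume "ret_defect x \<noteq> 0"
    then have "finite {x \<in> {x0..x0 + 2 * pi}. ret_defect x = 0}"
      using param_analytic_zeros[OF param_analytic_ret_defect] by blast
    then have fin: "finite {x \<in> {x0..x0 + 2 * pi}. ret (ret (circ x)) = circ x}"
      by (simp only: ret_defect_zero_iff)
    have "emeasure \<nu> (range circ) = 0"
    proof (rule invariant_measure_null[OF continuous_circ circ_eq_iff _ finite_measure_axioms _ F(1,2) L(1,2) L(3) pts fin])
      show "sets \<nu> = sets (restrict_space borel (range circ))" using \<nu>(1) by (simp add: range_circ)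
      show "emeasure \<nu> (ret ` A) = emeasure \<nu> A" if "A \<in> sets \<nu>" for A
        using inv that by (simp add: pullback_invariant_def)
    qed
    moreover have "space \<nu> = range circ"
      using sets_eq_imp_space_eq[OF \<nu>(1)] by (simp add: range_circ space_restrict_space)
    ultimately show False using emeasure_space_1 by simp
  qed
  then show ?thesis using \<xi> ret_defect_zero_iff unfolding range_circ[symmetric] by auto
qed

text \<open>After two return times the phase point is the initial one. Velocity is a function of the
  phase point through the energy field, so it agrees as well.\<close>

lemma geodesic_closes:
  assumes sq: "\<And>\<xi>. \<xi> \<in> cosphere_fiber g p \<Longrightarrow> ret (ret \<xi>) = \<xi>"
    and \<gamma>: "unit_speed_geodesic g \<gamma>" "\<gamma> 0 = p"
  shows "\<gamma> (2 * T) = p" "vector_derivative \<gamma> (at (2 * T)) = vector_derivative \<gamma> (at 0)"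
proof -
  obtain c where c: "hamilton_curve g c" "\<And>t. c t \<in> cosphere_bundle g" and \<gamma>c: "\<gamma> = fst \<circ> c"
    using \<gamma>(1) unfolding unit_speed_geodesic_def by blast
  define \<xi> where "\<xi> = snd (c 0)"
  have c0: "c 0 = (p, \<xi>)" using \<gamma>(2) by (simp add: \<gamma>c \<xi>_def prod_eq_iff)
  then have \<xi>: "\<xi> \<in> cosphere_fiber g p" using c(2)[of 0] by (simp add: cosphere_fiber_def)
  have cT: "c T = (p, ret \<xi>)"
    using geodesic_flow_eq[OF g c(1) c(2), of T] flow_T(1)[OF \<xi>] by (simp add: c0)
  have "geodesic_flow g T (c (0 + T)) = c (T + T)"
    by (rule geodesic_flow_eq[OF g hamilton_curve_shift[OF c(1)] c(2)])
  then have c2T: "c (2 * T) = c 0"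
    using flow_T[OF flow_T(2)[OF \<xi>]] sq[OF \<xi>] by (simp add: cT c0)
  then show "\<gamma> (2 * T) = p" by (simp add: \<gamma>c c0)
  have "(\<gamma> has_vector_derivative fst (energy_field g (c t))) (at t)" for t
    using has_derivative_fst[OF hamilton_curve_energy_field[OF g c(1) c(2), of t, unfolded has_vector_derivative_def]]
    by (simp add: \<gamma>c o_def has_vector_derivative_def)
  then show "vector_derivative \<gamma> (at (2 * T)) = vector_derivative \<gamma> (at 0)"
    using c2T vector_derivative_at by metis
qed

end

section \<open>Points are null for a density on the circle, and the conclusion\<close>

theorem mainTheorem2:
  fixes g :: metric and p :: "real^3" and \<rho> :: "real^3 \<Rightarrow> real"
  assumes "real_analytic_metric g"
    and "p \<in> S2"
    and "self_focal g p"
    and "integrable (cosphere_measure g p) \<rho>"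
    and "AE \<xi> in cosphere_measure g p. 0 \<le> \<rho> \<xi>"
    and "prob_space (density (cosphere_measure g p) (\<lambda>\<xi>. ennreal (\<rho> \<xi>)))"
    and "pullback_invariant (first_return_map g p) (density (cosphere_measure g p) (\<lambda>\<xi>. ennreal (\<rho> \<xi>)))"
  shows "(\<forall>\<xi>\<in>cosphere_fiber g p. first_return_map g p (first_return_map g p \<xi>) = \<xi>) \<and>
    (\<forall>\<gamma>. unit_speed_geodesic g \<gamma> \<and> \<gamma> 0 = p \<longrightarrow>
       \<gamma> (2 * first_return_time g p) = p \<and>
       vector_derivative \<gamma> (at (2 * first_return_time g p)) = vector_derivative \<gamma> (at 0))"
proof -
  obtain b1 b2 where "tangent_frame g p b1 b2" using exists_tangent_frame[OF riem[OF assms(1)] assms(2)] .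
  then have "\<exists>b. orthonormal_coframe g p b" by (rule tangent_frame.exists_orthonormal_coframe)
  then have some: "orthonormal_coframe g p (SOME b. orthonormal_coframe g p b)" by (rule someI_ex)
  \<comment> \<open>The coframe must be the one chosen inside \<open>cosphere_measure\<close>, so
    that the measure is the image of Lebesgue measure under \<open>circ\<close> itself.\<close>
  obtain e f where some_eq: "(SOME b. orthonormal_coframe g p b) = (e, f)" by fastforce
  interpret self_focal_point g p e f
    by unfold_locales (use assms some some_eq in auto)
  define \<mu> where "\<mu> = cosphere_measure g p"
  define \<nu> where "\<nu> = density \<mu> (\<lambda>\<xi>. ennreal (\<rho> \<xi>))"
  have \<mu>: "\<mu> = distr (restrict_space lborel {0..<2*pi}) (restrict_space borel (cosphere_fiber g p)) circ"
    by (simp add: \<mu>_def cosphere_measure_def some_eq circ_def[abs_def])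
  have circ_meas: "circ \<in> measurable (restrict_space lborel {0..<2*pi}) (restrict_space borel (cosphere_fiber g p))"
  proof (rule measurable_restrict_space2)
    show "circ \<in> space (restrict_space lborel {0..<2*pi}) \<rightarrow> cosphere_fiber g p" using circ_fiber by simp
    show "circ \<in> borel_measurable (restrict_space lborel {0..<2*pi})"
      using borel_measurable_continuous_onI[OF continuous_circ]
      by (intro measurable_restrict_space1) simp
  qed
  have "emeasure \<nu> {circ x} = 0" for x
  proof -
    have A: "{circ x} \<in> sets (restrict_space borel (cosphere_fiber g p))"
      unfolding sets_restrict_space using circ_fiber[of x] by (auto intro!: image_eqI[where x = "{circ x}"])
    \<comment> \<open>A point of the circle has countably many angles, so it is null for arc length
      and for every density over it.\<close>
    have "circ -` {circ x} \<subseteq> range (\<lambda>k::int. x + 2 * pi * k)"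
    proof
      fix y assume "y \<in> circ -` {circ x}"
      then have "circ x = circ y" by simp
      then show "y \<in> range (\<lambda>k::int. x + 2 * pi * k)" unfolding circ_eq_iff by blast
    qed
    then have count: "countable (circ -` {circ x})" by (rule countable_subset) simp
    have "emeasure \<mu> {circ x} = emeasure (restrict_space lborel {0..<2*pi}) (circ -` {circ x} \<inter> {0..<2*pi})"
      unfolding \<mu> by (subst emeasure_distr[OF circ_meas A]) (simp add: space_restrict_space)
    also have "\<dots> = emeasure lborel (circ -` {circ x} \<inter> {0..<2*pi})"
      by (rule emeasure_restrict_space) auto
    also have "\<dots> = 0"
      using count by (intro emeasure_lborel_countable) (rule countable_Int1)
    finally have null: "{circ x} \<in> null_sets \<mu>" using A by (intro null_setsI) (simp_all add: \<mu>)
    have "AE \<xi> in \<mu>. \<xi> \<in> {circ x} \<longrightarrow> ennreal (\<rho> \<xi>) = 0"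
      using AE_not_in[OF null] by (rule eventually_mono) simp
    moreover have "(\<lambda>\<xi>. ennreal (\<rho> \<xi>)) \<in> borel_measurable \<mu>"
      using borel_measurable_integrable[OF assms(4)] unfolding \<mu>_def by simp
    ultimately have "{circ x} \<in> null_sets \<nu>"
      unfolding \<nu>_def using null_setsD2[OF null]
      by (subst null_sets_density_iff) simp_all
    then show ?thesis by (rule null_setsD1)
  qed
  moreover have "sets \<nu> = sets (restrict_space borel (cosphere_fiber g p))" by (simp add: \<nu>_def \<mu>)
  moreover have "prob_space \<nu>" "pullback_invariant ret \<nu>" using assms(6,7) by (simp_all add: \<nu>_def \<mu>_def)
  ultimately have sq: "ret (ret \<xi>) = \<xi>" if "\<xi> \<in> cosphere_fiber g p" for \<xi>
    using ret_square_id that by blast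
  then show ?thesis using geodesic_closes by blast
qed

end
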